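(* Let $m,n\ge 1$. The ML-degree $ML(m,n)$ of the bivariate multinomial $m\times n$ missing data problem is $$ML(m,n)=\sum_{k=0}^m\sum_{l=0}^n(-1)^{k+l}\binom{m}{k}\binom{n}{l}B(m-k,n-l),$$ where $B(\cdot,\cdot)$ denotes the negative index poly-Bernoulli numbers defined in the context.
   Context: For integers $k,l\ge 0$, the Stirling numbers of the second kind are $S(l,k)=\frac{1}{k!}\sum_{i=0}^k(-1)^{k-i}\binom{k}{i}i^l$ (with $0^0=1$), and the negative index poly-Bernoulli numbers are $B(l,k)=\sum_{i=0}^l(-1)^{l-i}\,i!\,S(l,i)\,(i+1)^k$. Notation: $[m]=\{1,\dots,m\}$; for an $m\times n$ matrix $p=(p_{ij})$, $p_{i+}=\sum_j p_{ij}$, $p_{+j}=\sum_i p_{ij}$, $p_{++}=\sum_{i,j}p_{ij}$. In the bivariate multinomial $m\times n$ missing data problem (data missing at random), $X_1\in[m]$ and $X_2\in[n]$ are discrete random variables with joint probabilities $p_{ij}=P(X_1=i,X_2=j)$. The data are a table of counts $T=(t_{ij})$ of complete observations, a vector of counts $R=(r_i)$ of observations of $X_1$ only, and a vector of counts $S=(s_j)$ of observations of $X_2$ only. The log-likelihood is $$\ell(R,S,T;p)=\sum_{i=1}^m\sum_{j=1}^n t_{ij}\log p_{ij}+\sum_{i=1}^m r_i\log p_{i+}+\sum_{j=1}^n s_j\log p_{+j},$$ to be maximized subject to $p\ge 0$ and $p_{++}=1$. The score (critical) equations are the equations for critical points of $\ell$ restricted to the hyperplane $p_{++}=1$: a complex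 solution is a matrix $p\in\mathbb{C}^{m\times n}$ with $p_{++}=1$ and all $p_{ij},p_{i+},p_{+j}$ nonzero at which the differential of $\ell$ vanishes along the hyperplane $p_{++}=1$. The ML-degree is the number of complex solutions of the score equations for generic data, i.e. for data $(R,S,T)$ outside some proper algebraic subset of the data space. *)

theory Defs
  imports "HOL-Analysis.Analysis" "HOL-Combinatorics.Stirling"
begin

section \<open>Negative index poly-Bernoulli numbers\<close>

lemma Stirling_explicit:
  "fact k * int (Stirling l k) = (\<Sum>i=0..k. (-1) ^ (k - i) * int (k choose i) * int i ^ l)"
proof (induction l k rule: Stirling.induct)
  case (2 k)
  have "(1 + (-1 :: int)) ^ Suc k = (\<Sum>i\<le>Suc k. of_nat (Suc k choose i) * 1 ^ i * (-1) ^ (Suc k - i))"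
    by (rule binomial_ring)
  then show ?case
    by (simp add: atLeast0AtMost mult.commute del: sum.atMost_Suc binomial_Suc_Suc)
next
  case (4 n k)
  have step: "(-1) ^ (Suc k - i) * int (Suc k choose i) * int i ^ Suc n =
      int (Suc k) * ((-1) ^ (Suc k - i) * int (Suc k choose i) * int i ^ n) +
      (if i \<le> k then int (Suc k) * ((-1) ^ (k - i) * int (k choose i) * int i ^ n) else 0)"
    if "i \<in> {0..Suc k}" for i
  proof (cases "i = Suc k")
    case False
    with that have i: "i \<le> k" by auto
    have "(Suc k - i) * (Suc k choose i) = Suc k * (k choose i)"
      using binomial_absorb_comp[of "Suc k" i] by simp
    then have "int (Suc k - i) * int (Suc k choose i) = int (Suc k) * int (k choose i)"
      by (metis of_nat_mult)
    moreover have "int (Suc k - i) = int (Suc k) - int i"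
      using i by simp
    ultimately have a: "int i * int (Suc k choose i) =
        int (Suc k) * int (Suc k choose i) - int (Suc k) * int (k choose i)"
      by (simp only: left_diff_distrib)
    have "(-1) ^ (Suc k - i) * int (Suc k choose i) * int i ^ Suc n =
        (-1) ^ (Suc k - i) * (int i * int (Suc k choose i)) * int i ^ n"
      by (simp only: power_Suc mult_ac)
    also have "\<dots> = int (Suc k) * ((-1) ^ (Suc k - i) * int (Suc k choose i) * int i ^ n) +
        int (Suc k) * ((-1) ^ (k - i) * int (k choose i) * int i ^ n)"
      unfolding a using i by (simp only: Suc_diff_le power_Suc) (simp add: algebra_simps del: binomial_Suc_Suc)
    finally show ?thesis using i by simp
  qed simp
  have "(\<Sum>i=0..Suc k. (-1) ^ (Suc k - i) * int (Suc k choose i) * int i ^ Suc n) =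
      int (Suc k) * (\<Sum>i=0..Suc k. (-1) ^ (Suc k - i) * int (Suc k choose i) * int i ^ n) +
      int (Suc k) * (\<Sum>i=0..k. (-1) ^ (k - i) * int (k choose i) * int i ^ n)"
    (is "?L = int (Suc k) * ?A + int (Suc k) * ?B")
  proof -
    have "?L = int (Suc k) * ?A +
        (\<Sum>i=0..Suc k. if i \<le> k then int (Suc k) * ((-1) ^ (k - i) * int (k choose i) * int i ^ n) else 0)"
      unfolding sum_distrib_left sum.distrib[symmetric] by (rule sum.cong[OF refl step])
    also have "(\<Sum>i=0..Suc k. if i \<le> k then int (Suc k) * ((-1) ^ (k - i) * int (k choose i) * int i ^ n) else 0)
        = int (Suc k) * ?B"
      by (simp add: sum_distrib_left)
    finally show ?thesis .
  qed
  also have "\<dots> = int (Suc k) * (fact (Suc k) * int (Stirling n (Suc k))) +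
      int (Suc k) * (fact k * int (Stirling n k))"
    by (simp only: 4)
  also have "\<dots> = fact (Suc k) * int (Stirling (Suc n) (Suc k))"
    by (simp add: algebra_simps)
  finally show ?case by simp
qed simp_all

definition poly_Bernoulli :: "nat \<Rightarrow> nat \<Rightarrow> int" where
  "poly_Bernoulli l k =
     (\<Sum>i=0..l. (-1) ^ (l - i) * fact i * int (Stirling l i) * int (i + 1) ^ k)"


section \<open>The log-likelihood and its critical points\<close>

text \<open>
  An \<open>m \<times> n\<close> matrix is an element of \<open>complex^'n^'m\<close>, with \<open>m = CARD('m)\<close> and
  \<open>n = CARD('n)\<close>.
\<close>

definition row_sum :: "complex^'n^'m \<Rightarrow> 'm \<Rightarrow> complex" where
  "row_sum p i = (\<Sum>j\<in>UNIV. p $ i $ j)"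

definition col_sum :: "complex^'n^'m \<Rightarrow> 'n \<Rightarrow> complex" where
  "col_sum p j = (\<Sum>i\<in>UNIV. p $ i $ j)"

definition total_sum :: "complex^'n^'m \<Rightarrow> complex" where
  "total_sum p = (\<Sum>i\<in>UNIV. \<Sum>j\<in>UNIV. p $ i $ j)"

text \<open>
  The principal logarithm is discontinuous on the negative real axis. The function
  \<open>log_branch a\<close> is a branch of the logarithm that is holomorphic near \<open>a \<noteq> 0\<close>; any two
  branches near \<open>a\<close> differ by a constant, so the choice does not affect differentials.
\<close>

definition log_branch :: "complex \<Rightarrow> complex \<Rightarrow> complex" where
  "log_branch a z = Ln a + Ln (z / a)"

lemma exp_log_branch: "a \<noteq> 0 \<Longrightarrow> z \<noteq> 0 \<Longrightarrow> exp (log_branch a z) = z"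
  by (simp add: log_branch_def exp_add)

lemma log_branch_has_field_derivative:
  "a \<noteq> 0 \<Longrightarrow> (log_branch a has_field_derivative 1 / a) (at a)"
  unfolding log_branch_def by (auto intro!: derivative_eq_intros)

text \<open>The log-likelihood, with the branches of the logarithms taken near the point \<open>q\<close>.\<close>

definition loglik ::
  "complex^'n^'m \<Rightarrow> complex^'m \<Rightarrow> complex^'n \<Rightarrow> complex^'n^'m \<Rightarrow> complex^'n^'m \<Rightarrow> complex" where
  "loglik q R S T p =
     (\<Sum>i\<in>UNIV. \<Sum>j\<in>UNIV. T $ i $ j * log_branch (q $ i $ j) (p $ i $ j))
     + (\<Sum>i\<in>UNIV. R $ i * log_branch (row_sum q i) (row_sum p i))
     + (\<Sum>j\<in>UNIV. S $ j * log_branch (col_sum q j) (col_sum p j))"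

definition score_solutions ::
  "complex^'m \<Rightarrow> complex^'n \<Rightarrow> complex^'n^'m \<Rightarrow> (complex^'n^'m) set" where
  "score_solutions R S T =
     {p. total_sum p = 1 \<and>
         (\<forall>i j. p $ i $ j \<noteq> 0) \<and> (\<forall>i. row_sum p i \<noteq> 0) \<and> (\<forall>j. col_sum p j \<noteq> 0) \<and>
         (\<exists>D. (loglik p R S T has_derivative D) (at p) \<and>
              (\<forall>v. total_sum v = 0 \<longrightarrow> D v = 0))}"


section \<open>The ML-degree\<close>

text \<open>
  The data space is the complex affine space of all triples \<open>(R, S, T)\<close>. Its polynomial
  functions are those generated over the complex numbers by the coordinates. The library's
  \<open>polynomial_function\<close> is not suitable here: on a complex space it also admits
  complex conjugates of coordinates.
\<close>

type_synonym ('m, 'n) data = "(complex^'m) \<times> (complex^'n) \<times> (complex^'n^'m)"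

inductive polynomial_on_data :: "(('m::finite, 'n::finite) data \<Rightarrow> complex) \<Rightarrow> bool" where
  const: "polynomial_on_data (\<lambda>_. c)"
| coord_R: "polynomial_on_data (\<lambda>(R, S, T). R $ i)"
| coord_S: "polynomial_on_data (\<lambda>(R, S, T). S $ j)"
| coord_T: "polynomial_on_data (\<lambda>(R, S, T). T $ i $ j)"
| add: "polynomial_on_data f \<Longrightarrow> polynomial_on_data g \<Longrightarrow> polynomial_on_data (\<lambda>x. f x + g x)"
| mult: "polynomial_on_data f \<Longrightarrow> polynomial_on_data g \<Longrightarrow> polynomial_on_data (\<lambda>x. f x * g x)"

definition algebraic_subset :: "('m::finite, 'n::finite) data set \<Rightarrow> bool" where
  "algebraic_subset A \<longleftrightarrow>
     (\<exists>F. (\<forall>f\<in>F. polynomial_on_data f) \<and> A = {x. \<forall>f\<in>F. f x = 0})"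

definition has_mldegree :: "'m::finite itself \<Rightarrow> 'n::finite itself \<Rightarrow> nat \<Rightarrow> bool" where
  "has_mldegree _ _ d \<longleftrightarrow>
     (\<exists>A :: ('m, 'n) data set. algebraic_subset A \<and> A \<noteq> UNIV \<and>
        (\<forall>R S T. (R, S, T) \<notin> A \<longrightarrow>
           finite (score_solutions R S T) \<and> card (score_solutions R S T) = d))"

text \<open>
  Meaningful only together with \<open>has_mldegree\<close> for some \<open>d\<close>; such a \<open>d\<close> is unique because
  two proper algebraic subsets do not cover the data space.
\<close>

definition mldegree :: "'m::finite itself \<Rightarrow> 'n::finite itself \<Rightarrow> nat" where
  "mldegree M N = (THE d. has_mldegree M N d)"

end

theory Submission
  imports Defs
begin

text \<open>
  Let \<open>N\<close> be the total of all counts. At a solution of the score equations the Lagrange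
  multiplier is \<open>N\<close>, and in the coordinates \<open>a\<^sub>i = R\<^sub>i / (N p\<^sub>i\<^sub>+)\<close>,
  \<open>b\<^sub>j = 1 - S\<^sub>j / (N p\<^sub>+\<^sub>j)\<close> the equations say that \<open>p\<^sub>i\<^sub>j = T\<^sub>i\<^sub>j / (N (b\<^sub>j - a\<^sub>i))\<close>
  and that \<open>(a, b)\<close> is a critical point of
  \<open>\<Prod>a\<^sub>i\<^bsup>R\<^sub>i\<^esup> \<Prod>(1 - b\<^sub>j)\<^bsup>S\<^sub>j\<^esup> \<Prod>(b\<^sub>j - a\<^sub>i)\<^bsup>T\<^sub>i\<^sub>j\<^esup>\<close>. This function lives on the complement of the
  hyperplanes \<open>a\<^sub>i = 0\<close>, \<open>b\<^sub>j = 1\<close>, \<open>a\<^sub>i = b\<^sub>j\<close>. Its critical equations can be solved for \<open>R\<close>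
  and \<open>S\<close>, so for data with nonzero entries and nonzero \<open>N\<close> the solutions correspond to the fibre
  over \<open>(R, S, T)\<close> of an explicit rational map \<open>(a, b, T) \<mapsto> (R, S, T)\<close> between spaces of equal
  dimension (\<open>score_solutions_bij_fibre\<close>).

  Two hypersurfaces in the data space are discarded. Off the first one (\<open>resonance\<close>, a union of
  hyperplanes) the map is proper: a solution running to infinity or to the boundary would
  produce a cluster of the points \<open>0, 1, a\<^sub>i, b\<^sub>j\<close> much smaller than its distance to the other
  points, and summing the critical equations over the cluster would force the total exponent
  inside it to vanish (\<open>fibre_sequence_limit\<close>). The second one contains the image of the
  zero set of the Jacobian determinant. It exists because the Jacobian is
  algebraic over the components of the map: \<open>d + 1\<close> rational functions of \<open>d\<close> variables
  satisfy a polynomial relation (\<open>discriminant_exists\<close>). Off both hypersurfaces the map is a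
  proper local homeomorphism, so the fibres are finite and their cardinality is locally
  constant. A complex line minus finitely many points is connected, hence the cardinality is
  constant (\<open>card_fibre_generically_constant\<close>).

  It remains to count the fibre over one generic point with positive real entries. There the
  extremal imaginary part of the points \<open>a\<^sub>i, b\<^sub>j\<close> must be zero, so all solutions are real;
  each bounded region of the real arrangement contains exactly one, because the logarithm of
  the function above is strictly concave there and tends to minus infinity at the boundary; and
  the other regions contain none. A bounded region is determined by the relation \<open>a\<^sub>i < b\<^sub>j\<close>,
  and the relations that occur are those whose rows form a chain and which have neither an empty
  row nor an empty column (\<open>card_fibre_real_data\<close>). Splitting off the full rows recursively shows that there are
  \<open>\<Sum>k. (k!)\<^sup>2 S(m,k) S(n,k)\<close> of them (\<open>card_staircases\<close>), and binomial inversion turns the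
  right-hand side of the theorem into the same sum (\<open>sum_poly_Bernoulli\<close>).
\<close>

section \<open>Polynomial functions on the data space\<close>

text \<open>
  A single index type for all coordinates of the data space, so that monomials and lines can be
  described uniformly; its cardinality is the dimension.
\<close>

type_synonym ('m, 'n) coords = "'m + 'n + 'm \<times> 'n"

fun coord :: "('m::finite, 'n::finite) coords \<Rightarrow> ('m, 'n) data \<Rightarrow> complex" where
  "coord (Inl i) (R, S, T) = R $ i"
| "coord (Inr (Inl j)) (R, S, T) = S $ j"
| "coord (Inr (Inr (i, j))) (R, S, T) = T $ i $ j"

definition of_coords :: "(('m::finite, 'n::finite) coords \<Rightarrow> complex) \<Rightarrow> ('m, 'n) data" where
  "of_coords f = (\<chi> i. f (Inl i), \<chi> j. f (Inr (Inl j)), \<chi> i j. f (Inr (Inr (i, j))))"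

lemma coord_of_coords [simp]: "coord k (of_coords f) = f k"
  by (cases "(k, of_coords f)" rule: coord.cases) (auto simp: of_coords_def)

lemma of_coords_coord [simp]: "of_coords (\<lambda>k. coord k x) = x"
  by (cases x) (simp add: of_coords_def vec_eq_iff)

lemma polynomial_coord: "polynomial_on_data (coord k)"
proof (cases k)
  case (Inl i)
  then have "coord k = (\<lambda>(R, S, T). R $ i)" by (auto simp: fun_eq_iff)
  then show ?thesis by (simp add: polynomial_on_data.coord_R)
next
  case (Inr k')
  show ?thesis
  proof (cases k')
    case (Inl j)
    then have "coord k = (\<lambda>(R, S, T). S $ j)" using Inr by (auto simp: fun_eq_iff)
    then show ?thesis by (simp add: polynomial_on_data.coord_S)
  next
    case 2: (Inr ij)
    then have "coord k = (\<lambda>(R, S, T). T $ fst ij $ snd ij)" using Inr by (cases ij) (auto simp: fun_eq_iff)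
    then show ?thesis by (simp add: polynomial_on_data.coord_T)
  qed
qed

lemma polynomial_on_data_induct [consumes 1, case_names const coord add mult]:
  assumes "polynomial_on_data f"
    and "\<And>c. P (\<lambda>_. c)" "\<And>k. P (coord k)"
    and "\<And>f g. P f \<Longrightarrow> P g \<Longrightarrow> P (\<lambda>x. f x + g x)"
    and "\<And>f g. P f \<Longrightarrow> P g \<Longrightarrow> P (\<lambda>x. f x * g x)"
  shows "P f"
  using assms(1)
proof induction
  case (coord_R i)
  have "(\<lambda>(R, S, T). R $ i) = coord (Inl i)" by (auto simp: fun_eq_iff)
  then show ?case using assms(3) by metis
next
  case (coord_S j)
  have "(\<lambda>(R, S, T). S $ j) = coord (Inr (Inl j))" by (auto simp: fun_eq_iff)
  then show ?case using assms(3) by metis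
next
  case (coord_T i j)
  have "(\<lambda>(R, S, T). T $ i $ j) = coord (Inr (Inr (i, j)))" by (auto simp: fun_eq_iff)
  then show ?case using assms(3) by metis
qed (use assms in auto)

lemma polynomial_sum:
  "(\<And>a. a \<in> A \<Longrightarrow> polynomial_on_data (f a)) \<Longrightarrow> polynomial_on_data (\<lambda>x. \<Sum>a\<in>A. f a x)"
  by (induction A rule: infinite_finite_induct)
    (auto intro: polynomial_on_data.const polynomial_on_data.add)

lemma polynomial_prod:
  "(\<And>a. a \<in> A \<Longrightarrow> polynomial_on_data (f a)) \<Longrightarrow> polynomial_on_data (\<lambda>x. \<Prod>a\<in>A. f a x)"
  by (induction A rule: infinite_finite_induct)
    (auto intro: polynomial_on_data.const polynomial_on_data.mult)

lemma polynomial_power: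
  "polynomial_on_data f \<Longrightarrow> polynomial_on_data (\<lambda>x. f x ^ k)"
  by (induction k) (auto intro: polynomial_on_data.const polynomial_on_data.mult)

lemma polynomial_minus:
  "polynomial_on_data f \<Longrightarrow> polynomial_on_data (\<lambda>x. - f x)"
  using polynomial_on_data.mult[OF polynomial_on_data.const[of "-1"]] by simp

lemma polynomial_diff:
  "polynomial_on_data f \<Longrightarrow> polynomial_on_data g \<Longrightarrow> polynomial_on_data (\<lambda>x. f x - g x)"
  using polynomial_on_data.add[of f "\<lambda>x. - g x"] polynomial_minus[of g] by simp

lemmas polynomial_intros = polynomial_on_data.const polynomial_coord polynomial_on_data.add
  polynomial_on_data.mult polynomial_sum polynomial_prod polynomial_power polynomial_minus
  polynomial_diff

definition line :: "('m::finite, 'n::finite) data \<Rightarrow> (('m, 'n) coords \<Rightarrow> complex) \<Rightarrow> complex \<Rightarrow> ('m, 'n) data"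
  where "line x v s = of_coords (\<lambda>k. coord k x + s * v k)"

lemma coord_line [simp]: "coord k (line x v s) = coord k x + s * v k"
  by (simp add: line_def)

lemma line_0 [simp]: "line x v 0 = x"
  by (simp add: line_def)

lemma line_1: "line x (\<lambda>k. coord k y - coord k x) 1 = y"
  by (simp add: line_def)

lemma polynomial_on_line:
  assumes "polynomial_on_data f"
  shows "\<exists>p. \<forall>s. f (line x v s) = poly p s"
  using assms
proof (induction rule: polynomial_on_data_induct)
  case (const c)
  show ?case by (rule exI[of _ "[:c:]"]) simp
next
  case (coord k)
  show ?case by (rule exI[of _ "[:coord k x, v k:]"]) simp
next
  case (add f g)
  then obtain p q where "\<And>s. f (line x v s) = poly p s" "\<And>s. g (line x v s) = poly q s" by blast
  then show ?case by (intro exI[of _ "p + q"]) simp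
next
  case (mult f g)
  then obtain p q where "\<And>s. f (line x v s) = poly p s" "\<And>s. g (line x v s) = poly q s" by blast
  then show ?case by (intro exI[of _ "p * q"]) simp
qed

text \<open>
  Polynomial functions form an integral domain: on the complex line through a point where the
  first one does not vanish and a point where the second one does not vanish, each of them has
  only finitely many zeros.
\<close>

lemma polynomials_common_nonzero:
  assumes f: "polynomial_on_data f" and g: "polynomial_on_data g"
    and "f x \<noteq> 0" and "g y \<noteq> 0"
  shows "\<exists>z. f z \<noteq> 0 \<and> g z \<noteq> 0"
proof -
  let ?L = "line x (\<lambda>k. coord k y - coord k x)"
  obtain p where p: "\<And>s. f (?L s) = poly p s" using polynomial_on_line[OF f] by metis
  obtain q where q: "\<And>s. g (?L s) = poly q s" using polynomial_on_line[OF g] by metis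
  have "p \<noteq> 0" using p[of 0] assms by auto
  moreover have "q \<noteq> 0" using q[of 1] assms line_1[of x y] by auto
  ultimately have "finite {s. poly (p * q) s = 0}" by (intro poly_roots_finite) simp
  then obtain s where "s \<notin> {s. poly (p * q) s = 0}"
    using ex_new_if_finite[OF infinite_UNIV_char_0] by blast
  then have "f (?L s) \<noteq> 0 \<and> g (?L s) \<noteq> 0" by (simp add: p q)
  then show ?thesis by blast
qed

text \<open>
  The positive real points are Zariski dense: the coordinates can be made positive one at a time,
  since a nonzero univariate polynomial has only finitely many zeros.
\<close>

lemma polynomial_nonzero_pos_real:
  assumes f: "polynomial_on_data f" and "f x \<noteq> 0"
  shows "\<exists>t :: _ \<Rightarrow> real. (\<forall>k. t k > 0) \<and> f (of_coords (\<lambda>k. of_real (t k))) \<noteq> 0"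
proof -
  have "\<exists>y. f y \<noteq> 0 \<and> (\<forall>k\<in>K. \<exists>t>0. coord k y = complex_of_real t)" if "finite K" for K
    using that
  proof (induction K rule: finite_induct)
    case empty
    show ?case by (rule exI[of _ x]) (simp add: assms(2))
  next
    case (insert k K)
    then obtain y where y: "f y \<noteq> 0" "\<forall>k\<in>K. \<exists>t>0. coord k y = complex_of_real t" by blast
    let ?L = "line y (\<lambda>l. if l = k then 1 else 0)"
    obtain p where p: "\<And>s. f (?L s) = poly p s" using polynomial_on_line[OF f] by metis
    have "p \<noteq> 0" using p[of 0] y by auto
    then have "finite {s. poly p s = 0}" by (rule poly_roots_finite)
    moreover have "infinite ((\<lambda>t. complex_of_real t - coord k y) ` {0<..})"
      by (subst finite_image_iff) (auto simp: inj_on_def infinite_Ioi)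
    ultimately have "\<not> (\<lambda>t. complex_of_real t - coord k y) ` {0<..} \<subseteq> {s. poly p s = 0}"
      using finite_subset by blast
    then obtain s where "s \<in> (\<lambda>t. complex_of_real t - coord k y) ` {0<..}" "poly p s \<noteq> 0"
      by blast
    then obtain t where t: "t > 0" "poly p (of_real t - coord k y) \<noteq> 0" by auto
    show ?case
      by (rule exI[of _ "?L (of_real t - coord k y)"]) (use p t y insert(2) in auto)
  qed
  from this[of UNIV] obtain y where y: "f y \<noteq> 0" "\<forall>k. \<exists>t>0. coord k y = complex_of_real t" by auto
  then obtain t where t: "\<And>k. t k > 0" "\<And>k. coord k y = complex_of_real (t k)" by metis
  then have "y = of_coords (\<lambda>k. of_real (t k))" using of_coords_coord[of y] by simp
  then show ?thesis using y(1) t(1) by (intro exI[of _ t]) simp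
qed

subsection \<open>Monomials and degrees\<close>

definition exponents :: "nat \<Rightarrow> ('k \<Rightarrow> nat) set" where
  "exponents D = (UNIV \<rightarrow>\<^sub>E {..D})"

lemma finite_exponents [simp]: "finite (exponents D :: ('k::finite \<Rightarrow> nat) set)"
  by (simp add: exponents_def finite_PiE)

lemma card_exponents: "card (exponents D :: ('k::finite \<Rightarrow> nat) set) = Suc D ^ CARD('k)"
  by (simp add: exponents_def card_PiE)

lemma exponents_iff: "\<alpha> \<in> exponents D \<longleftrightarrow> (\<forall>k. \<alpha> k \<le> D)"
  by (auto simp: exponents_def)

definition monomial :: "('k::finite \<Rightarrow> nat) \<Rightarrow> ('k \<Rightarrow> complex) \<Rightarrow> complex" where
  "monomial \<alpha> z = (\<Prod>k\<in>UNIV. z k ^ \<alpha> k)"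

text \<open>
  The degree is bounded in each variable separately. The exponent vectors then form a
  box, whose cardinality is an exact power, and no binomial estimates are needed in the dimension
  count below.
\<close>

definition degrees_le :: "nat \<Rightarrow> (('m::finite, 'n::finite) data \<Rightarrow> complex) \<Rightarrow> bool" where
  "degrees_le D f \<longleftrightarrow> (\<exists>c. \<forall>x. f x = (\<Sum>\<alpha>\<in>exponents D. c \<alpha> * monomial \<alpha> (\<lambda>k. coord k x)))"

lemma degrees_le_zero: "degrees_le D (\<lambda>_. 0)"
  unfolding degrees_le_def by (rule exI[of _ "\<lambda>_. 0"]) simp

lemma degrees_le_add: "degrees_le D f \<Longrightarrow> degrees_le D g \<Longrightarrow> degrees_le D (\<lambda>x. f x + g x)"
  unfolding degrees_le_def
proof (elim exE)
  fix c c'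
  assume "\<forall>x. f x = (\<Sum>\<alpha>\<in>exponents D. c \<alpha> * monomial \<alpha> (\<lambda>k. coord k x))"
    "\<forall>x. g x = (\<Sum>\<alpha>\<in>exponents D. c' \<alpha> * monomial \<alpha> (\<lambda>k. coord k x))"
  then show "\<exists>c. \<forall>x. f x + g x = (\<Sum>\<alpha>\<in>exponents D. c \<alpha> * monomial \<alpha> (\<lambda>k. coord k x))"
    by (intro exI[of _ "\<lambda>\<alpha>. c \<alpha> + c' \<alpha>"]) (simp add: distrib_right sum.distrib)
qed

lemma degrees_le_sum: "(\<And>a. a \<in> A \<Longrightarrow> degrees_le D (f a)) \<Longrightarrow> degrees_le D (\<lambda>x. \<Sum>a\<in>A. f a x)"
  by (induction A rule: infinite_finite_induct) (auto intro: degrees_le_zero degrees_le_add)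

lemma degrees_le_monomial:
  assumes "\<alpha> \<in> exponents D"
  shows "degrees_le D (\<lambda>x. c * monomial \<alpha> (\<lambda>k. coord k x))"
  unfolding degrees_le_def
  by (rule exI[of _ "\<lambda>\<beta>. if \<beta> = \<alpha> then c else 0"]) (simp add: assms if_distrib[of "\<lambda>t. t * _"] cong: if_cong)

lemma degrees_le_mult:
  assumes "degrees_le D f" "degrees_le E g"
  shows "degrees_le (D + E) (\<lambda>x. f x * g x)"
proof -
  obtain c where c: "\<And>x. f x = (\<Sum>\<alpha>\<in>exponents D. c \<alpha> * monomial \<alpha> (\<lambda>k. coord k x))"
    using assms(1) unfolding degrees_le_def by blast
  obtain d where d: "\<And>x. g x = (\<Sum>\<alpha>\<in>exponents E. d \<alpha> * monomial \<alpha> (\<lambda>k. coord k x))"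
    using assms(2) unfolding degrees_le_def by blast
  have "f x * g x = (\<Sum>\<alpha>\<in>exponents D. \<Sum>\<beta>\<in>exponents E.
      (c \<alpha> * d \<beta>) * monomial (\<lambda>k. \<alpha> k + \<beta> k) (\<lambda>k. coord k x))" for x
    unfolding c d sum_product
    by (intro sum.cong refl) (simp add: monomial_def power_add prod.distrib)
  moreover have "degrees_le (D + E) (\<lambda>x. \<Sum>\<alpha>\<in>exponents D. \<Sum>\<beta>\<in>exponents E.
      (c \<alpha> * d \<beta>) * monomial (\<lambda>k. \<alpha> k + \<beta> k) (\<lambda>k. coord k x))"
    by (intro degrees_le_sum degrees_le_monomial) (auto simp: exponents_iff add_mono)
  ultimately show ?thesis by simp
qed

lemma degrees_le_const: "degrees_le 0 (\<lambda>_. c)"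
  using degrees_le_monomial[of "\<lambda>_. 0" 0 c] by (simp add: monomial_def exponents_iff)

lemma degrees_le_mono:
  assumes "degrees_le D f" "D \<le> E"
  shows "degrees_le E f"
proof -
  have "degrees_le (E - D) (\<lambda>_. 1)"
    using degrees_le_monomial[of "\<lambda>_. 0" "E - D" 1] by (simp add: monomial_def exponents_iff)
  from degrees_le_mult[OF this assms(1)] show ?thesis using assms(2) by simp
qed

lemma degrees_le_power: "degrees_le D f \<Longrightarrow> degrees_le (k * D) (\<lambda>x. f x ^ k)"
  by (induction k) (auto intro: degrees_le_const degrees_le_mult)

lemma degrees_le_prod:
  "finite A \<Longrightarrow> (\<And>a. a \<in> A \<Longrightarrow> degrees_le D (f a)) \<Longrightarrow> degrees_le (card A * D) (\<lambda>x. \<Prod>a\<in>A. f a x)"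
  by (induction A rule: finite_induct) (auto intro: degrees_le_const degrees_le_mult)

lemma polynomial_degrees_le:
  assumes "polynomial_on_data f"
  shows "\<exists>D. degrees_le D f"
  using assms
proof (induction rule: polynomial_on_data_induct)
  case (const c)
  then show ?case using degrees_le_const by blast
next
  case (coord k)
  have "coord k x = 1 * monomial (\<lambda>l. if l = k then 1 else 0) (\<lambda>l. coord l x)" for x
    by (simp add: monomial_def if_distrib[of "\<lambda>t. _ ^ t"] cong: if_cong)
  then have eq: "coord k = (\<lambda>x. 1 * monomial (\<lambda>l. if l = k then 1 else 0) (\<lambda>l. coord l x))" by blast
  show ?case
    by (subst eq, rule exI[of _ 1], rule degrees_le_monomial) (simp add: exponents_iff)
next
  case (add f g)
  then obtain D E where "degrees_le D f" "degrees_le E g" by blast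
  then have "degrees_le (max D E) f" "degrees_le (max D E) g" by (auto intro: degrees_le_mono)
  then show ?case by (blast intro: degrees_le_add)
next
  case (mult f g)
  then show ?case by (blast intro: degrees_le_mult)
qed

lemma polynomial_monomial:
  "polynomial_on_data (\<lambda>x. monomial \<alpha> (\<lambda>k. coord k x))"
  unfolding monomial_def by (intro polynomial_intros)

text \<open>
  By induction on the set of variables: for fixed values of the other variables the sum is a
  univariate polynomial in the new variable, so each of its coefficients vanishes, and the
  coefficients are combinations of monomials in fewer variables.
\<close>

lemma monomials_independent:
  assumes "finite I"
    and "\<And>z :: 'k \<Rightarrow> complex. (\<Sum>\<alpha>\<in>I \<rightarrow>\<^sub>E {..D}. c \<alpha> * (\<Prod>i\<in>I. z i ^ \<alpha> i)) = 0"
    and "\<alpha> \<in> I \<rightarrow>\<^sub>E {..D}"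
  shows "c \<alpha> = 0"
  using assms
proof (induction I arbitrary: c \<alpha> rule: finite_induct)
  case empty
  then show ?case by simp
next
  case (insert i I)
  let ?X = "I \<rightarrow>\<^sub>E {..D}"
  have inj: "inj_on (\<lambda>(e, \<beta>). \<beta>(i := e)) ({..D} \<times> ?X)"
    using insert(2) by (rule inj_combinator)
  have img: "insert i I \<rightarrow>\<^sub>E {..D} = (\<lambda>(e, \<beta>). \<beta>(i := e)) ` ({..D} \<times> ?X)"
    by (rule PiE_insert_eq)
  define q where "q z e = (\<Sum>\<beta>\<in>?X. c (\<beta>(i := e)) * (\<Prod>l\<in>I. z l ^ \<beta> l))" for z :: "'k \<Rightarrow> complex" and e
  have zero: "q z e = 0" if "e \<le> D" for z e
  proof -
    have "(\<Sum>e\<le>D. q z e * w ^ e) = 0" for w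
    proof -
      have "0 = (\<Sum>\<alpha>\<in>insert i I \<rightarrow>\<^sub>E {..D}. c \<alpha> * (\<Prod>l\<in>insert i I. (z(i := w)) l ^ \<alpha> l))"
        using insert.prems(1)[of "z(i := w)"] by simp
      also have "\<dots> = (\<Sum>(e, \<beta>)\<in>{..D} \<times> ?X. c (\<beta>(i := e)) * (\<Prod>l\<in>insert i I. (z(i := w)) l ^ (\<beta>(i := e)) l))"
        unfolding img by (subst sum.reindex[OF inj]) (simp add: case_prod_unfold comp_def)
      also have "\<dots> = (\<Sum>e\<le>D. \<Sum>\<beta>\<in>?X. c (\<beta>(i := e)) * (\<Prod>l\<in>insert i I. (z(i := w)) l ^ (\<beta>(i := e)) l))"
        by (simp add: sum.cartesian_product)
      also have "\<dots> = (\<Sum>e\<le>D. q z e * w ^ e)"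
        unfolding q_def sum_distrib_right
      proof (intro sum.cong refl)
        fix e \<beta>
        have "(\<Prod>l\<in>I. (z(i := w)) l ^ (\<beta>(i := e)) l) = (\<Prod>l\<in>I. z l ^ \<beta> l)"
          using insert(2) by (intro prod.cong) auto
        then show "c (\<beta>(i := e)) * (\<Prod>l\<in>insert i I. (z(i := w)) l ^ (\<beta>(i := e)) l) =
          c (\<beta>(i := e)) * (\<Prod>l\<in>I. z l ^ \<beta> l) * w ^ e"
          using insert(1,2) by simp
      qed
      finally show ?thesis by simp
    qed
    then have "(\<forall>e\<le>D. q z e = 0)" using polyfun_eq_const[of "q z" D 0] polyfun_eq_0[of "q z" D] by simp
    then show ?thesis using that by simp
  qed
  obtain e \<beta> where \<alpha>: "\<alpha> = \<beta>(i := e)" "e \<le> D" "\<beta> \<in> ?X" using insert.prems(2) unfolding img by auto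
  show ?case
    using insert.IH[of "\<lambda>\<beta>. c (\<beta>(i := e))" \<beta>] zero[OF \<alpha>(2)] \<alpha> unfolding q_def by blast
qed

subsection \<open>Algebraic dependence\<close>

text \<open>
  Gaussian elimination of one equation, using a pivot \<open>a0\<close>.
\<close>

lemma homogeneous_system_nontrivial_solution:
  fixes M :: "'a \<Rightarrow> 'b \<Rightarrow> 'c::field"
  assumes "finite B" "finite A" "card B < card A"
  shows "\<exists>c. (\<exists>a\<in>A. c a \<noteq> 0) \<and> (\<forall>b\<in>B. (\<Sum>a\<in>A. c a * M a b) = 0)"
  using assms
proof (induction B arbitrary: A M rule: finite_induct)
  case empty
  then have "A \<noteq> {}" by auto
  then show ?case by (intro exI[of _ "\<lambda>_. 1"]) auto
next
  case (insert b B)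
  show ?case
  proof (cases "\<forall>a\<in>A. M a b = 0")
    case True
    have "card B < card A" using insert by simp
    then obtain c where "\<exists>a\<in>A. c a \<noteq> 0" "\<forall>b\<in>B. (\<Sum>a\<in>A. c a * M a b) = 0"
      using insert.IH[of A M] insert.prems by blast
    then show ?thesis using True by (intro exI[of _ c]) auto
  next
    case False
    then obtain a0 where a0: "a0 \<in> A" "M a0 b \<noteq> 0" by blast
    let ?A = "A - {a0}"
    have "card B < card ?A" using insert a0 by simp
    then obtain c where c: "\<exists>a\<in>?A. c a \<noteq> 0"
      "\<And>b'. b' \<in> B \<Longrightarrow> (\<Sum>a\<in>?A. c a * (M a b' - M a b / M a0 b * M a0 b')) = 0"
      using insert.IH[of ?A "\<lambda>a b'. M a b' - M a b / M a0 b * M a0 b'"] insert.prems by auto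
    define d where "d = c(a0 := - (\<Sum>a\<in>?A. c a * M a b) / M a0 b)"
    have split: "(\<Sum>a\<in>A. d a * M a b') = - (\<Sum>a\<in>?A. c a * M a b) / M a0 b * M a0 b' + (\<Sum>a\<in>?A. c a * M a b')" for b'
    proof -
      have "(\<Sum>a\<in>A. d a * M a b') = d a0 * M a0 b' + (\<Sum>a\<in>?A. d a * M a b')"
        using a0 insert.prems by (simp add: sum.remove)
      also have "(\<Sum>a\<in>?A. d a * M a b') = (\<Sum>a\<in>?A. c a * M a b')"
        by (rule sum.cong) (auto simp: d_def)
      finally show ?thesis by (simp add: d_def)
    qed
    have "(\<Sum>a\<in>A. d a * M a b') = 0" if "b' \<in> insert b B" for b'
    proof (cases "b' = b")
      case True
      then show ?thesis using split[of b] a0 by simp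
    next
      case False
      then have "b' \<in> B" using that by simp
      from c(2)[OF this] show ?thesis unfolding split
        by (simp add: sum_distrib_left sum_divide_distrib right_diff_distrib sum_subtractf mult_ac)
    qed
    moreover have "\<exists>a\<in>A. d a \<noteq> 0" using c(1) by (auto simp: d_def)
    ultimately show ?thesis by blast
  qed
qed

text \<open>
  The rational functions whose denominator is a power of \<open>h\<close>.
\<close>

definition regular_off :: "(('m::finite, 'n::finite) data \<Rightarrow> complex) \<Rightarrow> (('m, 'n) data \<Rightarrow> complex) \<Rightarrow> bool" where
  "regular_off h g \<longleftrightarrow>
     (\<exists>r P. polynomial_on_data P \<and> (\<forall>x. h x \<noteq> 0 \<longrightarrow> g x * h x ^ r = P x))"

lemma regular_off_polynomial: "polynomial_on_data g \<Longrightarrow> regular_off h g"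
  unfolding regular_off_def by (intro exI[of _ 0]) auto

lemma regular_off_add:
  assumes h: "polynomial_on_data h" and "regular_off h f" "regular_off h g"
  shows "regular_off h (\<lambda>x. f x + g x)"
proof -
  obtain r P where 1: "polynomial_on_data P" "\<And>x. h x \<noteq> 0 \<Longrightarrow> f x * h x ^ r = P x"
    using assms(2) unfolding regular_off_def by metis
  obtain s Q where 2: "polynomial_on_data Q" "\<And>x. h x \<noteq> 0 \<Longrightarrow> g x * h x ^ s = Q x"
    using assms(3) unfolding regular_off_def by metis
  have "polynomial_on_data (\<lambda>x. P x * h x ^ s + Q x * h x ^ r)"
    using 1(1) 2(1) h by (intro polynomial_intros)
  moreover have "(f x + g x) * h x ^ (r + s) = P x * h x ^ s + Q x * h x ^ r" if "h x \<noteq> 0" for x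
    unfolding 1(2)[OF that, symmetric] 2(2)[OF that, symmetric] by (simp add: power_add algebra_simps)
  ultimately show ?thesis unfolding regular_off_def
    by (intro exI[of _ "r + s"] exI[of _ "\<lambda>x. P x * h x ^ s + Q x * h x ^ r"]) auto
qed

lemma regular_off_mult:
  assumes "regular_off h f" "regular_off h g"
  shows "regular_off h (\<lambda>x. f x * g x)"
proof -
  obtain r P where 1: "polynomial_on_data P" "\<And>x. h x \<noteq> 0 \<Longrightarrow> f x * h x ^ r = P x"
    using assms(1) unfolding regular_off_def by metis
  obtain s Q where 2: "polynomial_on_data Q" "\<And>x. h x \<noteq> 0 \<Longrightarrow> g x * h x ^ s = Q x"
    using assms(2) unfolding regular_off_def by metis
  have "(f x * g x) * h x ^ (r + s) = P x * Q x" if "h x \<noteq> 0" for x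
    unfolding 1(2)[OF that, symmetric] 2(2)[OF that, symmetric] by (simp add: power_add algebra_simps)
  then show ?thesis unfolding regular_off_def using polynomial_on_data.mult[OF 1(1) 2(1)] by blast
qed

lemma regular_off_sum:
  assumes "polynomial_on_data h" "\<And>a. a \<in> A \<Longrightarrow> regular_off h (f a)"
  shows "regular_off h (\<lambda>x. \<Sum>a\<in>A. f a x)"
  using assms(2) by (induction A rule: infinite_finite_induct)
    (auto intro: regular_off_polynomial polynomial_on_data.const regular_off_add[OF assms(1)])

lemma regular_off_prod:
  assumes "\<And>a. a \<in> A \<Longrightarrow> regular_off h (f a)"
  shows "regular_off h (\<lambda>x. \<Prod>a\<in>A. f a x)"
  using assms by (induction A rule: infinite_finite_induct)
    (auto intro: regular_off_polynomial polynomial_on_data.const regular_off_mult)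

lemma regular_off_power: "regular_off h f \<Longrightarrow> regular_off h (\<lambda>x. f x ^ k)"
  using regular_off_prod[of "{..<k}" h "\<lambda>_. f"] by simp

lemma regular_off_no_zero_divisors:
  assumes h: "polynomial_on_data h" and "regular_off h f" "regular_off h g"
    and 0: "\<And>x. h x \<noteq> 0 \<Longrightarrow> f x * g x = 0" and g: "h y \<noteq> 0" "g y \<noteq> 0" and x: "h x \<noteq> 0"
  shows "f x = 0"
proof (rule ccontr)
  assume fx: "f x \<noteq> 0"
  obtain r P where 1: "polynomial_on_data P" "\<And>x. h x \<noteq> 0 \<Longrightarrow> f x * h x ^ r = P x"
    using assms(2) unfolding regular_off_def by metis
  obtain s Q where 2: "polynomial_on_data Q" "\<And>x. h x \<noteq> 0 \<Longrightarrow> g x * h x ^ s = Q x"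
    using assms(3) unfolding regular_off_def by metis
  have "P x * h x \<noteq> 0" using 1(2)[of x] x fx by (metis mult_eq_0_iff power_eq_0_iff)
  moreover have "Q y \<noteq> 0" using 2(2)[of y] g by (metis mult_eq_0_iff power_eq_0_iff)
  ultimately obtain z where z: "P z * h z \<noteq> 0" "Q z \<noteq> 0"
    using polynomials_common_nonzero[OF polynomial_on_data.mult[OF 1(1) h] 2(1)] by blast
  then have "h z \<noteq> 0" by auto
  then show False using 0[of z] z 1(2)[of z] 2(2)[of z] by auto
qed

text \<open>
  More rational functions than there are variables satisfy a polynomial relation. Cleared of
  denominators, the \<open>(D + 1)\<^sup>K\<close> monomials in \<open>K\<close> functions lie in a space of dimension
  \<open>O(D\<^sup>N)\<close>, where \<open>N < K\<close> is the number of variables.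
\<close>

lemma algebraic_dependence:
  fixes g :: "'k::finite \<Rightarrow> ('m::finite, 'n::finite) data \<Rightarrow> complex"
  assumes h: "polynomial_on_data h" and g: "\<And>k. regular_off h (g k)"
    and card: "CARD('k) > CARD(('m, 'n) coords)"
  shows "\<exists>D c. (\<exists>\<alpha>\<in>exponents D. c \<alpha> \<noteq> 0) \<and>
    (\<forall>x. h x \<noteq> 0 \<longrightarrow> (\<Sum>\<alpha>\<in>exponents D. c \<alpha> * monomial \<alpha> (\<lambda>k. g k x)) = 0)"
proof -
  have "\<exists>r P. polynomial_on_data P \<and> (\<forall>x. h x \<noteq> 0 \<longrightarrow> g k x * h x ^ r = P x)" for k
    using g[of k] unfolding regular_off_def .
  then obtain r P where P: "\<And>k. polynomial_on_data (P k)"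
    "\<And>k x. h x \<noteq> 0 \<Longrightarrow> g k x * h x ^ r k = P k x" by metis
  have "\<exists>e. degrees_le e (\<lambda>x. P k x)" for k using polynomial_degrees_le[OF P(1)] by simp
  then obtain e1 where e1: "\<And>k. degrees_le (e1 k) (P k)" by metis
  have "\<exists>e. degrees_le e (\<lambda>x. h x ^ r k)" for k by (intro polynomial_degrees_le polynomial_intros h)
  then obtain e2 where e2: "\<And>k. degrees_le (e2 k) (\<lambda>x. h x ^ r k)" by metis
  define e where "e = Max (range e1) + Max (range e2)"
  have e: "degrees_le e (P k)" "degrees_le e (\<lambda>x. h x ^ r k)" for k
  proof -
    have "e1 k \<le> Max (range e1)" "e2 k \<le> Max (range e2)" by (simp_all add: Max_ge)
    then have "e1 k \<le> e" "e2 k \<le> e" unfolding e_def by linarith+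
    then show "degrees_le e (P k)" "degrees_le e (\<lambda>x. h x ^ r k)"
      using degrees_le_mono[OF e1] degrees_le_mono[OF e2] by blast+
  qed
  define K where "K = CARD('k)"
  define N where "N = CARD(('m, 'n) coords)"
  \<comment> \<open>Since \<open>E + 1 \<le> (2Ke + 1) (D + 1)\<close>, the inequality \<open>(E + 1)\<^sup>N < (D + 1)\<^sup>K\<close> follows from
    \<open>(2Ke + 1)\<^sup>N < D + 1\<close>.\<close>
  define D where "D = (K * (2 * e) + 1) ^ N"
  define E where "E = K * (D * e + D * e)"
  define G where "G \<alpha> x = (\<Prod>k\<in>UNIV. P k x ^ \<alpha> k * (h x ^ r k) ^ (D - \<alpha> k))" for \<alpha> x
  have deg: "degrees_le E (G \<alpha>)" if "\<alpha> \<in> exponents D" for \<alpha>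
    unfolding G_def E_def K_def
  proof (rule degrees_le_prod)
    fix k
    have "\<alpha> k * e \<le> D * e" "(D - \<alpha> k) * e \<le> D * e" using that by (auto simp: exponents_iff)
    then show "degrees_le (D * e + D * e) (\<lambda>x. P k x ^ \<alpha> k * (h x ^ r k) ^ (D - \<alpha> k))"
      using degrees_le_mono[OF degrees_le_power[OF e(1)]] degrees_le_mono[OF degrees_le_power[OF e(2)]]
      by (intro degrees_le_mult)
  qed simp
  then have "\<forall>\<alpha>\<in>exponents D. \<exists>M. \<forall>x. G \<alpha> x = (\<Sum>\<beta>\<in>exponents E. M \<beta> * monomial \<beta> (\<lambda>k. coord k x))"
    unfolding degrees_le_def by blast
  from bchoice[OF this] obtain M where M: "\<And>\<alpha> x. \<alpha> \<in> exponents D \<Longrightarrow>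
      G \<alpha> x = (\<Sum>\<beta>\<in>exponents E. M \<alpha> \<beta> * monomial \<beta> (\<lambda>k. coord k x))"
    by blast
  have "Suc E ^ N \<le> ((K * (2 * e) + 1) * Suc D) ^ N"
    unfolding E_def by (intro power_mono) (auto simp: algebra_simps)
  also have "\<dots> = D * Suc D ^ N" by (simp only: power_mult_distrib D_def)
  also have "\<dots> < Suc D ^ Suc N" by simp
  also have "\<dots> \<le> Suc D ^ K" using card unfolding K_def N_def by (intro power_increasing) auto
  finally have "card (exponents E :: (('m, 'n) coords \<Rightarrow> nat) set) < card (exponents D :: ('k \<Rightarrow> nat) set)"
    by (simp add: card_exponents K_def N_def)
  then obtain c where c: "\<exists>\<alpha>\<in>exponents D. c \<alpha> \<noteq> 0"
    "\<And>\<beta>. \<beta> \<in> exponents E \<Longrightarrow> (\<Sum>\<alpha>\<in>exponents D. c \<alpha> * M \<alpha> \<beta>) = 0"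
    using homogeneous_system_nontrivial_solution[of "exponents E" "exponents D" M] by auto
  have "(\<Sum>\<alpha>\<in>exponents D. c \<alpha> * monomial \<alpha> (\<lambda>k. g k x)) = 0" if hx: "h x \<noteq> 0" for x
  proof -
    define H where "H = (\<Prod>k\<in>UNIV. (h x ^ r k) ^ D)"
    have H: "H \<noteq> 0" using hx by (simp add: H_def)
    have GH: "monomial \<alpha> (\<lambda>k. g k x) * H = G \<alpha> x" if "\<alpha> \<in> exponents D" for \<alpha>
    proof -
      have "(h x ^ r k) ^ D = (h x ^ r k) ^ \<alpha> k * (h x ^ r k) ^ (D - \<alpha> k)" for k
        using that by (simp add: exponents_iff flip: power_add)
      then show ?thesis unfolding monomial_def H_def G_def P(2)[OF hx, symmetric]
        by (simp add: power_mult_distrib mult.assoc flip: prod.distrib)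
    qed
    have "(\<Sum>\<alpha>\<in>exponents D. c \<alpha> * monomial \<alpha> (\<lambda>k. g k x)) * H = (\<Sum>\<alpha>\<in>exponents D. c \<alpha> * G \<alpha> x)"
      unfolding sum_distrib_right by (intro sum.cong refl) (simp add: GH mult.assoc)
    also have "\<dots> = (\<Sum>\<alpha>\<in>exponents D. \<Sum>\<beta>\<in>exponents E. c \<alpha> * M \<alpha> \<beta> * monomial \<beta> (\<lambda>k. coord k x))"
      by (intro sum.cong refl) (simp add: M sum_distrib_left mult.assoc)
    also have "\<dots> = (\<Sum>\<beta>\<in>exponents E. (\<Sum>\<alpha>\<in>exponents D. c \<alpha> * M \<alpha> \<beta>) * monomial \<beta> (\<lambda>k. coord k x))"
      by (subst sum.swap) (simp add: sum_distrib_right)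
    also have "\<dots> = 0" by (intro sum.neutral ballI) (simp add: c(2))
    finally show ?thesis using H by simp
  qed
  then show ?thesis using c(1) by blast
qed

text \<open>
  \<open>J\<close> is algebraic over the components of \<open>F\<close>. In a relation
  \<open>c\<^sub>r(F) J\<^sup>r + c\<^sub>r\<^sub>+\<^sub>1(F) J\<^sup>r\<^sup>+\<^sup>1 + \<dots> = 0\<close> with \<open>c\<^sub>r \<noteq> 0\<close> the factor \<open>J\<^sup>r\<close> can be cancelled,
  because there are no zero divisors; what remains shows that \<open>c\<^sub>r(F)\<close> vanishes wherever \<open>J\<close>
  does.
\<close>

lemma image_of_zero_set_not_dense:
  fixes F :: "('m::finite, 'n::finite) data \<Rightarrow> ('m, 'n) data"
  assumes h: "polynomial_on_data h" and F: "\<And>k. regular_off h (\<lambda>x. coord k (F x))"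
    and J: "regular_off h J" and y: "h y \<noteq> 0" "J y \<noteq> 0"
  shows "\<exists>q. polynomial_on_data q \<and> (\<exists>u. q u \<noteq> 0) \<and> (\<forall>x. h x \<noteq> 0 \<longrightarrow> J x = 0 \<longrightarrow> q (F x) = 0)"
proof -
  define g where "g k = (case k of None \<Rightarrow> J | Some k \<Rightarrow> (\<lambda>x. coord k (F x)))" for k
  have "regular_off h (g k)" for k using F J by (cases k) (auto simp: g_def)
  moreover have "CARD(('m, 'n) coords option) > CARD(('m, 'n) coords)" by (simp add: card_UNIV_option)
  ultimately obtain D c where c: "\<exists>\<alpha>\<in>exponents D. c \<alpha> \<noteq> 0"
    "\<And>x. h x \<noteq> 0 \<Longrightarrow> (\<Sum>\<alpha>\<in>exponents D. c \<alpha> * monomial \<alpha> (\<lambda>k. g k x)) = 0"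
    using algebraic_dependence[OF h, of g] by blast
  \<comment> \<open>\<open>None\<close> indexes the exponent of \<open>J\<close>, and \<open>r\<close> is the lowest power of \<open>J\<close> in the relation.\<close>
  define r where "r = (LEAST r. \<exists>\<alpha>\<in>exponents D. c \<alpha> \<noteq> 0 \<and> \<alpha> None = r)"
  have ex: "\<exists>\<alpha>\<in>exponents D. c \<alpha> \<noteq> 0 \<and> \<alpha> None = r"
    unfolding r_def by (rule LeastI_ex) (use c in blast)
  have least: "r \<le> \<alpha> None" if "\<alpha> \<in> exponents D" "c \<alpha> \<noteq> 0" for \<alpha>
    unfolding r_def by (rule Least_le) (use that in blast)
  have mono: "monomial \<alpha> (\<lambda>k. g k x) = J x ^ \<alpha> None * monomial (\<alpha> \<circ> Some) (\<lambda>k. coord k (F x))" for \<alpha> x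
    unfolding monomial_def UNIV_option_conv
    by (subst prod.insert) (auto simp: g_def prod.reindex)
  define G where "G x = (\<Sum>\<alpha>\<in>exponents D. c \<alpha> * (J x ^ (\<alpha> None - r) * monomial (\<alpha> \<circ> Some) (\<lambda>k. coord k (F x))))" for x
  have mono_regular: "regular_off h (\<lambda>x. monomial \<alpha> (\<lambda>k. coord k (F x)))" for \<alpha>
    unfolding monomial_def by (intro regular_off_prod regular_off_power F)
  then have "regular_off h G"
    unfolding G_def by (intro regular_off_sum regular_off_mult regular_off_power J mono_regular
        regular_off_polynomial[OF polynomial_on_data.const] h)
  moreover have "G x * J x ^ r = 0" if "h x \<noteq> 0" for x
  proof -
    have "G x * J x ^ r = (\<Sum>\<alpha>\<in>exponents D. c \<alpha> * monomial \<alpha> (\<lambda>k. g k x))"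
      unfolding G_def sum_distrib_right
    proof (intro sum.cong refl)
      fix \<alpha> :: "('m, 'n) coords option \<Rightarrow> nat" assume \<alpha>: "\<alpha> \<in> exponents D"
      show "c \<alpha> * (J x ^ (\<alpha> None - r) * monomial (\<alpha> \<circ> Some) (\<lambda>k. coord k (F x))) * J x ^ r =
        c \<alpha> * monomial \<alpha> (\<lambda>k. g k x)"
      proof (cases "c \<alpha> = 0")
        case False
        then have "J x ^ \<alpha> None = J x ^ (\<alpha> None - r) * J x ^ r"
          using least[OF \<alpha>] by (simp flip: power_add)
        then show ?thesis by (simp add: mono)
      qed simp
    qed
    then show ?thesis using c(2)[OF that] by simp
  qed
  ultimately have G0: "G x = 0" if "h x \<noteq> 0" for x
    using regular_off_no_zero_divisors[OF h, of G "\<lambda>x. J x ^ r" y x] regular_off_power[OF J] y that by auto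
  define d where "d \<beta> = c (\<lambda>k. case k of None \<Rightarrow> r | Some l \<Rightarrow> \<beta> l)" for \<beta>
  define q where "q u = (\<Sum>\<beta>\<in>exponents D. d \<beta> * monomial \<beta> (\<lambda>k. coord k u))" for u :: "('m, 'n) data"
  obtain \<alpha> where \<alpha>: "\<alpha> \<in> exponents D" "c \<alpha> \<noteq> 0" "\<alpha> None = r" using ex by blast
  have "r \<le> D" using \<alpha> by (auto simp: exponents_iff)
  have "polynomial_on_data q" unfolding q_def
    by (intro polynomial_sum polynomial_on_data.mult polynomial_on_data.const polynomial_monomial)
  moreover have "\<exists>u. q u \<noteq> 0"
  proof (rule ccontr)
    assume "\<nexists>u. q u \<noteq> 0"
    then have "q (of_coords z) = 0" for z by blast
    then have "(\<Sum>\<beta>\<in>UNIV \<rightarrow>\<^sub>E {..D}. d \<beta> * (\<Prod>k\<in>UNIV. z k ^ \<beta> k)) = 0" for z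
      by (simp add: q_def exponents_def monomial_def)
    moreover have "\<alpha> \<circ> Some \<in> UNIV \<rightarrow>\<^sub>E {..D}" using \<alpha>(1) by (auto simp: exponents_iff)
    ultimately have "d (\<alpha> \<circ> Some) = 0" using monomials_independent[of UNIV d D "\<alpha> \<circ> Some"] by simp
    moreover have "(\<lambda>k. case k of None \<Rightarrow> r | Some l \<Rightarrow> (\<alpha> \<circ> Some) l) = \<alpha>"
      using \<alpha>(3) by (auto simp: fun_eq_iff split: option.split)
    ultimately show False using \<alpha>(2) by (simp add: d_def)
  qed
  moreover have "q (F x) = 0" if "h x \<noteq> 0" "J x = 0" for x
  proof -
    let ?ext = "\<lambda>\<beta> k. case k of None \<Rightarrow> r | Some l \<Rightarrow> \<beta> l"
    let ?A = "{\<alpha>\<in>exponents D. \<alpha> None = r}"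
    have "0 = G x" using G0 that by simp
    also have "\<dots> = (\<Sum>\<alpha>\<in>?A. c \<alpha> * monomial (\<alpha> \<circ> Some) (\<lambda>k. coord k (F x)))"
      unfolding G_def
    proof (rule sum.mono_neutral_cong_right)
      show "\<forall>i\<in>exponents D - ?A. c i * (J x ^ (i None - r) * monomial (i \<circ> Some) (\<lambda>k. coord k (F x))) = 0"
        using least that(2) by (auto simp: power_0_left intro: antisym)
    qed auto
    also have "\<dots> = q (F x)"
      unfolding q_def
    proof (rule sum.reindex_bij_witness[of _ ?ext "\<lambda>\<alpha>. \<alpha> \<circ> Some"])
      fix \<alpha> :: "('m, 'n) coords option \<Rightarrow> nat" assume \<alpha>: "\<alpha> \<in> ?A"
      show *: "?ext (\<alpha> \<circ> Some) = \<alpha>" using \<alpha> by (auto simp: fun_eq_iff split: option.split)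
      show "d (\<alpha> \<circ> Some) * monomial (\<alpha> \<circ> Some) (\<lambda>k. coord k (F x)) =
         c \<alpha> * monomial (\<alpha> \<circ> Some) (\<lambda>k. coord k (F x))" unfolding d_def * ..
    qed (use \<open>r \<le> D\<close> in \<open>auto simp: exponents_iff split: option.split\<close>)
    finally show ?thesis by simp
  qed
  ultimately show ?thesis by blast
qed


section \<open>The critical equations as the fibres of a rational map\<close>

definition gap :: "('m::finite, 'n::finite) data \<Rightarrow> 'm \<Rightarrow> 'n \<Rightarrow> complex" where
  "gap x i j = fst (snd x) $ j - fst x $ i"

definition admissible :: "('m::finite, 'n::finite) data set" where
  "admissible = {x. \<forall>i j. gap x i j \<noteq> 0}"

text \<open>
  The equation \<open>crit_map (a, b, T) = (R, S, T)\<close> says that \<open>(a, b)\<close> is a critical point of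
  \<open>\<Prod>a\<^sub>i\<^bsup>R\<^sub>i\<^esup> \<Prod>(1 - b\<^sub>j)\<^bsup>S\<^sub>j\<^esup> \<Prod>(b\<^sub>j - a\<^sub>i)\<^bsup>T\<^sub>i\<^sub>j\<^esup>\<close>, each logarithmic derivative having been solved
  for \<open>R\<^sub>i\<close> or \<open>S\<^sub>j\<close>. The table \<open>T\<close> is carried along so that source and target have the same
  dimension.
\<close>

definition crit_map :: "('m::finite, 'n::finite) data \<Rightarrow> ('m, 'n) data" where
  "crit_map x =
     (\<chi> i. fst x $ i * (\<Sum>j\<in>UNIV. snd (snd x) $ i $ j / gap x i j),
      \<chi> j. (1 - fst (snd x) $ j) * (\<Sum>i\<in>UNIV. snd (snd x) $ i $ j / gap x i j),
      snd (snd x))"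

definition fibre :: "('m::finite, 'n::finite) data \<Rightarrow> ('m, 'n) data set" where
  "fibre u = {x \<in> admissible. crit_map x = u}"

definition sample_size :: "('m::finite, 'n::finite) data \<Rightarrow> complex" where
  "sample_size u = (\<Sum>i\<in>UNIV. fst u $ i) + (\<Sum>j\<in>UNIV. fst (snd u) $ j)
     + (\<Sum>i\<in>UNIV. \<Sum>j\<in>UNIV. snd (snd u) $ i $ j)"

subsection \<open>Score equations\<close>

text \<open>
  The partial derivative of the log-likelihood with respect to \<open>p\<^sub>i\<^sub>j\<close>.
\<close>

definition score :: "complex^'m \<Rightarrow> complex^'n \<Rightarrow> complex^'n^'m \<Rightarrow> complex^'n^'m \<Rightarrow> 'm::finite \<Rightarrow> 'n::finite \<Rightarrow> complex" where
  "score R S T p i j = T $ i $ j / p $ i $ j + R $ i / row_sum p i + S $ j / col_sum p j"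

lemma bounded_linear_entry: "bounded_linear (\<lambda>p :: complex^'n^'m. p $ i $ j)"
  using bounded_linear_compose[OF bounded_linear_vec_nth bounded_linear_vec_nth] .

lemma bounded_linear_row_sum: "bounded_linear (\<lambda>p :: complex^'n::finite^'m. row_sum p i)"
  unfolding row_sum_def by (intro bounded_linear_sum bounded_linear_entry)

lemma bounded_linear_col_sum: "bounded_linear (\<lambda>p :: complex^'n::finite^'m::finite. col_sum p j)"
  unfolding col_sum_def by (intro bounded_linear_sum bounded_linear_entry)

lemma log_branch_has_derivative:
  assumes "bounded_linear f" "f p0 \<noteq> 0"
  shows "((\<lambda>p. c * log_branch (f p0) (f p)) has_derivative (\<lambda>v. c * (f v / f p0))) (at p0)"
proof -
  have "(log_branch (f p0) has_derivative (*) (1 / f p0)) (at (f p0))"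
    using log_branch_has_field_derivative[of "f p0"] assms by (simp add: has_field_derivative_def)
  from has_derivative_compose[OF bounded_linear_imp_has_derivative[OF assms(1)] this]
  have "((\<lambda>p. log_branch (f p0) (f p)) has_derivative (\<lambda>v. f v / f p0)) (at p0)" by simp
  then show ?thesis by (rule has_derivative_mult_right)
qed

lemma loglik_has_derivative:
  fixes p :: "complex^'n::finite^'m::finite"
  assumes "\<And>i j. p $ i $ j \<noteq> 0" "\<And>i. row_sum p i \<noteq> 0" "\<And>j. col_sum p j \<noteq> 0"
  shows "(loglik p R S T has_derivative (\<lambda>v. \<Sum>i\<in>UNIV. \<Sum>j\<in>UNIV. v $ i $ j * score R S T p i j)) (at p)"
proof -
  have "(loglik p R S T has_derivative (\<lambda>v.
      (\<Sum>i\<in>UNIV. \<Sum>j\<in>UNIV. T $ i $ j * (v $ i $ j / p $ i $ j))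
      + (\<Sum>i\<in>UNIV. R $ i * (row_sum v i / row_sum p i))
      + (\<Sum>j\<in>UNIV. S $ j * (col_sum v j / col_sum p j)))) (at p)"
    unfolding loglik_def[abs_def]
    by (intro has_derivative_add has_derivative_sum
        log_branch_has_derivative[OF bounded_linear_entry]
        log_branch_has_derivative[OF bounded_linear_row_sum]
        log_branch_has_derivative[OF bounded_linear_col_sum] assms)
  moreover have "(\<Sum>i\<in>UNIV. \<Sum>j\<in>UNIV. T $ i $ j * (v $ i $ j / p $ i $ j))
      + (\<Sum>i\<in>UNIV. R $ i * (row_sum v i / row_sum p i))
      + (\<Sum>j\<in>UNIV. S $ j * (col_sum v j / col_sum p j))
      = (\<Sum>i\<in>UNIV. \<Sum>j\<in>UNIV. v $ i $ j * score R S T p i j)" for v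
  proof -
    have "(\<Sum>j\<in>UNIV. S $ j * (col_sum v j / col_sum p j))
      = (\<Sum>i\<in>UNIV. \<Sum>j\<in>UNIV. v $ i $ j * (S $ j / col_sum p j))"
      by (subst sum.swap) (simp add: col_sum_def sum_distrib_left sum_divide_distrib mult_ac)
    moreover have "(\<Sum>i\<in>UNIV. R $ i * (row_sum v i / row_sum p i))
      = (\<Sum>i\<in>UNIV. \<Sum>j\<in>UNIV. v $ i $ j * (R $ i / row_sum p i))"
      by (simp add: row_sum_def sum_distrib_left sum_divide_distrib mult_ac)
    ultimately show ?thesis
      by (simp add: score_def distrib_left sum.distrib mult_ac)
  qed
  ultimately show ?thesis by simp
qed

lemma linear_form_vanishes_iff:
  fixes g :: "'m::finite \<Rightarrow> 'n::finite \<Rightarrow> complex"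
  shows "(\<forall>v :: complex^'n^'m. total_sum v = 0 \<longrightarrow> (\<Sum>i\<in>UNIV. \<Sum>j\<in>UNIV. v $ i $ j * g i j) = 0)
    \<longleftrightarrow> (\<exists>c. \<forall>i j. g i j = c)"
proof
  assume *: "\<forall>v :: complex^'n^'m. total_sum v = 0 \<longrightarrow> (\<Sum>i\<in>UNIV. \<Sum>j\<in>UNIV. v $ i $ j * g i j) = 0"
  define E :: "'m \<Rightarrow> 'n \<Rightarrow> complex^'n^'m" where "E i j = (\<chi> k l. if k = i then if l = j then 1 else 0 else 0)" for i j
  have E: "(\<Sum>k\<in>UNIV. \<Sum>l\<in>UNIV. E i j $ k $ l * w k l) = w i j" for i j and w :: "'m \<Rightarrow> 'n \<Rightarrow> complex"
  proof -
    have "(\<Sum>l\<in>UNIV. E i j $ k $ l * w k l) = (if k = i then w i j else 0)" for k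
      by (simp add: E_def if_distrib[of "\<lambda>t. t * _"] cong: if_cong)
    then show ?thesis by simp
  qed
  have "g i j = g k l" for i j k l
  proof -
    have "total_sum (E i j - E k l) = 0"
      using E[of i j "\<lambda>_ _. 1"] E[of k l "\<lambda>_ _. 1"] by (simp add: total_sum_def sum_subtractf)
    with * have "(\<Sum>i'\<in>UNIV. \<Sum>j'\<in>UNIV. (E i j - E k l) $ i' $ j' * g i' j') = 0" by blast
    then show ?thesis using E[of i j g] E[of k l g] by (simp add: left_diff_distrib sum_subtractf)
  qed
  then show "\<exists>c. \<forall>i j. g i j = c" by blast
next
  assume "\<exists>c. \<forall>i j. g i j = c"
  then obtain c where "g = (\<lambda>i j. c)" by blast
  then show "\<forall>v :: complex^'n^'m. total_sum v = 0 \<longrightarrow> (\<Sum>i\<in>UNIV. \<Sum>j\<in>UNIV. v $ i $ j * g i j) = 0"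
    by (simp add: total_sum_def flip: sum_distrib_right)
qed

text \<open>
  The differential vanishes along the hyperplane if and only if all partial derivatives agree.
  Averaging them with the weights \<open>p\<^sub>i\<^sub>j\<close>, which sum to 1, identifies the common value.
\<close>

lemma score_solutions_iff:
  fixes p :: "complex^'n::finite^'m::finite"
  shows "p \<in> score_solutions R S T \<longleftrightarrow> total_sum p = 1 \<and>
     (\<forall>i j. p $ i $ j \<noteq> 0) \<and> (\<forall>i. row_sum p i \<noteq> 0) \<and> (\<forall>j. col_sum p j \<noteq> 0) \<and>
     (\<forall>i j. score R S T p i j = sample_size (R, S, T))"
proof -
  have "(\<exists>D. (loglik p R S T has_derivative D) (at p) \<and> (\<forall>v. total_sum v = 0 \<longrightarrow> D v = 0))
     \<longleftrightarrow> (\<forall>i j. score R S T p i j = sample_size (R, S, T))"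
    if tot: "total_sum p = 1" and nz: "\<And>i j. p $ i $ j \<noteq> 0" "\<And>i. row_sum p i \<noteq> 0" "\<And>j. col_sum p j \<noteq> 0"
  proof -
    let ?D = "\<lambda>v. \<Sum>i\<in>UNIV. \<Sum>j\<in>UNIV. v $ i $ j * score R S T p i j"
    have D: "(loglik p R S T has_derivative ?D) (at p)" by (rule loglik_has_derivative[OF nz])
    have "(\<exists>D. (loglik p R S T has_derivative D) (at p) \<and> (\<forall>v. total_sum v = 0 \<longrightarrow> D v = 0))
      \<longleftrightarrow> (\<forall>v. total_sum v = 0 \<longrightarrow> ?D v = 0)"
      using D has_derivative_unique[OF D] by blast
    also have "\<dots> \<longleftrightarrow> (\<exists>c. \<forall>i j. score R S T p i j = c)" by (rule linear_form_vanishes_iff)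
    also have "\<dots> \<longleftrightarrow> (\<forall>i j. score R S T p i j = sample_size (R, S, T))"
    proof
      assume "\<exists>c. \<forall>i j. score R S T p i j = c"
      then obtain c where c: "\<And>i j. score R S T p i j = c" by blast
      have "p $ i $ j * score R S T p i j = T $ i $ j + p $ i $ j * (R $ i / row_sum p i) + p $ i $ j * (S $ j / col_sum p j)" for i j
        using nz(1)[of i j] by (simp add: score_def distrib_left)
      then have "(\<Sum>i\<in>UNIV. \<Sum>j\<in>UNIV. p $ i $ j * score R S T p i j) =
          (\<Sum>i\<in>UNIV. \<Sum>j\<in>UNIV. T $ i $ j) + (\<Sum>i\<in>UNIV. \<Sum>j\<in>UNIV. p $ i $ j * (R $ i / row_sum p i))
          + (\<Sum>i\<in>UNIV. \<Sum>j\<in>UNIV. p $ i $ j * (S $ j / col_sum p j))"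
        by (simp add: sum.distrib)
      also have "(\<Sum>i\<in>UNIV. \<Sum>j\<in>UNIV. p $ i $ j * (R $ i / row_sum p i)) = (\<Sum>i\<in>UNIV. R $ i)"
      proof (rule sum.cong[OF refl])
        fix i
        have "(\<Sum>j\<in>UNIV. p $ i $ j * (R $ i / row_sum p i)) = row_sum p i * (R $ i / row_sum p i)"
          by (simp only: sum_distrib_right row_sum_def)
        then show "(\<Sum>j\<in>UNIV. p $ i $ j * (R $ i / row_sum p i)) = R $ i" using nz by simp
      qed
      also have "(\<Sum>i\<in>UNIV. \<Sum>j\<in>UNIV. p $ i $ j * (S $ j / col_sum p j)) = (\<Sum>j\<in>UNIV. S $ j)"
      proof (subst sum.swap, rule sum.cong[OF refl])
        fix j
        have "(\<Sum>i\<in>UNIV. p $ i $ j * (S $ j / col_sum p j)) = col_sum p j * (S $ j / col_sum p j)"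
          by (simp only: sum_distrib_right col_sum_def)
        then show "(\<Sum>i\<in>UNIV. p $ i $ j * (S $ j / col_sum p j)) = S $ j" using nz by simp
      qed
      also have "(\<Sum>i\<in>UNIV. \<Sum>j\<in>UNIV. p $ i $ j * score R S T p i j) = c"
        using tot by (simp add: c total_sum_def flip: sum_distrib_right)
      finally show "\<forall>i j. score R S T p i j = sample_size (R, S, T)"
        by (simp add: c sample_size_def)
    qed blast
    finally show ?thesis .
  qed
  then show ?thesis unfolding score_solutions_def by auto
qed

text \<open>
  Sum the identity \<open>a\<^sub>i + (1 - b\<^sub>j) + (b\<^sub>j - a\<^sub>i) = 1\<close> against \<open>T\<^sub>i\<^sub>j / (b\<^sub>j - a\<^sub>i)\<close>.
\<close>

lemma sample_size_eq:
  assumes "x \<in> fibre u"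
  shows "sample_size u = (\<Sum>i\<in>UNIV. \<Sum>j\<in>UNIV. snd (snd u) $ i $ j / gap x i j)"
proof -
  obtain a b T where x: "x = (a, b, T)" by (cases x)
  have gp: "gap x i j \<noteq> 0" for i j using assms by (simp add: fibre_def admissible_def)
  have u: "fst u $ i = a $ i * (\<Sum>j\<in>UNIV. T $ i $ j / gap x i j)"
    "fst (snd u) $ j = (1 - b $ j) * (\<Sum>i\<in>UNIV. T $ i $ j / gap x i j)" "snd (snd u) = T" for i j
    using assms by (auto simp: fibre_def crit_map_def x)
  have "T $ i $ j / gap x i j = a $ i * (T $ i $ j / gap x i j) + (1 - b $ j) * (T $ i $ j / gap x i j) + T $ i $ j" for i j
  proof -
    define q where "q = T $ i $ j / gap x i j"
    have "T $ i $ j = (b $ j - a $ i) * q" using gp[of i j] by (simp add: q_def x gap_def)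
    then have "q = a $ i * q + (1 - b $ j) * q + T $ i $ j" by (simp add: algebra_simps)
    then show ?thesis by (simp only: q_def)
  qed
  then have "(\<Sum>i\<in>UNIV. \<Sum>j\<in>UNIV. T $ i $ j / gap x i j) = (\<Sum>i\<in>UNIV. \<Sum>j\<in>UNIV.
      a $ i * (T $ i $ j / gap x i j) + (1 - b $ j) * (T $ i $ j / gap x i j) + T $ i $ j)"
    by (intro sum.cong refl)
  also have "\<dots> = (\<Sum>i\<in>UNIV. a $ i * (\<Sum>j\<in>UNIV. T $ i $ j / gap x i j))
      + (\<Sum>i\<in>UNIV. \<Sum>j\<in>UNIV. (1 - b $ j) * (T $ i $ j / gap x i j)) + (\<Sum>i\<in>UNIV. \<Sum>j\<in>UNIV. T $ i $ j)"
    by (simp only: sum.distrib sum_distrib_left)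
  also have "(\<Sum>i\<in>UNIV. \<Sum>j\<in>UNIV. (1 - b $ j) * (T $ i $ j / gap x i j)) = (\<Sum>j\<in>UNIV. fst (snd u) $ j)"
    by (subst sum.swap) (simp add: sum_distrib_left u(2))
  also have "(\<Sum>i\<in>UNIV. a $ i * (\<Sum>j\<in>UNIV. T $ i $ j / gap x i j)) = (\<Sum>i\<in>UNIV. fst u $ i)"
    by (simp only: u)
  finally show ?thesis by (simp add: sample_size_def u(3))
qed

text \<open>
  The change of coordinates \<open>a\<^sub>i = R\<^sub>i / (N p\<^sub>i\<^sub>+)\<close>, \<open>b\<^sub>j = 1 - S\<^sub>j / (N p\<^sub>+\<^sub>j)\<close> with inverse
  \<open>p\<^sub>i\<^sub>j = T\<^sub>i\<^sub>j / (N (b\<^sub>j - a\<^sub>i))\<close>. The score equations turn the first formula into the second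
  one, and the normalization \<open>p\<^sub>+\<^sub>+ = 1\<close> is automatic on the fibre.
\<close>

lemma score_solutions_bij_fibre:
  fixes R :: "complex^'m::finite" and S :: "complex^'n::finite" and T :: "complex^'n^'m"
  assumes nz: "\<And>i. R $ i \<noteq> 0" "\<And>j. S $ j \<noteq> 0" "\<And>i j. T $ i $ j \<noteq> 0" "sample_size (R, S, T) \<noteq> 0"
  shows "\<exists>f. bij_betw f (score_solutions R S T) (fibre (R, S, T))"
proof -
  define N where "N = sample_size (R, S, T)"
  have N: "N \<noteq> 0" using nz by (simp add: N_def)
  define f where "f p = (\<chi> i. R $ i / (N * row_sum p i), \<chi> j. 1 - S $ j / (N * col_sum p j), T)" for p
  define g where "g x = (\<chi> i j. T $ i $ j / (N * gap x i j))" for x :: "('m, 'n) data"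
  have f: "f p \<in> fibre (R, S, T) \<and> g (f p) = p" if "p \<in> score_solutions R S T" for p
  proof -
    have p: "\<And>i j. p $ i $ j \<noteq> 0" "\<And>i. row_sum p i \<noteq> 0" "\<And>j. col_sum p j \<noteq> 0"
      "\<And>i j. score R S T p i j = N"
      using that by (simp_all add: score_solutions_iff N_def)
    have gap: "N * gap (f p) i j = T $ i $ j / p $ i $ j" for i j
    proof -
      have "N * gap (f p) i j = N - S $ j / col_sum p j - R $ i / row_sum p i"
        using N by (simp add: gap_def f_def right_diff_distrib)
      also have "\<dots> = T $ i $ j / p $ i $ j" using p(4)[of i j] by (auto simp: score_def algebra_simps)
      finally show ?thesis .
    qed
    have nzgap: "gap (f p) i j \<noteq> 0" for i j using gap[of i j] N nz(3)[of i j] p(1)[of i j] by auto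
    have quot: "T $ i $ j / gap (f p) i j = N * p $ i $ j" for i j
      using gap[of i j] nzgap[of i j] p(1)[of i j] nz(3)[of i j] by (simp add: field_simps)
    have "crit_map (f p) = (R, S, T)"
    proof -
      have "snd (snd (f p)) = T" by (simp add: f_def)
      then have "crit_map (f p) = (\<chi> i. fst (f p) $ i * (N * row_sum p i),
          \<chi> j. (1 - fst (snd (f p)) $ j) * (N * col_sum p j), T)"
        by (simp add: crit_map_def quot row_sum_def col_sum_def sum_distrib_left)
      also have "\<dots> = (R, S, T)" using N p by (simp add: f_def vec_eq_iff)
      finally show ?thesis .
    qed
    moreover have "g (f p) = p"
      using p nz(3) by (simp add: g_def gap vec_eq_iff)
    ultimately show ?thesis using nzgap by (simp add: fibre_def admissible_def)
  qed
  have g: "g x \<in> score_solutions R S T \<and> f (g x) = x" if "x \<in> fibre (R, S, T)" for x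
  proof -
    have "snd (snd x) = T" using that by (auto simp: fibre_def crit_map_def)
    then obtain a b where x: "x = (a, b, T)" by (cases x) auto
    have gp: "gap x i j \<noteq> 0" for i j using that by (simp add: fibre_def admissible_def)
    have row: "a $ i * (\<Sum>j\<in>UNIV. T $ i $ j / gap x i j) = R $ i"
      and col: "(1 - b $ j) * (\<Sum>i\<in>UNIV. T $ i $ j / gap x i j) = S $ j" for i j
      using that by (auto simp: fibre_def crit_map_def x)
    have a: "a $ i \<noteq> 0" for i using row[of i] nz(1)[of i] by auto
    have b: "1 - b $ j \<noteq> 0" for j using col[of j] nz(2)[of j] by (metis mult_zero_left)
    have rs: "row_sum (g x) i = R $ i / (N * a $ i)" for i
    proof -
      have "row_sum (g x) i = (\<Sum>j\<in>UNIV. T $ i $ j / gap x i j) / N"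
        by (simp add: row_sum_def g_def sum_divide_distrib mult.commute)
      moreover have "(\<Sum>j\<in>UNIV. T $ i $ j / gap x i j) = R $ i / a $ i"
        using row[of i] a[of i] by (simp add: eq_divide_eq mult.commute)
      ultimately show ?thesis by (simp add: mult.commute)
    qed
    have cs: "col_sum (g x) j = S $ j / (N * (1 - b $ j))" for j
    proof -
      have "col_sum (g x) j = (\<Sum>i\<in>UNIV. T $ i $ j / gap x i j) / N"
        by (simp add: col_sum_def g_def sum_divide_distrib mult.commute)
      moreover have "(\<Sum>i\<in>UNIV. T $ i $ j / gap x i j) = S $ j / (1 - b $ j)"
        using col[of j] b[of j] by (simp add: eq_divide_eq mult.commute)
      ultimately show ?thesis by (simp add: mult.commute)
    qed
    have tot: "total_sum (g x) = 1"
    proof -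
      have "total_sum (g x) = (\<Sum>i\<in>UNIV. \<Sum>j\<in>UNIV. T $ i $ j / gap x i j) / N"
        by (simp add: total_sum_def g_def sum_divide_distrib mult.commute)
      then show ?thesis using N sample_size_eq[OF that] by (simp add: N_def)
    qed
    have "score R S T (g x) i j = N" for i j
    proof -
      have "score R S T (g x) i j = N * gap x i j + N * a $ i + N * (1 - b $ j)"
        unfolding score_def rs cs using nz N gp[of i j] a[of i] b[of j]
        by (simp add: g_def)
      then show ?thesis by (simp add: x gap_def algebra_simps)
    qed
    moreover have "g x $ i $ j \<noteq> 0" for i j using nz gp N by (simp add: g_def)
    moreover have "row_sum (g x) i \<noteq> 0" for i unfolding rs using nz a N by simp
    moreover have "col_sum (g x) j \<noteq> 0" for j unfolding cs using nz b[of j] N by simp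
    ultimately have "g x \<in> score_solutions R S T"
      unfolding score_solutions_iff N_def[symmetric] using tot by blast
    moreover have "f (g x) = x"
    proof -
      have "R $ i / (N * row_sum (g x) i) = a $ i" for i unfolding rs using N a nz by simp
      moreover have "1 - S $ j / (N * col_sum (g x) j) = b $ j" for j
        unfolding cs using N b[of j] nz by simp
      ultimately show ?thesis unfolding f_def by (simp add: x vec_eq_iff)
    qed
    ultimately show ?thesis by blast
  qed
  show ?thesis
    by (rule exI[of _ f], rule bij_betwI[of f _ _ g]) (use f g in auto)
qed

subsection \<open>Divided differences and the Jacobian determinant\<close>

text \<open>
  A matrix of divided differences: applied to the difference of the \<open>(a, b)\<close>-parts of two
  points with the same \<open>T\<close>, it gives the difference of their images. On the diagonal it is the
  Jacobian matrix of \<open>crit_map\<close> with respect to \<open>(a, b)\<close>. Working with it instead of the derivative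
  gives local injectivity directly from the continuity of the determinant.
\<close>

definition diff_matrix :: "('m::finite, 'n::finite) data \<Rightarrow> ('m, 'n) data \<Rightarrow> complex^('m + 'n)^('m + 'n)" where
  "diff_matrix x y = (\<chi> r c. case r of
      Inl i \<Rightarrow> (case c of
          Inl k \<Rightarrow> if k = i then \<Sum>j\<in>UNIV. snd (snd x) $ i $ j * fst (snd y) $ j / (gap x i j * gap y i j) else 0
        | Inr j \<Rightarrow> - (snd (snd x) $ i $ j * fst y $ i / (gap x i j * gap y i j)))
    | Inr j \<Rightarrow> (case c of
          Inl i \<Rightarrow> snd (snd x) $ i $ j * (1 - fst (snd x) $ j) / (gap x i j * gap y i j)
        | Inr l \<Rightarrow> if l = j then - (\<Sum>i\<in>UNIV. snd (snd x) $ i $ j * (1 - fst x $ i) / (gap x i j * gap y i j)) else 0))"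

definition crit_jacobian :: "('m::finite, 'n::finite) data \<Rightarrow> complex" where
  "crit_jacobian x = det (diff_matrix x x)"

lemma sum_UNIV_Plus:
  "(\<Sum>k\<in>(UNIV :: ('m::finite + 'n::finite) set). f k) = (\<Sum>i\<in>UNIV. f (Inl i)) + (\<Sum>j\<in>UNIV. f (Inr j))"
  unfolding UNIV_Plus_UNIV[symmetric] by (subst sum.Plus) simp_all

lemma quotient_difference:
  fixes d d' :: "'a::field"
  assumes "d \<noteq> 0" "d' \<noteq> 0" "c * d' - c' * d = u * s - w * r"
  shows "t * u / (d * d') * s - t * w / (d * d') * r = c * (t / d) - c' * (t / d')"
proof -
  have "c * (t / d) - c' * (t / d') = t * (c * d' - c' * d) / (d * d')"
    using assms(1,2) by (simp add: field_simps)
  also have "\<dots> = t * u / (d * d') * s - t * w / (d * d') * r"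
    unfolding assms(3) by (simp add: right_diff_distrib diff_divide_distrib mult.assoc)
  finally show ?thesis by simp
qed

lemma diff_matrix_mult:
  assumes x: "x \<in> admissible" and y: "y \<in> admissible" and T: "snd (snd x) = snd (snd y)"
  defines "v \<equiv> \<chi> k. case k of Inl i \<Rightarrow> fst x $ i - fst y $ i | Inr j \<Rightarrow> fst (snd x) $ j - fst (snd y) $ j"
  shows "(diff_matrix x y *v v) $ Inl i = fst (crit_map x) $ i - fst (crit_map y) $ i"
    and "(diff_matrix x y *v v) $ Inr j = fst (snd (crit_map x)) $ j - fst (snd (crit_map y)) $ j"
proof -
  obtain a b T where x': "x = (a, b, T)" by (cases x)
  obtain a' b' where y': "y = (a', b', T)" using T x' by (cases y) auto
  have gx: "b $ j - a $ i \<noteq> 0" and gy: "b' $ j - a' $ i \<noteq> 0" for i j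
    using x y by (auto simp: admissible_def gap_def x' y')
  have "(diff_matrix x y *v v) $ Inl i =
      (\<Sum>j\<in>UNIV. T $ i $ j * b' $ j / ((b $ j - a $ i) * (b' $ j - a' $ i))) * (a $ i - a' $ i)
      - (\<Sum>j\<in>UNIV. T $ i $ j * a' $ i / ((b $ j - a $ i) * (b' $ j - a' $ i)) * (b $ j - b' $ j))"
    by (simp add: matrix_vector_mult_def sum_UNIV_Plus diff_matrix_def v_def gap_def x' y' sum_negf
        if_distrib[of "\<lambda>t. t * _"] cong: if_cong)
  also have "\<dots> = (\<Sum>j\<in>UNIV. a $ i * (T $ i $ j / (b $ j - a $ i)) - a' $ i * (T $ i $ j / (b' $ j - a' $ i)))"
    unfolding sum_distrib_right sum_subtractf[symmetric]
    by (intro sum.cong refl quotient_difference gx gy) (simp add: algebra_simps)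
  also have "\<dots> = fst (crit_map x) $ i - fst (crit_map y) $ i"
    by (simp add: crit_map_def gap_def x' y' sum_subtractf sum_distrib_left)
  finally show "(diff_matrix x y *v v) $ Inl i = fst (crit_map x) $ i - fst (crit_map y) $ i" .
  have "(diff_matrix x y *v v) $ Inr j =
      (\<Sum>i\<in>UNIV. T $ i $ j * (1 - b $ j) / ((b $ j - a $ i) * (b' $ j - a' $ i)) * (a $ i - a' $ i))
      - (\<Sum>i\<in>UNIV. T $ i $ j * (1 - a $ i) / ((b $ j - a $ i) * (b' $ j - a' $ i))) * (b $ j - b' $ j)"
    by (simp add: matrix_vector_mult_def sum_UNIV_Plus diff_matrix_def v_def gap_def x' y' sum_negf
        if_distrib[of "\<lambda>t. t * _"] cong: if_cong)
  also have "\<dots> = (\<Sum>i\<in>UNIV. (1 - b $ j) * (T $ i $ j / (b $ j - a $ i)) - (1 - b' $ j) * (T $ i $ j / (b' $ j - a' $ i)))"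
    unfolding sum_distrib_right sum_subtractf[symmetric]
    by (intro sum.cong refl quotient_difference gx gy) (simp add: algebra_simps)
  also have "\<dots> = fst (snd (crit_map x)) $ j - fst (snd (crit_map y)) $ j"
    by (simp add: crit_map_def gap_def x' y' sum_subtractf sum_distrib_left)
  finally show "(diff_matrix x y *v v) $ Inr j = fst (snd (crit_map x)) $ j - fst (snd (crit_map y)) $ j" .
qed

lemma det_nonzero_iff_ker:
  fixes A :: "complex^'k^'k"
  shows "det A \<noteq> 0 \<longleftrightarrow> (\<forall>v. A *v v = 0 \<longrightarrow> v = 0)"
  by (simp only: invertible_det_nz[symmetric] invertible_left_inverse matrix_left_invertible_ker)

lemma crit_map_injective:
  assumes x: "x \<in> admissible" and y: "y \<in> admissible" and eq: "crit_map x = crit_map y"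
    and det: "det (diff_matrix x y) \<noteq> 0"
  shows "x = y"
proof -
  have T: "snd (snd x) = snd (snd y)" using eq by (simp add: crit_map_def)
  define v :: "complex^('a + 'b)" where
    "v = (\<chi> k. case k of Inl i \<Rightarrow> fst x $ i - fst y $ i | Inr j \<Rightarrow> fst (snd x) $ j - fst (snd y) $ j)"
  have "diff_matrix x y *v v = 0"
  proof (subst vec_eq_iff, rule allI)
    fix k show "(diff_matrix x y *v v) $ k = 0 $ k"
      using diff_matrix_mult[OF x y T, folded v_def] eq by (cases k) simp_all
  qed
  then have "v = 0" using det unfolding det_nonzero_iff_ker by blast
  then have "v $ k = 0" for k by simp
  from this[of "Inl _"] this[of "Inr _"] have "fst x = fst y" "fst (snd x) = fst (snd y)"
    by (simp_all add: v_def vec_eq_iff)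
  then show ?thesis using T by (simp add: prod_eq_iff)
qed

lemma continuous_on_gap [continuous_intros]:
  "continuous_on A f \<Longrightarrow> continuous_on A (\<lambda>z. gap (f z) i j)"
  unfolding gap_def by (intro continuous_intros)

lemma open_admissible: "open (admissible :: ('m::finite, 'n::finite) data set)"
proof -
  have "admissible = (\<Inter>i. \<Inter>j. {x :: ('m, 'n) data. gap x i j \<noteq> 0})"
    by (auto simp: admissible_def)
  also have "open \<dots>"
    by (intro open_INT finite ballI open_Collect_neq continuous_intros)
  finally show ?thesis .
qed

lemma continuous_on_crit_map: "continuous_on admissible crit_map"
  unfolding crit_map_def by (intro continuous_intros) (auto simp: admissible_def)

lemma continuous_on_diff_det:
  "continuous_on (admissible \<times> admissible) (\<lambda>z. det (diff_matrix (fst z) (snd z)))"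
proof -
  have entry: "continuous_on (admissible \<times> admissible) (\<lambda>z. diff_matrix (fst z) (snd z) $ r $ c)" for r c
    by (cases r; cases c; cases "r = c"; simp add: diff_matrix_def)
      (auto intro!: continuous_intros simp: admissible_def)
  show ?thesis unfolding det_def
    by (intro continuous_on_sum continuous_on_mult continuous_on_prod continuous_on_const entry)
qed

text \<open>
  The determinant of the divided differences is continuous and nonzero at \<open>(x, x)\<close>, hence nonzero
  for all pairs of points near \<open>x\<close>.
\<close>

lemma crit_map_locally_injective:
  assumes x: "x \<in> admissible" and J: "crit_jacobian x \<noteq> 0"
  shows "\<exists>U. open U \<and> x \<in> U \<and> U \<subseteq> admissible \<and> inj_on crit_map U"
proof -
  let ?W = "(admissible \<times> admissible) \<inter> (\<lambda>z. det (diff_matrix (fst z) (snd z))) -` (- {0})"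
  have "open ?W"
    by (intro continuous_open_preimage continuous_on_diff_det open_Times open_admissible) auto
  moreover have "(x, x) \<in> ?W" using x J by (simp add: crit_jacobian_def)
  ultimately obtain A B where "open A" "open B" "(x, x) \<in> A \<times> B" "A \<times> B \<subseteq> ?W"
    by (rule open_prod_elim)
  then have AB: "open A" "open B" "x \<in> A" "x \<in> B" "A \<times> B \<subseteq> ?W" by auto
  show ?thesis
  proof (intro exI[of _ "A \<inter> B"] conjI)
    show "A \<inter> B \<subseteq> admissible" using AB by auto
    show "inj_on crit_map (A \<inter> B)"
    proof (rule inj_onI)
      fix y z assume "y \<in> A \<inter> B" "z \<in> A \<inter> B" and eq: "crit_map y = crit_map z"
      then have "(y, z) \<in> ?W" using AB by blast
      then show "y = z" using crit_map_injective[OF _ _ eq] by auto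
    qed
  qed (use AB in auto)
qed

subsection \<open>The discriminant\<close>

definition gap_product :: "('m::finite, 'n::finite) data \<Rightarrow> complex" where
  "gap_product x = (\<Prod>i\<in>UNIV. \<Prod>j\<in>UNIV. gap x i j)"

lemma gap_product_nonzero_iff: "gap_product x \<noteq> 0 \<longleftrightarrow> x \<in> admissible"
  by (simp add: gap_product_def admissible_def)

lemma polynomial_components:
  "polynomial_on_data (\<lambda>x. fst x $ i)"
  "polynomial_on_data (\<lambda>x. fst (snd x) $ j)"
  "polynomial_on_data (\<lambda>x. snd (snd x) $ i $ j)"
  using polynomial_on_data.coord_R polynomial_on_data.coord_S polynomial_on_data.coord_T
  by (simp_all add: case_prod_unfold)

lemma polynomial_gap: "polynomial_on_data (\<lambda>x. gap x i j)"
  unfolding gap_def by (intro polynomial_intros polynomial_components)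

lemma polynomial_gap_product: "polynomial_on_data gap_product"
  unfolding gap_product_def by (intro polynomial_intros polynomial_gap)

lemma regular_off_inverse_gap: "regular_off gap_product (\<lambda>x. 1 / gap x i j)"
proof -
  define P where "P x = (\<Prod>l\<in>UNIV - {j}. gap x i l) * (\<Prod>k\<in>UNIV - {i}. \<Prod>l\<in>UNIV. gap x k l)" for x
  have "gap_product x = gap x i j * P x" for x
    unfolding gap_product_def P_def by (simp add: prod.remove[of UNIV i] prod.remove[of UNIV j "gap x i"] mult_ac)
  moreover have "gap x i j \<noteq> 0" if "gap_product x \<noteq> 0" for x
    using that by (simp add: gap_product_def)
  moreover have "polynomial_on_data P"
    unfolding P_def by (intro polynomial_intros polynomial_gap)
  ultimately show ?thesis unfolding regular_off_def by (intro exI[of _ 1] exI[of _ P]) auto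
qed

lemma regular_off_divide_gap:
  "regular_off gap_product f \<Longrightarrow> regular_off gap_product (\<lambda>x. f x / gap x i j)"
  using regular_off_mult[OF _ regular_off_inverse_gap] by simp

lemmas regular_off_components =
  regular_off_polynomial[OF polynomial_components(1)]
  regular_off_polynomial[OF polynomial_components(2)]
  regular_off_polynomial[OF polynomial_components(3)]
  regular_off_polynomial[OF polynomial_diff[OF polynomial_on_data.const polynomial_components(1)]]
  regular_off_polynomial[OF polynomial_diff[OF polynomial_on_data.const polynomial_components(2)]]

lemma regular_off_divide_two_gaps:
  "regular_off gap_product f \<Longrightarrow> regular_off gap_product (\<lambda>x. f x / (gap x i j * gap x k l))"
  using regular_off_divide_gap[OF regular_off_divide_gap] by (simp add: divide_divide_eq_left)

text \<open>
  The map and its Jacobian determinant are rational functions with poles along \<open>a\<^sub>i = b\<^sub>j\<close> only.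
\<close>

lemma regular_off_crit_map: "regular_off gap_product (\<lambda>x. coord k (crit_map x))"
proof -
  note [intro!] = regular_off_mult regular_off_sum regular_off_divide_gap polynomial_gap_product
    regular_off_components
  consider i where "k = Inl i" | j where "k = Inr (Inl j)" | i j where "k = Inr (Inr (i, j))"
    by (metis sum.exhaust surj_pair)
  then show ?thesis
    by cases (auto simp: crit_map_def)
qed

lemma regular_off_crit_jacobian: "regular_off gap_product crit_jacobian"
proof -
  note [intro!] = regular_off_mult regular_off_sum regular_off_divide_gap polynomial_gap_product
    regular_off_components
  have minus: "regular_off gap_product (\<lambda>x. - f x)" if "regular_off gap_product f" for f
    using regular_off_mult[OF regular_off_polynomial[OF polynomial_on_data.const[of "-1"]] that] by simp
  have "regular_off gap_product (\<lambda>x. diff_matrix x x $ r $ c)" for r c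
    by (cases r; cases c; cases "r = c"; simp add: diff_matrix_def)
      (auto intro!: minus regular_off_divide_two_gaps intro: regular_off_polynomial polynomial_on_data.const)
  then show ?thesis unfolding crit_jacobian_def[abs_def] det_def
    by (intro regular_off_sum regular_off_mult regular_off_prod polynomial_gap_product
        regular_off_polynomial[OF polynomial_on_data.const])
qed

lemma crit_jacobian_not_identically_zero:
  "\<exists>x :: ('m::finite, 'n::finite) data. x \<in> admissible \<and> crit_jacobian x \<noteq> 0"
proof -
  \<comment> \<open>All gaps equal 1/2 here, and each equation expresses one entry of a kernel vector by the
    total of the entries in the other block.\<close>
  define x :: "('m, 'n) data" where "x = (\<chi> i. 1 / 4, \<chi> j. 3 / 4, \<chi> i j. 1)"
  have comp: "fst x $ i = 1 / 4" "fst (snd x) $ j = 3 / 4" "snd (snd x) $ i $ j = 1" for i j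
    by (simp_all add: x_def)
  have gap: "gap x i j = 1 / 2" for i j by (simp add: gap_def comp)
  have "v = 0" if v: "diff_matrix x x *v v = 0" for v
  proof -
    define A where "A = (\<Sum>i\<in>UNIV. v $ Inl i)"
    define B where "B = (\<Sum>j\<in>UNIV. v $ Inr j)"
    define m where "m = complex_of_nat CARD('m)"
    define n where "n = complex_of_nat CARD('n)"
    have mn: "m \<noteq> 0" "n \<noteq> 0" by (simp_all add: m_def n_def)
    have "(diff_matrix x x *v v) $ Inl i = 0" for i by (simp add: v)
    then have "n * 3 * v $ Inl i = B" for i
      by (simp add: matrix_vector_mult_def sum_UNIV_Plus diff_matrix_def gap comp n_def B_def sum_negf
          if_distrib[of "\<lambda>t. t * _"] cong: if_cong flip: sum_distrib_left)
    then have row: "3 * n * v $ Inl i = B" for i by (simp add: mult_ac)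
    have "(diff_matrix x x *v v) $ Inr j = 0" for j by (simp add: v)
    then have "A = m * 3 * v $ Inr j" for j
      by (simp add: matrix_vector_mult_def sum_UNIV_Plus diff_matrix_def gap comp m_def A_def sum_negf
          if_distrib[of "\<lambda>t. t * _"] cong: if_cong flip: sum_distrib_left)
    then have col: "A = 3 * m * v $ Inr j" for j by (simp add: mult_ac)
    have "3 * n * A = m * B" unfolding A_def sum_distrib_left row by (simp add: m_def)
    moreover have "n * A = 3 * m * B" unfolding B_def sum_distrib_left col[symmetric] by (simp add: n_def)
    ultimately have "9 * (m * B) = m * B" by (simp add: mult.assoc)
    then have "B = 0" using mn by simp
    then have "A = 0" using \<open>n * A = 3 * m * B\<close> mn by simp
    have "v $ k = 0" for k using row col \<open>A = 0\<close> \<open>B = 0\<close> mn by (cases k) auto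
    then show ?thesis by (simp add: vec_eq_iff)
  qed
  then have "crit_jacobian x \<noteq> 0" unfolding crit_jacobian_def det_nonzero_iff_ker by blast
  moreover have "x \<in> admissible" by (simp add: admissible_def gap)
  ultimately show ?thesis by blast
qed

lemma discriminant_exists:
  "\<exists>q. polynomial_on_data q \<and> (\<exists>u :: ('m::finite, 'n::finite) data. q u \<noteq> 0) \<and>
    (\<forall>u. q u \<noteq> 0 \<longrightarrow> (\<forall>x\<in>fibre u. crit_jacobian x \<noteq> 0))"
proof -
  obtain y :: "('m, 'n) data" where y: "y \<in> admissible" "crit_jacobian y \<noteq> 0"
    using crit_jacobian_not_identically_zero by blast
  have "\<exists>q. polynomial_on_data q \<and> (\<exists>u :: ('m, 'n) data. q u \<noteq> 0) \<and>
      (\<forall>x. gap_product x \<noteq> 0 \<longrightarrow> crit_jacobian x = 0 \<longrightarrow> q (crit_map x) = 0)"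
    using y by (intro image_of_zero_set_not_dense[where y = y] polynomial_gap_product
        regular_off_crit_map regular_off_crit_jacobian) (simp_all add: gap_product_nonzero_iff)
  then show ?thesis unfolding gap_product_nonzero_iff fibre_def by blast
qed


section \<open>Nonresonant data: critical points stay away from the boundary\<close>

text \<open>
  Think of \<open>w k l\<close> as the exponent of \<open>B l - A k\<close>. In the sum of \<open>A k - c\<close> times the equation of
  \<open>A k\<close> over \<open>k \<in> C\<close>, minus the sum of \<open>B l - c\<close> times the equation of \<open>B l\<close> over \<open>l \<in> D\<close>, a pair
  inside the cluster contributes \<open>- w k l\<close>, a pair outside nothing, and a mixed pair at most
  \<open>\<bar>w k l\<bar> / (L - 1)\<close>.
\<close>

lemma cluster_weight_bound:
  fixes A :: "'k::finite \<Rightarrow> complex" and B :: "'l::finite \<Rightarrow> complex" and w :: "'k \<Rightarrow> 'l \<Rightarrow> complex"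
  assumes distinct: "\<And>k l. B l \<noteq> A k"
    and row: "\<And>k. (\<Sum>l\<in>UNIV. w k l / (B l - A k)) = 0"
    and col: "\<And>l. (\<Sum>k\<in>UNIV. w k l / (B l - A k)) = 0"
    and inA: "\<And>k. k \<in> C \<Longrightarrow> norm (A k - c) \<le> \<delta>" and outA: "\<And>k. k \<notin> C \<Longrightarrow> norm (A k - c) > L * \<delta>"
    and inB: "\<And>l. l \<in> D \<Longrightarrow> norm (B l - c) \<le> \<delta>" and outB: "\<And>l. l \<notin> D \<Longrightarrow> norm (B l - c) > L * \<delta>"
    and L: "L \<ge> 1"
  shows "norm (\<Sum>k\<in>C. \<Sum>l\<in>D. w k l) * (L - 1) \<le> (\<Sum>k\<in>UNIV. \<Sum>l\<in>UNIV. norm (w k l))"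
proof -
  \<comment> \<open>\<open>z\<close> is the contribution of a pair to the weighted sum of the equations; \<open>z'\<close> cancels
    the contributions of the pairs inside the cluster.\<close>
  define z where "z k l = (if k \<in> C then A k - c else 0) * (w k l / (B l - A k))
      - (if l \<in> D then B l - c else 0) * (w k l / (B l - A k))" for k l
  define z' where "z' k l = z k l + (if k \<in> C then if l \<in> D then w k l else 0 else 0)" for k l
  have "(\<Sum>k\<in>UNIV. \<Sum>l\<in>UNIV. z k l) = (\<Sum>k\<in>UNIV. (if k \<in> C then A k - c else 0) * (\<Sum>l\<in>UNIV. w k l / (B l - A k)))
      - (\<Sum>k\<in>UNIV. \<Sum>l\<in>UNIV. (if l \<in> D then B l - c else 0) * (w k l / (B l - A k)))"
    by (simp only: z_def sum_subtractf sum_distrib_left)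
  also have "(\<Sum>k\<in>UNIV. \<Sum>l\<in>UNIV. (if l \<in> D then B l - c else 0) * (w k l / (B l - A k)))
      = (\<Sum>l\<in>UNIV. (if l \<in> D then B l - c else 0) * (\<Sum>k\<in>UNIV. w k l / (B l - A k)))"
    by (subst sum.swap) (simp only: sum_distrib_left)
  finally have z0: "(\<Sum>k\<in>UNIV. \<Sum>l\<in>UNIV. z k l) = 0" by (simp only: row col) simp
  have "(\<Sum>k\<in>UNIV. \<Sum>l\<in>UNIV. if k \<in> C then if l \<in> D then w k l else 0 else 0)
      = (\<Sum>k\<in>UNIV. if k \<in> C then \<Sum>l\<in>UNIV. if l \<in> D then w k l else 0 else 0)"
    by (intro sum.cong refl) auto
  also have "\<dots> = (\<Sum>k\<in>C. \<Sum>l\<in>D. w k l)"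
    by (simp add: sum.If_cases)
  finally have sum_z': "(\<Sum>k\<in>UNIV. \<Sum>l\<in>UNIV. z' k l) = (\<Sum>k\<in>C. \<Sum>l\<in>D. w k l)"
    using z0 by (simp add: z'_def sum.distrib)
  have bound: "norm (s * (w k l / (B l - A k))) * (L - 1) \<le> norm (w k l)"
    if "norm s * (L - 1) \<le> norm (B l - A k)" for s k l
  proof -
    have "norm (s * (w k l / (B l - A k))) * (L - 1) = norm (w k l) * ((norm s * (L - 1)) / norm (B l - A k))"
      by (simp add: norm_mult norm_divide)
    also have "\<dots> \<le> norm (w k l) * 1"
      using that distinct[of l k] by (intro mult_left_mono) (auto simp: divide_le_eq)
    finally show ?thesis by simp
  qed
  have "norm (z' k l) * (L - 1) \<le> norm (w k l)" for k l
  proof (cases "k \<in> C"; cases "l \<in> D")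
    assume "k \<in> C" "l \<in> D"
    then have "z' k l = (A k - c) * (w k l / (B l - A k)) - (B l - c) * (w k l / (B l - A k)) + w k l"
      by (simp add: z'_def z_def)
    also have "\<dots> = (A k - B l) * (w k l / (B l - A k)) + w k l"
      unfolding left_diff_distrib[symmetric] by simp
    also have "\<dots> = 0" using distinct[of l k] by (simp add: field_simps)
    finally show ?thesis by simp
  next
    assume kl: "k \<in> C" "l \<notin> D"
    have "norm (A k - c) * (L - 1) \<le> \<delta> * (L - 1)" using inA[OF kl(1)] L by (intro mult_right_mono) auto
    also have "\<dots> \<le> norm (B l - c) - norm (A k - c)" using inA[OF kl(1)] outB[OF kl(2)] by (simp add: algebra_simps)
    also have "\<dots> \<le> norm (B l - A k)" using norm_triangle_ineq2[of "B l - c" "A k - c"] by simp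
    finally show ?thesis using bound[of "A k - c"] kl by (simp add: z'_def z_def)
  next
    assume kl: "k \<notin> C" "l \<in> D"
    have "norm (B l - c) * (L - 1) \<le> \<delta> * (L - 1)" using inB[OF kl(2)] L by (intro mult_right_mono) auto
    also have "\<dots> \<le> norm (A k - c) - norm (B l - c)" using inB[OF kl(2)] outA[OF kl(1)] by (simp add: algebra_simps)
    also have "\<dots> \<le> norm (B l - A k)"
      using norm_triangle_ineq2[of "A k - c" "B l - c"] by (simp add: norm_minus_commute)
    finally show ?thesis using bound[of "B l - c"] kl by (simp add: z'_def z_def)
  next
    assume "k \<notin> C" "l \<notin> D"
    then show ?thesis by (simp add: z'_def z_def)
  qed
  then have "(\<Sum>k\<in>UNIV. \<Sum>l\<in>UNIV. norm (z' k l) * (L - 1)) \<le> (\<Sum>k\<in>UNIV. \<Sum>l\<in>UNIV. norm (w k l))"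
    by (intro sum_mono)
  moreover have "norm (\<Sum>k\<in>UNIV. \<Sum>l\<in>UNIV. z' k l) \<le> (\<Sum>k\<in>UNIV. \<Sum>l\<in>UNIV. norm (z' k l))"
    by (rule order_trans[OF norm_sum]) (intro sum_mono norm_sum)
  then have "norm (\<Sum>k\<in>UNIV. \<Sum>l\<in>UNIV. z' k l) * (L - 1) \<le> (\<Sum>k\<in>UNIV. \<Sum>l\<in>UNIV. norm (z' k l)) * (L - 1)"
    using L by (intro mult_right_mono) auto
  ultimately show ?thesis by (simp only: sum_z' sum_distrib_right)
qed

text \<open>
  Each multiplication of the radius by \<open>L\<close> captures a further point until all are captured.
\<close>

lemma gapless_radii_bounded:
  fixes r :: "'p::finite \<Rightarrow> real"
  assumes "d \<ge> 0" "L \<ge> 1"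
    and gapless: "\<And>\<delta>. \<delta> \<ge> d \<Longrightarrow> {p. r p \<le> \<delta>} \<noteq> UNIV \<Longrightarrow> \<exists>q. \<delta> < r q \<and> r q \<le> L * \<delta>"
  shows "r p \<le> L ^ CARD('p) * d"
proof -
  define C where "C n = {p. r p \<le> L ^ n * d}" for n
  have mono: "C n \<subseteq> C (Suc n)" for n
  proof -
    have "L ^ n * d \<le> L ^ Suc n * d"
      using assms(1,2) by (intro mult_right_mono power_increasing) auto
    then show ?thesis by (auto simp: C_def)
  qed
  have "C n = UNIV \<or> n \<le> card (C n)" for n
  proof (induction n)
    case (Suc n)
    show ?case
    proof (cases "C n = UNIV")
      case True
      then show ?thesis using mono[of n] by auto
    next
      case False
      have "d \<le> L ^ n * d" using assms(1,2) mult_right_mono[of 1 "L ^ n" d] by (simp add: one_le_power)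
      then obtain q where "L ^ n * d < r q" "r q \<le> L * (L ^ n * d)"
        using gapless[of "L ^ n * d"] False by (auto simp: C_def)
      then have "q \<in> C (Suc n) - C n" by (simp add: C_def)
      then have "C n \<subset> C (Suc n)" using mono[of n] by auto
      then have "card (C n) < card (C (Suc n))" by (intro psubset_card_mono) auto
      then show ?thesis using Suc False by simp
    qed
  qed simp
  then have "C CARD('p) = UNIV"
    by (metis card_seteq finite subset_UNIV)
  then show ?thesis by (auto simp: C_def)
qed

text \<open>
  If some point were much farther away from \<open>A k\<close> than \<open>B l\<close> is, then some ball around \<open>A k\<close> that
  contains \<open>B l\<close> but not all points would be followed by a wide gap. The points in that ball would
  form a cluster, whose total weight cannot be as large as \<open>\<eta>\<close>.
\<close>

lemma points_separated:
  fixes A :: "'k::finite \<Rightarrow> complex" and B :: "'l::finite \<Rightarrow> complex" and w :: "'k \<Rightarrow> 'l \<Rightarrow> complex"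
  assumes distinct: "\<And>k l. B l \<noteq> A k"
    and row: "\<And>k. (\<Sum>l\<in>UNIV. w k l / (B l - A k)) = 0"
    and col: "\<And>l. (\<Sum>k\<in>UNIV. w k l / (B l - A k)) = 0"
    and nonres: "\<And>C D. C \<noteq> {} \<Longrightarrow> D \<noteq> {} \<Longrightarrow> C \<noteq> UNIV \<or> D \<noteq> UNIV \<Longrightarrow> \<eta> \<le> norm (\<Sum>k\<in>C. \<Sum>l\<in>D. w k l)"
    and W: "(\<Sum>k\<in>UNIV. \<Sum>l\<in>UNIV. norm (w k l)) < \<eta> * (L - 1)" and L: "L \<ge> 1"
  shows "norm (A k' - A k) \<le> L ^ (CARD('k) + CARD('l)) * norm (B l - A k)"
    and "norm (B l' - A k) \<le> L ^ (CARD('k) + CARD('l)) * norm (B l - A k)"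
proof -
  define r where "r p = (case p of Inl k' \<Rightarrow> norm (A k' - A k) | Inr l' \<Rightarrow> norm (B l' - A k))" for p
  have "r p \<le> L ^ CARD('k + 'l) * norm (B l - A k)" for p
  proof (rule gapless_radii_bounded)
    fix \<delta> assume \<delta>: "norm (B l - A k) \<le> \<delta>" and ne: "{p. r p \<le> \<delta>} \<noteq> UNIV"
    show "\<exists>q. \<delta> < r q \<and> r q \<le> L * \<delta>"
    proof (rule ccontr)
      assume none: "\<nexists>q. \<delta> < r q \<and> r q \<le> L * \<delta>"
      define C where "C = {k'. norm (A k' - A k) \<le> \<delta>}"
      define D where "D = {l'. norm (B l' - A k) \<le> \<delta>}"
      have "\<delta> \<ge> 0" using \<delta> norm_ge_zero order_trans by blast
      then have "k \<in> C" "l \<in> D" using \<delta> by (auto simp: C_def D_def)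
      moreover have "C \<noteq> UNIV \<or> D \<noteq> UNIV"
      proof -
        obtain p where "\<not> r p \<le> \<delta>" using ne by auto
        then show ?thesis by (cases p) (auto simp: r_def C_def D_def)
      qed
      ultimately have "\<eta> \<le> norm (\<Sum>k\<in>C. \<Sum>l\<in>D. w k l)" by (intro nonres) auto
      then have "\<eta> * (L - 1) \<le> norm (\<Sum>k\<in>C. \<Sum>l\<in>D. w k l) * (L - 1)"
        using L by (intro mult_right_mono) auto
      also have "\<dots> \<le> (\<Sum>k\<in>UNIV. \<Sum>l\<in>UNIV. norm (w k l))"
      proof (rule cluster_weight_bound[OF distinct row col _ _ _ _ L])
        fix k' assume "k' \<notin> C"
        then show "norm (A k' - A k) > L * \<delta>" using none[simplified, rule_format, of "Inl k'"] by (simp add: C_def r_def)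
      next
        fix l' assume "l' \<notin> D"
        then show "norm (B l' - A k) > L * \<delta>" using none[simplified, rule_format, of "Inr l'"] by (simp add: D_def r_def)
      qed (auto simp: C_def D_def)
      finally show False using W by simp
    qed
  qed (use L in auto)
  from this[of "Inl k'"] this[of "Inr l'"]
  show "norm (A k' - A k) \<le> L ^ (CARD('k) + CARD('l)) * norm (B l - A k)"
    "norm (B l' - A k) \<le> L ^ (CARD('k) + CARD('l)) * norm (B l - A k)" by (simp_all add: r_def)
qed

text \<open>
  The linear forms \<open>a\<^sub>i\<close> and \<open>1 - b\<^sub>j\<close> are treated on the same footing as \<open>b\<^sub>j - a\<^sub>i\<close> by adding the
  constant points \<open>1\<close> to the \<open>a\<^sub>i\<close> and \<open>0\<close> to the \<open>b\<^sub>j\<close>, both with the index \<open>None\<close>.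
\<close>

definition row_point :: "('m::finite, 'n::finite) data \<Rightarrow> 'm option \<Rightarrow> complex" where
  "row_point x k = (case k of None \<Rightarrow> 1 | Some i \<Rightarrow> fst x $ i)"

definition col_point :: "('m::finite, 'n::finite) data \<Rightarrow> 'n option \<Rightarrow> complex" where
  "col_point x l = (case l of None \<Rightarrow> 0 | Some j \<Rightarrow> fst (snd x) $ j)"

text \<open>
  The weight of the pair of constant points is chosen such that the balance equations hold at
  these two points as well; all weights together then sum to zero.
\<close>

definition weight :: "('m::finite, 'n::finite) data \<Rightarrow> 'm option \<Rightarrow> 'n option \<Rightarrow> complex" where
  "weight u k l = (case k of
      None \<Rightarrow> (case l of None \<Rightarrow> - sample_size u | Some j \<Rightarrow> fst (snd u) $ j)
    | Some i \<Rightarrow> (case l of None \<Rightarrow> fst u $ i | Some j \<Rightarrow> snd (snd u) $ i $ j))"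

lemma sum_UNIV_option: "(\<Sum>k\<in>(UNIV :: 'k::finite option set). f k) = f None + (\<Sum>i\<in>UNIV. f (Some i))"
  unfolding UNIV_option_conv by (simp add: sum.reindex)

lemma fibre_balanced:
  assumes x: "x \<in> fibre u" and R: "\<And>i. fst u $ i \<noteq> 0" and S: "\<And>j. fst (snd u) $ j \<noteq> 0"
  shows "col_point x l \<noteq> row_point x k"
    and "(\<Sum>l\<in>UNIV. weight u k l / (col_point x l - row_point x k)) = 0"
    and "(\<Sum>k\<in>UNIV. weight u k l / (col_point x l - row_point x k)) = 0"
proof -
  obtain a b T where x': "x = (a, b, T)" by (cases x)
  have gp: "b $ j - a $ i \<noteq> 0" for i j using x by (auto simp: fibre_def admissible_def gap_def x')
  have u: "fst u $ i = a $ i * (\<Sum>j\<in>UNIV. T $ i $ j / (b $ j - a $ i))"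
    "fst (snd u) $ j = (1 - b $ j) * (\<Sum>i\<in>UNIV. T $ i $ j / (b $ j - a $ i))" "snd (snd u) = T" for i j
    using x by (auto simp: fibre_def crit_map_def gap_def x')
  have a: "a $ i \<noteq> 0" for i using R[of i] u(1)[of i] by auto
  have b: "b $ j - 1 \<noteq> 0" for j using S[of j] u(2)[of j] by auto
  show "col_point x l \<noteq> row_point x k"
    using gp a b by (cases k; cases l) (auto simp: col_point_def row_point_def x')
  have Ra: "fst u $ i / (- a $ i) = - (\<Sum>j\<in>UNIV. T $ i $ j / (b $ j - a $ i))" for i
    using u(1)[of i] a[of i] by simp
  have Sb: "fst (snd u) $ j / (b $ j - 1) = - (\<Sum>i\<in>UNIV. T $ i $ j / (b $ j - a $ i))" for j
  proof -
    have "fst (snd u) $ j = - (\<Sum>i\<in>UNIV. T $ i $ j / (b $ j - a $ i)) * (b $ j - 1)"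
      unfolding u(2) by (simp add: algebra_simps)
    then show ?thesis using b[of j] by simp
  qed
  have N: "sample_size u = (\<Sum>i\<in>UNIV. \<Sum>j\<in>UNIV. T $ i $ j / (b $ j - a $ i))"
    using sample_size_eq[OF x] u(3) by (simp add: gap_def x')
  show "(\<Sum>l\<in>UNIV. weight u k l / (col_point x l - row_point x k)) = 0"
  proof (cases k)
    case None
    have "(\<Sum>j\<in>UNIV. fst (snd u) $ j / (b $ j - 1)) = - sample_size u"
      unfolding Sb N sum_negf by (subst sum.swap) simp
    then show ?thesis using None
      by (simp add: sum_UNIV_option weight_def col_point_def row_point_def x')
  next
    case (Some i)
    then show ?thesis using Ra[of i]
      by (simp add: sum_UNIV_option weight_def col_point_def row_point_def x' u(3))
  qed
  show "(\<Sum>k\<in>UNIV. weight u k l / (col_point x l - row_point x k)) = 0"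
  proof (cases l)
    case None
    have "(\<Sum>i\<in>UNIV. fst u $ i / (- a $ i)) = - sample_size u"
      unfolding Ra N sum_negf ..
    then show ?thesis using None
      by (simp add: sum_UNIV_option weight_def col_point_def row_point_def x')
  next
    case (Some j)
    then show ?thesis using Sb[of j]
      by (simp add: sum_UNIV_option weight_def col_point_def row_point_def x' u(3))
  qed
qed

text \<open>
  The possible clusters containing both kinds of points, except the set of all points, whose total
  weight is zero for all data.
\<close>

definition proper_blocks :: "('m option set \<times> 'n option set) set" where
  "proper_blocks = {(C, D). C \<noteq> {} \<and> D \<noteq> {} \<and> (C \<noteq> UNIV \<or> D \<noteq> UNIV)}"

definition block_weight :: "('m::finite, 'n::finite) data \<Rightarrow> 'm option set \<times> 'n option set \<Rightarrow> complex" where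
  "block_weight u b = (\<Sum>k\<in>fst b. \<Sum>l\<in>snd b. weight u k l)"

definition resonance :: "('m::finite, 'n::finite) data \<Rightarrow> complex" where
  "resonance u = (\<Prod>b\<in>proper_blocks. block_weight u b)"

lemma singleton_proper_block: "({k}, {l}) \<in> proper_blocks"
proof -
  have "{k} \<noteq> UNIV" by (metis UNIV_I notin_range_Some option.distinct(1) rangeI singletonD)
  then show ?thesis by (simp add: proper_blocks_def)
qed

lemma resonance_nonzero_iff: "resonance u \<noteq> 0 \<longleftrightarrow> (\<forall>b\<in>proper_blocks. block_weight u b \<noteq> 0)"
  by (simp add: resonance_def)

lemma nonresonant_weight_nonzero:
  assumes "resonance u \<noteq> 0"
  shows "weight u k l \<noteq> 0"
  using assms singleton_proper_block[of k l] unfolding resonance_nonzero_iff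
  by (force simp: block_weight_def)

lemma nonresonant_nonzero:
  assumes "resonance u \<noteq> 0"
  shows "fst u $ i \<noteq> 0" "fst (snd u) $ j \<noteq> 0" "snd (snd u) $ i $ j \<noteq> 0" "sample_size u \<noteq> 0"
  using nonresonant_weight_nonzero[OF assms, of "Some i" None]
    nonresonant_weight_nonzero[OF assms, of None "Some j"]
    nonresonant_weight_nonzero[OF assms, of "Some i" "Some j"]
    nonresonant_weight_nonzero[OF assms, of None None]
  by (simp_all add: weight_def)

lemma polynomial_weight: "polynomial_on_data (\<lambda>u. weight u k l)"
  unfolding weight_def sample_size_def
  by (cases k; cases l) (auto intro!: polynomial_intros polynomial_components)

lemma polynomial_resonance: "polynomial_on_data resonance"
  unfolding resonance_def block_weight_def by (intro polynomial_prod polynomial_sum polynomial_weight)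

lemma continuous_on_weight [continuous_intros]:
  "continuous_on A f \<Longrightarrow> continuous_on A (\<lambda>z. weight (f z) k l)"
  unfolding weight_def sample_size_def
  by (cases k; cases l) (auto intro!: continuous_intros)

text \<open>
  Points at distance 1, namely \<open>0\<close> and \<open>1\<close>, are among those to which \<open>points_separated\<close> applies.
  Comparing the other distances with this one bounds the \<open>a\<^sub>i\<close> and \<open>b\<^sub>j\<close>; comparing this one
  with a gap bounds the gap from below. The constants depend only on a lower bound for the block
  weights and an upper bound for the total weight, which persist near \<open>u0\<close>.
\<close>

lemma nonresonant_fibres_bounded:
  fixes u0 :: "('m::finite, 'n::finite) data"
  assumes "resonance u0 \<noteq> 0"
  shows "\<exists>K>0. \<forall>\<^sub>F u in nhds u0. \<forall>x\<in>fibre u.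
    (\<forall>i. norm (fst x $ i) \<le> K) \<and> (\<forall>j. norm (fst (snd x) $ j) \<le> K) \<and> (\<forall>i j. norm (gap x i j) \<ge> 1 / K)"
proof -
  define total :: "('m, 'n) data \<Rightarrow> real" where "total u = (\<Sum>k\<in>UNIV. \<Sum>l\<in>UNIV. norm (weight u k l))" for u
  define \<eta> where "\<eta> = Min ((\<lambda>b. norm (block_weight u0 b)) ` proper_blocks) / 2"
  define W where "W = total u0 + 1"
  \<comment> \<open>This makes \<open>\<eta> (L - 1)\<close> equal to \<open>W\<close>, which exceeds the total weight.\<close>
  define L where "L = W / \<eta> + 1"
  define M where "M = L ^ (CARD('m option) + CARD('n option))"
  have ne: "(proper_blocks :: ('m option set \<times> 'n option set) set) \<noteq> {}"
    using singleton_proper_block by blast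
  have "0 < Min ((\<lambda>b. norm (block_weight u0 b)) ` proper_blocks)"
    using ne assms by (subst Min_gr_iff) (auto simp: resonance_nonzero_iff)
  then have \<eta>: "\<eta> > 0" by (simp add: \<eta>_def)
  have \<eta>_less: "\<eta> < norm (block_weight u0 b)" if "b \<in> proper_blocks" for b
  proof -
    have "2 * \<eta> \<le> norm (block_weight u0 b)" unfolding \<eta>_def using that by (simp add: Min_le)
    then show ?thesis using \<eta> by linarith
  qed
  have cont: "isCont (\<lambda>u. norm (block_weight u b)) u0" "isCont total u0" for b
    unfolding block_weight_def total_def
    by (rule continuous_on_interior[of UNIV]; auto intro!: continuous_intros)+
  note lim = cont(1)[unfolded isCont_def tendsto_at_iff_tendsto_nhds[of "\<lambda>u. norm (block_weight u _)"]]
    cont(2)[unfolded isCont_def tendsto_at_iff_tendsto_nhds]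
  have "\<forall>b\<in>proper_blocks. \<forall>\<^sub>F u in nhds u0. \<eta> < norm (block_weight u b)"
    using order_tendstoD(1)[OF lim(1)] \<eta>_less by blast
  then have 1: "\<forall>\<^sub>F u in nhds u0. \<forall>b\<in>proper_blocks. \<eta> < norm (block_weight u b)"
    by (intro eventually_ball_finite) auto
  have 2: "\<forall>\<^sub>F u in nhds u0. total u < W"
    by (rule order_tendstoD(2)[OF lim(2)]) (simp add: W_def)
  have W: "W > 0" unfolding W_def total_def by (intro add_nonneg_pos sum_nonneg) auto
  then have L: "L \<ge> 1" using \<eta> by (simp add: L_def)
  then have M: "M \<ge> 1" unfolding M_def by (rule one_le_power)
  have "(\<forall>i. norm (fst x $ i) \<le> 2 * M + 1) \<and> (\<forall>j. norm (fst (snd x) $ j) \<le> 2 * M + 1)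
      \<and> (\<forall>i j. norm (gap x i j) \<ge> 1 / (2 * M + 1))"
    if u: "\<forall>b\<in>proper_blocks. \<eta> < norm (block_weight u b)" "total u < W" and x: "x \<in> fibre u" for u x
  proof -
    have "resonance u \<noteq> 0" unfolding resonance_nonzero_iff
    proof
      fix b :: "'m option set \<times> 'n option set" assume "b \<in> proper_blocks"
      from bspec[OF u(1) this] \<eta> show "block_weight u b \<noteq> 0" by auto
    qed
    note nz = nonresonant_nonzero[OF this]
    note bal = fibre_balanced[OF x nz(1,2)]
    have block: "\<eta> \<le> norm (\<Sum>k\<in>C. \<Sum>l\<in>D. weight u k l)"
      if "C \<noteq> {}" "D \<noteq> {}" "C \<noteq> UNIV \<or> D \<noteq> UNIV" for C D
    proof -
      have "(C, D) \<in> proper_blocks" using that by (simp add: proper_blocks_def)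
      from bspec[OF u(1) this] show ?thesis by (simp add: block_weight_def)
    qed
    have "\<eta> * (L - 1) = W" using \<eta> by (simp add: L_def)
    then have tot: "(\<Sum>k\<in>UNIV. \<Sum>l\<in>UNIV. norm (weight u k l)) < \<eta> * (L - 1)"
      using u(2) by (simp add: total_def)
    have sep: "norm (row_point x k' - row_point x k) \<le> M * norm (col_point x l - row_point x k)"
      "norm (col_point x l' - row_point x k) \<le> M * norm (col_point x l - row_point x k)" for k k' l l'
      unfolding M_def by (rule points_separated[OF bal block tot L]; assumption)+
    have "norm (fst x $ i - 1) \<le> M" for i
      using sep(1)[of "Some i" None None] by (simp add: row_point_def col_point_def)
    then have a: "norm (fst x $ i) \<le> 2 * M + 1" for i
      using M norm_triangle_ineq2[of "fst x $ i" 1] by (smt (verit) norm_one)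
    have "norm (fst (snd x) $ j - 1) \<le> M" for j
      using sep(2)[of "Some j" None None] by (simp add: row_point_def col_point_def)
    then have b: "norm (fst (snd x) $ j) \<le> 2 * M + 1" for j
      using M norm_triangle_ineq2[of "fst (snd x) $ j" 1] by (smt (verit) norm_one)
    have "norm (gap x i j) \<ge> 1 / (2 * M + 1)" for i j
    proof -
      have "1 = norm ((1 - fst x $ i) - (0 - fst x $ i))" by simp
      also have "\<dots> \<le> norm (1 - fst x $ i) + norm (0 - fst x $ i)" by (rule norm_triangle_ineq4)
      also have "\<dots> \<le> M * norm (gap x i j) + M * norm (gap x i j)"
        using sep(1)[of None "Some i" "Some j"] sep(2)[of None "Some i" "Some j"]
        by (intro add_mono) (simp_all add: row_point_def col_point_def gap_def)
      also have "\<dots> \<le> (2 * M + 1) * norm (gap x i j)" by (simp add: algebra_simps)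
      finally show ?thesis using M by (simp add: divide_le_eq mult.commute)
    qed
    then show ?thesis using a b by blast
  qed
  then have "\<forall>\<^sub>F u in nhds u0. \<forall>x\<in>fibre u. (\<forall>i. norm (fst x $ i) \<le> 2 * M + 1) \<and>
      (\<forall>j. norm (fst (snd x) $ j) \<le> 2 * M + 1) \<and> (\<forall>i j. norm (gap x i j) \<ge> 1 / (2 * M + 1))"
    using eventually_conj[OF 1 2] by (auto elim!: eventually_mono)
  then show ?thesis using M by (intro exI[of _ "2 * M + 1"]) auto
qed

lemma bounded_vec_entries: "bounded {v :: ('a::real_normed_vector)^'k::finite. \<forall>i. norm (v $ i) \<le> K}"
proof (rule boundedI)
  fix v :: "'a^'k" assume "v \<in> {v. \<forall>i. norm (v $ i) \<le> K}"
  then have "(\<Sum>i\<in>UNIV. norm (v $ i)) \<le> (\<Sum>i\<in>(UNIV :: 'k set). K)" by (intro sum_mono) auto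
  moreover have "norm v \<le> (\<Sum>i\<in>UNIV. norm (v $ i))" unfolding norm_vec_def by (rule L2_set_le_sum) auto
  ultimately show "norm v \<le> of_nat CARD('k) * K" by simp
qed

lemma fibre_table: "x \<in> fibre u \<Longrightarrow> snd (snd x) = snd (snd u)"
  by (auto simp: fibre_def crit_map_def)

text \<open>
  Properness of \<open>crit_map\<close> over nonresonant data: the bounds keep a subsequence in a compact
  part of the domain.
\<close>

lemma fibre_sequence_limit:
  fixes u0 :: "('m::finite, 'n::finite) data"
  assumes "resonance u0 \<noteq> 0" and u: "u \<longlonglongrightarrow> u0" and x: "\<And>n. x n \<in> fibre (u n)"
  shows "\<exists>x0 r. x0 \<in> fibre u0 \<and> strict_mono r \<and> (x \<circ> r) \<longlonglongrightarrow> x0"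
proof -
  obtain K where K: "K > 0" "\<forall>\<^sub>F u in nhds u0. \<forall>x\<in>fibre u.
    (\<forall>i. norm (fst x $ i) \<le> K) \<and> (\<forall>j. norm (fst (snd x) $ j) \<le> K) \<and> (\<forall>i j. norm (gap x i j) \<ge> 1 / K)"
    using nonresonant_fibres_bounded[OF assms(1)] by blast
  have "\<forall>\<^sub>F n in sequentially. \<forall>x\<in>fibre (u n). (\<forall>i. norm (fst x $ i) \<le> K) \<and>
      (\<forall>j. norm (fst (snd x) $ j) \<le> K) \<and> (\<forall>i j. norm (gap x i j) \<ge> 1 / K)"
    using K(2) u by (rule eventually_compose_filterlim)
  then obtain n0 where n0: "\<And>n. n \<ge> n0 \<Longrightarrow> (\<forall>i. norm (fst (x n) $ i) \<le> K) \<and>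
      (\<forall>j. norm (fst (snd (x n)) $ j) \<le> K) \<and> (\<forall>i j. norm (gap (x n) i j) \<ge> 1 / K)"
    using x unfolding eventually_sequentially by blast
  have "bounded (range u)" using u by (rule convergent_imp_bounded)
  then have "bounded ((\<lambda>v. snd (snd v)) ` range u)" using bounded_snd[OF bounded_snd[OF \<open>bounded (range u)\<close>]] by (simp add: image_image)
  moreover have T: "snd (snd (x n)) = snd (snd (u n))" for n using fibre_table[OF x] .
  ultimately have bT: "bounded (range (\<lambda>n. snd (snd (x n))))" by (simp add: image_image)
  let ?A = "{v :: complex^'m. \<forall>i. norm (v $ i) \<le> K} \<times> {v :: complex^'n. \<forall>i. norm (v $ i) \<le> K}
      \<times> range (\<lambda>n. snd (snd (x n)))"
  have "bounded ?A" by (rule bounded_Times[OF bounded_vec_entries bounded_Times[OF bounded_vec_entries bT]])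
  moreover have "x (n + n0) \<in> ?A" for n
    using n0[of "n + n0"] by (simp add: mem_Times_iff)
  then have "range (\<lambda>n. x (n + n0)) \<subseteq> ?A" by blast
  ultimately have "bounded (range (\<lambda>n. x (n + n0)))" by (rule bounded_subset)
  then obtain x0 r where r: "strict_mono r" "((\<lambda>n. x (n + n0)) \<circ> r) \<longlonglongrightarrow> x0"
    using bounded_imp_convergent_subsequence by blast
  define r' where "r' n = r n + n0" for n
  have r': "strict_mono r'" using r(1) by (simp add: strict_mono_def r'_def)
  have lim: "(x \<circ> r') \<longlonglongrightarrow> x0" using r(2) by (simp add: comp_def r'_def)
  have "norm (gap x0 i j) \<ge> 1 / K" for i j
  proof (rule tendsto_lowerbound)
    show "(\<lambda>n. norm (gap ((x \<circ> r') n) i j)) \<longlonglongrightarrow> norm (gap x0 i j)"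
      unfolding gap_def by (intro tendsto_intros lim)
    show "\<forall>\<^sub>F n in sequentially. 1 / K \<le> norm (gap ((x \<circ> r') n) i j)"
      by (rule always_eventually) (use n0 in \<open>auto simp: r'_def\<close>)
  qed simp
  moreover have "0 < 1 / K" using K(1) by simp
  ultimately have "0 < norm (gap x0 i j)" for i j by (rule less_le_trans[rotated])
  then have adm: "x0 \<in> admissible" by (simp add: admissible_def)
  have "isCont crit_map x0"
    using continuous_on_crit_map adm unfolding continuous_on_eq_continuous_at[OF open_admissible] by blast
  then have "(\<lambda>n. crit_map ((x \<circ> r') n)) \<longlonglongrightarrow> crit_map x0"
    using lim by (rule isCont_tendsto_compose)
  moreover have "(\<lambda>n. crit_map ((x \<circ> r') n)) = u \<circ> r'" using x by (auto simp: fibre_def)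
  moreover have "(u \<circ> r') \<longlonglongrightarrow> u0" using u r' by (rule LIMSEQ_subseq_LIMSEQ)
  ultimately have "crit_map x0 = u0" using LIMSEQ_unique by metis
  then have "x0 \<in> fibre u0" using adm by (simp add: fibre_def)
  then show ?thesis using r' lim by blast
qed


section \<open>The number of critical points is generically constant\<close>

text \<open>
  An infinite fibre would accumulate at one of its points, where the map is injective.
\<close>

lemma finite_fibre:
  assumes res: "resonance u \<noteq> 0" and nondeg: "\<And>x. x \<in> fibre u \<Longrightarrow> crit_jacobian x \<noteq> 0"
  shows "finite (fibre u)"
proof (rule ccontr)
  assume "infinite (fibre u)"
  then obtain x :: "nat \<Rightarrow> _" where x: "inj x" "range x \<subseteq> fibre u"
    using infinite_countable_subset by blast
  obtain x0 r where r: "x0 \<in> fibre u" "strict_mono r" "(x \<circ> r) \<longlonglongrightarrow> x0"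
    using fibre_sequence_limit[OF res tendsto_const[of u], of x] x by blast
  have "x0 \<in> admissible" using r(1) by (simp add: fibre_def)
  then obtain U where U: "open U" "x0 \<in> U" "inj_on crit_map U"
    using crit_map_locally_injective nondeg[OF r(1)] by blast
  have "\<forall>\<^sub>F n in sequentially. (x \<circ> r) n \<in> U" using r(3) U(1,2) by (rule topological_tendstoD)
  then obtain n where "(x \<circ> r) n \<in> U" "(x \<circ> r) (Suc n) \<in> U"
    unfolding eventually_sequentially by (meson le_SucI order_refl)
  moreover have "crit_map ((x \<circ> r) n) = crit_map ((x \<circ> r) (Suc n))"
  proof -
    have "x k \<in> fibre u" for k using x(2) by blast
    then show ?thesis by (simp add: fibre_def)
  qed
  ultimately have "x (r n) = x (r (Suc n))" using U(3) by (auto dest: inj_onD)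
  then show False using x(1) r(2) by (metis injD lessI less_irrefl strict_monoD)
qed

lemma finite_set_separated:
  fixes F :: "'a::metric_space set"
  assumes "finite F"
  shows "\<exists>e>0. \<forall>x\<in>F. \<forall>y\<in>F. x \<noteq> y \<longrightarrow> ball x e \<inter> ball y e = {}"
proof -
  let ?D = "insert 1 ((\<lambda>(x, y). dist x y) ` {(x, y) \<in> F \<times> F. x \<noteq> y})"
  have fin: "finite ?D" using assms by (auto intro: finite_subset[of _ "F \<times> F"])
  have "Min ?D > 0" using fin by (subst Min_gr_iff) auto
  moreover have "ball x (Min ?D / 2) \<inter> ball y (Min ?D / 2) = {}" if "x \<in> F" "y \<in> F" "x \<noteq> y" for x y
  proof -
    have "Min ?D \<le> dist x y" using fin that by (intro Min_le) auto
    then have "\<not> (dist x z < Min ?D / 2 \<and> dist y z < Min ?D / 2)" for z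
      using dist_triangle2[of x y z] by linarith
    then show ?thesis by auto
  qed
  ultimately show ?thesis by (intro exI[of _ "Min ?D / 2"]) auto
qed

text \<open>
  Around the points of the fibre over \<open>u0\<close> there are disjoint open sets on which the map is
  injective; by invariance of domain each of them meets the fibre over a nearby \<open>u\<close> in exactly one
  point. By properness no other points can occur in that fibre.
\<close>

lemma card_fibre_locally_constant:
  assumes res: "resonance u0 \<noteq> 0" and nondeg: "\<And>x. x \<in> fibre u0 \<Longrightarrow> crit_jacobian x \<noteq> 0"
  shows "\<forall>\<^sub>F u in nhds u0. card (fibre u) = card (fibre u0)"
proof -
  have fin: "finite (fibre u0)" by (rule finite_fibre[OF assms])
  obtain e where e: "e > 0"
    "\<And>x y. x \<in> fibre u0 \<Longrightarrow> y \<in> fibre u0 \<Longrightarrow> x \<noteq> y \<Longrightarrow> ball x e \<inter> ball y e = {}"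
    using finite_set_separated[OF fin] by blast
  have "\<forall>x\<in>fibre u0. \<exists>U. open U \<and> x \<in> U \<and> U \<subseteq> admissible \<and> inj_on crit_map U"
  proof
    fix x assume x: "x \<in> fibre u0"
    then have "x \<in> admissible" by (simp add: fibre_def)
    then show "\<exists>U. open U \<and> x \<in> U \<and> U \<subseteq> admissible \<and> inj_on crit_map U"
      using crit_map_locally_injective nondeg[OF x] by blast
  qed
  from bchoice[OF this] obtain U where U: "\<And>x. x \<in> fibre u0 \<Longrightarrow> open (U x) \<and> x \<in> U x \<and> U x \<subseteq> admissible \<and> inj_on crit_map (U x)"
    by blast
  define V where "V x = U x \<inter> ball x e" for x
  have V: "open (V x)" "x \<in> V x" "V x \<subseteq> admissible" "inj_on crit_map (V x)" if "x \<in> fibre u0" for x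
    using U[OF that] e(1) by (auto simp: V_def intro: inj_on_subset)
  have disj: "V x \<inter> V y = {}" if "x \<in> fibre u0" "y \<in> fibre u0" "x \<noteq> y" for x y
    using e(2)[OF that] by (auto simp: V_def)
  have "\<forall>\<^sub>F u in nhds u0. u \<in> crit_map ` V x" if x: "x \<in> fibre u0" for x
  proof (rule eventually_nhds_in_open)
    show "open (crit_map ` V x)"
      using continuous_on_subset[OF continuous_on_crit_map V(3)[OF x]] V(1,4)[OF x]
      by (rule invariance_of_domain)
    show "u0 \<in> crit_map ` V x" using V(2)[OF x] x by (auto simp: fibre_def)
  qed
  then have 1: "\<forall>\<^sub>F u in nhds u0. \<forall>x\<in>fibre u0. u \<in> crit_map ` V x"
    using fin by (intro eventually_ball_finite) auto
  have 2: "\<forall>\<^sub>F u in nhds u0. fibre u \<subseteq> (\<Union>x\<in>fibre u0. V x)"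
    unfolding eventually_nhds_iff_sequentially
  proof (intro allI impI, rule ccontr)
    fix f assume f: "f \<longlonglongrightarrow> u0"
      and "\<not> (\<forall>\<^sub>F n in sequentially. fibre (f n) \<subseteq> (\<Union>x\<in>fibre u0. V x))"
    then obtain s :: "nat \<Rightarrow> nat" where s: "strict_mono s" "\<And>n. \<not> fibre (f (s n)) \<subseteq> (\<Union>x\<in>fibre u0. V x)"
      using not_eventually_sequentiallyD by blast
    then have "\<forall>n. \<exists>y. y \<in> fibre (f (s n)) \<and> y \<notin> (\<Union>x\<in>fibre u0. V x)" by blast
    from choice[OF this] obtain y where y: "\<And>n. y n \<in> fibre (f (s n))" "\<And>n. y n \<notin> (\<Union>x\<in>fibre u0. V x)"
      by blast
    have "(f \<circ> s) \<longlonglongrightarrow> u0" using f s(1) by (rule LIMSEQ_subseq_LIMSEQ)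
    then obtain y0 r where r: "y0 \<in> fibre u0" "(y \<circ> r) \<longlonglongrightarrow> y0"
      using fibre_sequence_limit[OF res, of "f \<circ> s" y] y(1) by auto
    have "\<forall>\<^sub>F n in sequentially. (y \<circ> r) n \<in> V y0"
      using r(2) V(1,2)[OF r(1)] by (rule topological_tendstoD)
    then obtain n where "(y \<circ> r) n \<in> V y0" unfolding eventually_sequentially by blast
    then show False using y(2)[of "r n"] r(1) by auto
  qed
  show ?thesis
  proof (rule eventually_mono[OF eventually_conj[OF 1 2]])
    fix u assume u: "(\<forall>x\<in>fibre u0. u \<in> crit_map ` V x) \<and> fibre u \<subseteq> (\<Union>x\<in>fibre u0. V x)"
    have single: "\<exists>y. fibre u \<inter> V x = {y}" if x: "x \<in> fibre u0" for x
    proof -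
      obtain y where y: "y \<in> V x" "crit_map y = u" using u x by blast
      then have "y \<in> fibre u" using V(3)[OF x] by (auto simp: fibre_def)
      moreover have "y' = y" if "y' \<in> fibre u \<inter> V x" for y'
        using that y V(4)[OF x] by (auto simp: fibre_def dest: inj_onD)
      ultimately show ?thesis using y(1) by blast
    qed
    have "fibre u = (\<Union>x\<in>fibre u0. fibre u \<inter> V x)" using u by blast
    also have "card \<dots> = (\<Sum>x\<in>fibre u0. card (fibre u \<inter> V x))"
    proof (rule card_UN_disjoint[OF fin])
      show "\<forall>x\<in>fibre u0. finite (fibre u \<inter> V x)" using single by fastforce
      show "\<forall>x\<in>fibre u0. \<forall>y\<in>fibre u0. x \<noteq> y \<longrightarrow> (fibre u \<inter> V x) \<inter> (fibre u \<inter> V y) = {}"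
        using disj by blast
    qed
    also have "\<dots> = (\<Sum>x\<in>fibre u0. 1)"
      by (intro sum.cong refl) (use single in fastforce)
    finally show "card (fibre u) = card (fibre u0)" by simp
  qed
qed

lemma continuous_on_line: "continuous_on A (line x v)"
  unfolding line_def of_coords_def by (intro continuous_intros)

lemma card_fibre_generically_constant:
  assumes h: "polynomial_on_data h"
    and good: "\<And>u. h u \<noteq> 0 \<Longrightarrow> resonance u \<noteq> 0 \<and> (\<forall>x\<in>fibre u. crit_jacobian x \<noteq> 0)"
    and u: "h u \<noteq> 0" and v: "h v \<noteq> 0"
  shows "card (fibre u) = card (fibre v)"
proof -
  let ?L = "line u (\<lambda>k. coord k v - coord k u)"
  obtain p where p: "\<And>s. h (?L s) = poly p s" using polynomial_on_line[OF h] by blast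
  have "p \<noteq> 0" using p[of 0] u by auto
  then have fin: "finite {s. poly p s = 0}" by (rule poly_roots_finite)
  define A where "A = - {s. poly p s = 0}"
  have "path_connected A" unfolding A_def
    by (rule path_connected_complement_countable) (use fin in \<open>auto intro: countable_finite\<close>)
  then have "connected A" by (rule path_connected_imp_connected)
  moreover have "0 \<in> A" "1 \<in> A" using p[of 0] p[of 1] u v by (auto simp: A_def line_1)
  moreover have "\<forall>s\<in>A. \<forall>\<^sub>F t in at s within A. card (fibre (?L s)) = card (fibre (?L t))"
  proof
    fix s assume s: "s \<in> A"
    then have "h (?L s) \<noteq> 0" by (simp add: p A_def)
    have "\<forall>\<^sub>F u in nhds (?L s). card (fibre u) = card (fibre (?L s))"
      by (rule card_fibre_locally_constant) (use good[OF \<open>h (?L s) \<noteq> 0\<close>] in blast)+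
    moreover have "(?L \<longlongrightarrow> ?L s) (at s within A)"
      using continuous_on_line s unfolding continuous_on_def by blast
    ultimately have "\<forall>\<^sub>F t in at s within A. card (fibre (?L t)) = card (fibre (?L s))"
      by (rule eventually_compose_filterlim)
    then show "\<forall>\<^sub>F t in at s within A. card (fibre (?L s)) = card (fibre (?L t))"
      by (rule eventually_mono) simp
  qed
  ultimately have "card (fibre (?L 0)) = card (fibre (?L 1))"
    by (rule connected_local_const[where f = "\<lambda>s. card (fibre (?L s))"])
  then show ?thesis by (simp add: line_1)
qed


section \<open>Counting staircase relations\<close>

text \<open>
  The rows of the relation form a chain, and no row or column is empty; after permuting rows and
  columns the related pairs form a Young diagram.
\<close>

definition staircases :: "'a set \<Rightarrow> 'b set \<Rightarrow> ('a \<times> 'b) set set" where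
  "staircases I J = {\<sigma>. \<sigma> \<subseteq> I \<times> J \<and>
     (\<forall>i\<in>I. \<forall>i'\<in>I. \<sigma> `` {i} \<subseteq> \<sigma> `` {i'} \<or> \<sigma> `` {i'} \<subseteq> \<sigma> `` {i}) \<and>
     (\<forall>i\<in>I. \<sigma> `` {i} \<noteq> {}) \<and> \<sigma> `` I = J}"

lemma chain_image_attained:
  assumes "finite I" "I \<noteq> {}" "finite \<sigma>"
    and chain: "\<And>i i'. i \<in> I \<Longrightarrow> i' \<in> I \<Longrightarrow> \<sigma> `` {i} \<subseteq> \<sigma> `` {i'} \<or> \<sigma> `` {i'} \<subseteq> \<sigma> `` {i}"
  shows "\<exists>i\<in>I. \<sigma> `` {i} = \<sigma> `` I"
proof -
  obtain i where i: "i \<in> I" "\<And>i'. i' \<in> I \<Longrightarrow> card (\<sigma> `` {i'}) \<le> card (\<sigma> `` {i})"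
  proof -
    let ?R = "(\<lambda>i. card (\<sigma> `` {i})) ` I"
    have "Max ?R \<in> ?R" using assms by (intro Max_in) auto
    then obtain i where "i \<in> I" "card (\<sigma> `` {i}) = Max ?R" by auto
    then show ?thesis using that[of i] Max_ge[of ?R] assms(1) by auto
  qed
  have "\<sigma> `` {i'} \<subseteq> \<sigma> `` {i}" if "i' \<in> I" for i'
  proof (rule ccontr)
    assume "\<not> ?thesis"
    then have "\<sigma> `` {i} \<subset> \<sigma> `` {i'}" using chain[OF i(1) that] by auto
    then have "card (\<sigma> `` {i}) < card (\<sigma> `` {i'})"
      using assms(3) by (intro psubset_card_mono finite_Image)
    then show False using i(2)[OF that] by simp
  qed
  then show ?thesis using i(1) by (intro bexI[of _ i]) auto
qed

text \<open>
  A chain of rows with union \<open>J\<close> contains \<open>J\<close> itself. Removing the full rows leaves a staircase on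
  fewer rows, \<open>X\<close>, and on the columns \<open>Y\<close> that these still cover; both sets are proper
  subsets, and \<open>X\<close> may be empty.
\<close>

lemma staircases_decompose:
  assumes "finite I" "finite J" "I \<noteq> {}" "J \<noteq> {}"
  shows "bij_betw (\<lambda>(X, Y, \<tau>). (I - X) \<times> J \<union> \<tau>)
    (SIGMA X:{X. X \<subset> I}. SIGMA Y:{Y. Y \<subset> J}. staircases X Y) (staircases I J)"
proof -
  define X where "X \<sigma> = {i \<in> I. \<sigma> `` {i} \<noteq> J}" for \<sigma>
  show ?thesis
  proof (rule bij_betwI[where g = "\<lambda>\<sigma>. (X \<sigma>, \<sigma> `` X \<sigma>, \<sigma> \<inter> X \<sigma> \<times> UNIV)"])
    show "(\<lambda>(X, Y, \<tau>). (I - X) \<times> J \<union> \<tau>) \<in>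
        (SIGMA X:{X. X \<subset> I}. SIGMA Y:{Y. Y \<subset> J}. staircases X Y) \<rightarrow> staircases I J"
    proof (rule funcsetI)
      fix z assume z: "z \<in> (SIGMA X:{X. X \<subset> I}. SIGMA Y:{Y. Y \<subset> J}. staircases X Y)"
      then obtain X Y \<tau> where z': "z = (X, Y, \<tau>)"
        and X: "X \<subset> I" and Y: "Y \<subset> J" and \<tau>: "\<tau> \<in> staircases X Y" by blast
      let ?s = "(I - X) \<times> J \<union> \<tau>"
      have rows: "?s `` {i} = (if i \<in> X then \<tau> `` {i} else J)" if "i \<in> I" for i
        using that \<tau> by (auto simp: staircases_def)
      have sub: "\<tau> `` {i} \<subseteq> J" for i using \<tau> Y by (auto simp: staircases_def)
      obtain i0 where "i0 \<in> I" "i0 \<notin> X" using X by blast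
      then have "?s `` I = J" using sub by blast
      moreover have "\<forall>i\<in>I. ?s `` {i} \<noteq> {}" using \<tau> assms(4) by (auto simp: rows staircases_def)
      moreover have "?s \<subseteq> I \<times> J" using \<tau> X Y by (auto simp: staircases_def)
      moreover have "\<forall>i\<in>I. \<forall>i'\<in>I. ?s `` {i} \<subseteq> ?s `` {i'} \<or> ?s `` {i'} \<subseteq> ?s `` {i}"
      proof (intro ballI)
        fix i i' assume i: "i \<in> I" "i' \<in> I"
        have "\<tau> `` {i} \<subseteq> \<tau> `` {i'} \<or> \<tau> `` {i'} \<subseteq> \<tau> `` {i}" if "i \<in> X" "i' \<in> X"
          using \<tau> that by (simp add: staircases_def)
        then show "?s `` {i} \<subseteq> ?s `` {i'} \<or> ?s `` {i'} \<subseteq> ?s `` {i}"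
          unfolding rows[OF i(1)] rows[OF i(2)] using sub by auto
      qed
      ultimately show "(case z of (X, Y, \<tau>) \<Rightarrow> (I - X) \<times> J \<union> \<tau>) \<in> staircases I J"
        by (simp add: staircases_def z')
    qed
    show "(\<lambda>\<sigma>. (X \<sigma>, \<sigma> `` X \<sigma>, \<sigma> \<inter> X \<sigma> \<times> UNIV)) \<in> staircases I J \<rightarrow>
        (SIGMA X:{X. X \<subset> I}. SIGMA Y:{Y. Y \<subset> J}. staircases X Y)"
    proof
      fix \<sigma> assume \<sigma>: "\<sigma> \<in> staircases I J"
      then have sub: "\<sigma> \<subseteq> I \<times> J" by (simp add: staircases_def)
      then have fin: "finite \<sigma>" using assms by (blast intro: finite_subset)
      have chain: "\<sigma> `` {i} \<subseteq> \<sigma> `` {i'} \<or> \<sigma> `` {i'} \<subseteq> \<sigma> `` {i}" if "i \<in> I" "i' \<in> I" for i i'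
        using \<sigma> that by (simp add: staircases_def)
      have "\<exists>i\<in>I. \<sigma> `` {i} = \<sigma> `` I" by (rule chain_image_attained) (use assms fin chain in auto)
      then have XI: "X \<sigma> \<subset> I" using \<sigma> by (auto simp: X_def staircases_def)
      have YJ: "\<sigma> `` X \<sigma> \<subset> J"
      proof (cases "X \<sigma> = {}")
        case False
        have "\<exists>i\<in>X \<sigma>. \<sigma> `` {i} = \<sigma> `` X \<sigma>"
          by (rule chain_image_attained) (use False assms fin chain in \<open>auto simp: X_def\<close>)
        then show ?thesis using sub by (auto simp: X_def)
      qed (use assms in auto)
      have rows: "(\<sigma> \<inter> X \<sigma> \<times> UNIV) `` {i} = \<sigma> `` {i}" if "i \<in> X \<sigma>" for i
        using that by auto
      have "\<sigma> \<inter> X \<sigma> \<times> UNIV \<in> staircases (X \<sigma>) (\<sigma> `` X \<sigma>)"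
        unfolding staircases_def
      proof (intro CollectI conjI ballI)
        fix i assume i: "i \<in> X \<sigma>"
        then have "i \<in> I" by (simp add: X_def)
        then show "(\<sigma> \<inter> X \<sigma> \<times> UNIV) `` {i} \<noteq> {}" using \<sigma> by (simp add: rows[OF i] staircases_def)
        fix i' assume i': "i' \<in> X \<sigma>"
        then have "i' \<in> I" by (simp add: X_def)
        then show "(\<sigma> \<inter> X \<sigma> \<times> UNIV) `` {i} \<subseteq> (\<sigma> \<inter> X \<sigma> \<times> UNIV) `` {i'} \<or>
          (\<sigma> \<inter> X \<sigma> \<times> UNIV) `` {i'} \<subseteq> (\<sigma> \<inter> X \<sigma> \<times> UNIV) `` {i}"
          unfolding rows[OF i] rows[OF i'] using chain[OF \<open>i \<in> I\<close>] by simp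
      qed auto
      then show "(X \<sigma>, \<sigma> `` X \<sigma>, \<sigma> \<inter> X \<sigma> \<times> UNIV) \<in>
          (SIGMA X:{X. X \<subset> I}. SIGMA Y:{Y. Y \<subset> J}. staircases X Y)"
        using XI YJ by simp
    qed
    show "(\<lambda>\<sigma>. (X \<sigma>, \<sigma> `` X \<sigma>, \<sigma> \<inter> X \<sigma> \<times> UNIV)) (case z of (X, Y, \<tau>) \<Rightarrow> (I - X) \<times> J \<union> \<tau>) = z"
      if z: "z \<in> (SIGMA X:{X. X \<subset> I}. SIGMA Y:{Y. Y \<subset> J}. staircases X Y)" for z
    proof -
      define \<sigma> where \<sigma>: "\<sigma> = (case z of (X, Y, \<tau>) \<Rightarrow> (I - X) \<times> J \<union> \<tau>)"
      obtain X' Y \<tau> where z': "z = (X', Y, \<tau>)" by (cases z)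
      have X': "X' \<subset> I" "Y \<subset> J" "\<tau> \<in> staircases X' Y" using z by (auto simp: z')
      have \<sigma>': "\<sigma> = (I - X') \<times> J \<union> \<tau>" using \<sigma> z' by simp
      have rows: "\<sigma> `` {i} = (if i \<in> X' then \<tau> `` {i} else J)" if "i \<in> I" for i
        using that X' unfolding \<sigma>' by (auto simp: staircases_def)
      have "\<tau> `` {i} \<subset> J" for i using X' by (auto simp: staircases_def)
      then have "\<sigma> `` {i} \<noteq> J \<longleftrightarrow> i \<in> X'" if "i \<in> I" for i using rows[OF that] by auto
      then have "X \<sigma> = X'" unfolding X_def using X'(1) by blast
      moreover have "\<sigma> \<inter> X' \<times> UNIV = \<tau>" unfolding \<sigma>' using X'(3) by (auto simp: staircases_def)
      moreover have "\<sigma> `` X' = Y" unfolding \<sigma>' using X'(3) by (auto simp: staircases_def)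
      ultimately show ?thesis by (simp add: z' \<sigma>'[symmetric])
    qed
    show "(case (X \<sigma>, \<sigma> `` X \<sigma>, \<sigma> \<inter> X \<sigma> \<times> UNIV) of (X, Y, \<tau>) \<Rightarrow> (I - X) \<times> J \<union> \<tau>) = \<sigma>"
      if "\<sigma> \<in> staircases I J" for \<sigma>
      using that by (auto simp: X_def staircases_def)
  qed
qed

lemma sum_psubsets_card:
  fixes g :: "nat \<Rightarrow> 'c::comm_semiring_1"
  assumes "finite I"
  shows "(\<Sum>X | X \<subset> I. g (card X)) = (\<Sum>x<card I. of_nat (card I choose x) * g x)"
proof -
  have "(\<Sum>X | X \<subset> I. g (card X)) = (\<Sum>x<card I. \<Sum>X | X \<in> {X. X \<subset> I} \<and> card X = x. g (card X))"
    using assms by (intro sum.group[symmetric])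
      (auto intro: finite_subset[of _ "Pow I"] psubset_card_mono)
  also have "\<dots> = (\<Sum>x<card I. of_nat (card I choose x) * g x)"
  proof (intro sum.cong refl)
    fix x assume "x \<in> {..<card I}"
    then have "{X. X \<in> {X. X \<subset> I} \<and> card X = x} = {X. X \<subseteq> I \<and> card X = x}" by auto
    then show "(\<Sum>X | X \<in> {X. X \<subset> I} \<and> card X = x. g (card X)) = of_nat (card I choose x) * g x"
      using n_subsets[OF assms, of x] by simp
  qed
  finally show ?thesis .
qed

text \<open>
  The number of surjections from a set with \<open>m\<close> elements onto one with \<open>k\<close> elements.
\<close>

definition surjections :: "nat \<Rightarrow> nat \<Rightarrow> int" where
  "surjections m k = fact k * int (Stirling m k)"

lemma surjections_explicit:
  "surjections m k = (\<Sum>i\<le>k. (-1) ^ (k - i) * int (k choose i) * int i ^ m)"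
  by (simp add: surjections_def Stirling_explicit atLeast0AtMost)

lemma surjections_0_left: "surjections 0 k = (if k = 0 then 1 else 0)"
  by (cases k) (simp_all add: surjections_def)

lemma surjections_Suc_0: "surjections (Suc m) 0 = 0"
  by (simp add: surjections_def)

lemma surjections_eq_0: "m < k \<Longrightarrow> surjections m k = 0"
  by (simp add: surjections_def)

lemma surjections_Suc:
  "surjections (Suc m) (Suc k) = (int k + 1) * (surjections m k + surjections m (Suc k))"
  by (simp add: surjections_def algebra_simps)

text \<open>
  Both sides, multiplied by \<open>k + 1\<close>, equal \<open>surjections (m + 1) (k + 1)\<close>, by the explicit
  formula and by the recursion.
\<close>

lemma sum_binomial_surjections:
  "(\<Sum>x\<le>m. int (m choose x) * surjections x k) = surjections m k + surjections m (Suc k)"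
proof -
  have "(\<Sum>x\<le>m. int (m choose x) * surjections x k)
      = (\<Sum>i\<le>k. (-1) ^ (k - i) * int (k choose i) * (\<Sum>x\<le>m. int (m choose x) * int i ^ x))"
    unfolding surjections_explicit sum_distrib_left
    by (subst sum.swap) (simp add: mult_ac)
  also have "\<dots> = (\<Sum>i\<le>k. (-1) ^ (k - i) * int (k choose i) * (int i + 1) ^ m)"
    using binomial_ring[of "int _" 1 m] by simp
  finally have A: "(\<Sum>x\<le>m. int (m choose x) * surjections x k) = \<dots>" .
  have "(int k + 1) * (surjections m k + surjections m (Suc k)) = surjections (Suc m) (Suc k)"
    by (rule surjections_Suc[symmetric])
  also have "\<dots> = (\<Sum>i\<le>k. (-1) ^ (k - i) * (int (Suc k choose Suc i) * (int i + 1)) * (int i + 1) ^ m)"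
    unfolding surjections_explicit sum.atMost_Suc_shift
    by (simp add: mult_ac add.commute del: binomial_Suc_Suc)
  also have "\<dots> = (\<Sum>i\<le>k. (-1) ^ (k - i) * ((int k + 1) * int (k choose i)) * (int i + 1) ^ m)"
  proof -
    have "int (Suc k choose Suc i) * (int i + 1) = (int k + 1) * int (k choose i)" for i
      using Suc_times_binomial_eq[of k i] by (metis add.commute of_nat_Suc of_nat_mult)
    then show ?thesis by simp
  qed
  also have "\<dots> = (int k + 1) * (\<Sum>x\<le>m. int (m choose x) * surjections x k)"
    unfolding A sum_distrib_left by (simp add: mult_ac)
  finally show ?thesis by simp
qed

lemma sum_binomial_surjections_less:
  "(\<Sum>x<m. int (m choose x) * surjections x k) = surjections m (Suc k)"
  using sum_binomial_surjections[of m k] by (simp add: lessThan_Suc_atMost[symmetric])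

lemma power_eq_sum_surjections:
  assumes "i \<le> K"
  shows "int i ^ n = (\<Sum>k\<le>K. int (i choose k) * surjections n k)"
proof (induction n)
  case 0
  then show ?case by (simp add: surjections_0_left if_distrib cong: if_cong)
next
  case (Suc n)
  have absorb: "int (i choose Suc k) * (int k + 1) + int (i choose k) * int k = int i * int (i choose k)" for k
  proof -
    have "Suc k * (i choose Suc k) + k * (i choose k) = i * (i choose k)"
    proof (cases "k \<le> i")
      case True
      have "Suc k * (i choose Suc k) = (i - k) * (i choose k)"
        by (simp only: binomial_absorption binomial_absorb_comp)
      then have "Suc k * (i choose Suc k) + k * (i choose k) = ((i - k) + k) * (i choose k)"
        by (simp only: add_mult_distrib)
      then show ?thesis using True by simp
    qed (simp add: binomial_eq_0)
    then have "int (Suc k * (i choose Suc k) + k * (i choose k)) = int (i * (i choose k))" by (rule arg_cong)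
    then show ?thesis by (simp add: algebra_simps)
  qed
  have "(\<Sum>k\<le>Suc K. int (i choose k) * surjections (Suc n) k)
     = (\<Sum>k\<le>K. int (i choose Suc k) * (int k + 1) * surjections n k)
      + (\<Sum>k\<le>K. int (i choose Suc k) * (int k + 1) * surjections n (Suc k))"
    unfolding sum.atMost_Suc_shift
    by (simp add: surjections_Suc_0 surjections_Suc algebra_simps sum.distrib)
  also have "(\<Sum>k\<le>K. int (i choose Suc k) * (int k + 1) * surjections n (Suc k))
     = (\<Sum>k\<le>Suc K. int (i choose k) * int k * surjections n k)"
    unfolding sum.atMost_Suc_shift by (simp add: add.commute)
  also have "\<dots> = (\<Sum>k\<le>K. int (i choose k) * int k * surjections n k)"
    using assms by simp
  also have "(\<Sum>k\<le>K. int (i choose Suc k) * (int k + 1) * surjections n k) + \<dots>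
    = int i * (\<Sum>k\<le>K. int (i choose k) * surjections n k)"
    unfolding sum.distrib[symmetric] sum_distrib_left
    by (intro sum.cong refl) (simp only: absorb mult.assoc[symmetric] flip: distrib_right)
  finally show ?case using Suc assms by (simp add: binomial_eq_0)
qed

text \<open>
  By induction on \<open>m\<close>; \<open>surjections (m + 1) (i + 1)\<close> is \<open>i + 1\<close> times the last factor of the
  summand, so that the recursion can be applied after shifting the index.
\<close>

lemma alternating_sum_surjections:
  "(\<Sum>i\<le>m. (-1) ^ (m - i) * int (i choose k) * (surjections m i + surjections m (Suc i))) = surjections m k"
proof (induction m arbitrary: k)
  case 0
  then show ?case by (cases k) (simp_all add: surjections_0_left)
next
  case (Suc m)
  define h where "h i = surjections m i + surjections m (Suc i)" for i
  have F: "surjections (Suc m) (Suc i) = (int i + 1) * h i" for i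
    by (simp add: surjections_Suc h_def)
  have "(\<Sum>i\<le>Suc m. (-1) ^ (Suc m - i) * int (i choose k) * (surjections (Suc m) i + surjections (Suc m) (Suc i)))
     = (\<Sum>i\<le>Suc m. (-1) ^ (Suc m - i) * int (i choose k) * surjections (Suc m) i)
      + (\<Sum>i\<le>Suc m. (-1) ^ (Suc m - i) * int (i choose k) * surjections (Suc m) (Suc i))"
    by (simp only: distrib_left sum.distrib)
  also have "(\<Sum>i\<le>Suc m. (-1) ^ (Suc m - i) * int (i choose k) * surjections (Suc m) i)
     = (\<Sum>i\<le>m. (-1) ^ (m - i) * int (Suc i choose k) * ((int i + 1) * h i))"
    unfolding sum.atMost_Suc_shift by (simp add: surjections_Suc_0 F)
  also have "(\<Sum>i\<le>Suc m. (-1) ^ (Suc m - i) * int (i choose k) * surjections (Suc m) (Suc i))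
     = (\<Sum>i\<le>m. - ((-1) ^ (m - i) * int (i choose k) * ((int i + 1) * h i)))"
    by (simp add: surjections_eq_0 h_def F Suc_diff_le)
  also have "(\<Sum>i\<le>m. (-1) ^ (m - i) * int (Suc i choose k) * ((int i + 1) * h i)) + \<dots>
    = (\<Sum>i\<le>m. (-1) ^ (m - i) * ((int i + 1) * (int (Suc i choose k) - int (i choose k))) * h i)"
    unfolding sum.distrib[symmetric] by (simp add: algebra_simps)
  also have "\<dots> = surjections (Suc m) k"
  proof (cases k)
    case 0
    then show ?thesis by (simp add: surjections_Suc_0)
  next
    case (Suc k')
    have "(int i + 1) * (int (Suc i choose k) - int (i choose k)) = (int k' + 1) * (int (i choose k') + int (i choose Suc k'))" for i
    proof -
      have "Suc i * (i choose k') = (Suc i choose Suc k') * Suc k'"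
        by (rule Suc_times_binomial_eq)
      then have "int (Suc i * (i choose k')) = int ((Suc i choose Suc k') * Suc k')" by (rule arg_cong)
      then show ?thesis using Suc by (simp add: algebra_simps)
    qed
    then have "(\<Sum>i\<le>m. (-1) ^ (m - i) * ((int i + 1) * (int (Suc i choose k) - int (i choose k))) * h i)
      = (int k' + 1) * ((\<Sum>i\<le>m. (-1) ^ (m - i) * int (i choose k') * h i) + (\<Sum>i\<le>m. (-1) ^ (m - i) * int (i choose Suc k') * h i))"
      by (simp add: sum_distrib_left sum.distrib[symmetric] algebra_simps)
    also have "\<dots> = (int k' + 1) * (surjections m k' + surjections m (Suc k'))"
      unfolding h_def Suc.IH ..
    finally show ?thesis using Suc by (simp add: surjections_Suc)
  qed
  finally show ?case .
qed

text \<open>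
  Sorting the functions on \<open>I\<close> by the preimage of the last value gives
  \<open>surj(m, k + 1) = \<Sum>x<m. (m choose x) surj(x, k)\<close>. The product of this identity for \<open>I\<close> and for \<open>J\<close>,
  summed over \<open>k\<close>, is the recursion obtained from removing the full rows.
\<close>

lemma card_staircases:
  assumes "finite I" "finite J"
  shows "finite (staircases I J) \<and>
    int (card (staircases I J)) = (\<Sum>k\<le>card I. surjections (card I) k * surjections (card J) k)"
  using assms
proof (induction "card I" arbitrary: I J rule: less_induct)
  case less
  have fin: "finite (staircases I J)"
    by (rule finite_subset[of _ "Pow (I \<times> J)"]) (use less.prems in \<open>auto simp: staircases_def\<close>)
  consider "I = {}" | "I \<noteq> {}" "J = {}" | "I \<noteq> {}" "J \<noteq> {}" by blast
  then have "int (card (staircases I J)) = (\<Sum>k\<le>card I. surjections (card I) k * surjections (card J) k)"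
  proof cases
    case 1
    then have "staircases I J = (if J = {} then {{}} else {})" by (auto simp: staircases_def)
    moreover have "surjections (card J) 0 = (if J = {} then 1 else 0)"
      using less.prems by (cases "card J") (auto simp: surjections_0_left surjections_Suc_0)
    ultimately show ?thesis using 1 by (simp add: surjections_0_left)
  next
    case 2
    then have "staircases I J = {}" by (auto simp: staircases_def)
    moreover have "surjections (card I) 0 = 0"
      using 2 less.prems by (cases "card I") (auto simp: surjections_Suc_0)
    ultimately show ?thesis using 2 by (simp add: surjections_0_left if_distrib cong: if_cong)
  next
    case 3
    define m where "m = card I"
    define n where "n = card J"
    obtain m' where m': "m = Suc m'" using 3 less.prems by (cases m) (auto simp: m_def)
    have IH: "finite (staircases X Y)"
      "int (card (staircases X Y)) = (\<Sum>k\<le>m'. surjections (card X) k * surjections (card Y) k)"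
      if "X \<subset> I" "Y \<subset> J" for X Y
    proof -
      have "card X < card I" using that less.prems by (intro psubset_card_mono)
      moreover have fin: "finite X" "finite Y" using that less.prems by (auto intro: finite_subset)
      ultimately have *: "finite (staircases X Y) \<and>
          int (card (staircases X Y)) = (\<Sum>k\<le>card X. surjections (card X) k * surjections (card Y) k)"
        by (intro less.hyps)
      then show "finite (staircases X Y)" by simp
      have "(\<Sum>k\<le>card X. surjections (card X) k * surjections (card Y) k)
        = (\<Sum>k\<le>m'. surjections (card X) k * surjections (card Y) k)"
        by (rule sum.mono_neutral_left)
          (use \<open>card X < card I\<close> m' in \<open>auto simp: m_def surjections_eq_0\<close>)
      then show "int (card (staircases X Y)) = (\<Sum>k\<le>m'. surjections (card X) k * surjections (card Y) k)"
        using * by simp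
    qed
    have finI: "finite {X. X \<subset> I}" "finite {Y. Y \<subset> J}"
      using less.prems by (auto intro: finite_subset[of _ "Pow _"])
    have "card (staircases I J) = card (SIGMA X:{X. X \<subset> I}. SIGMA Y:{Y. Y \<subset> J}. staircases X Y)"
      using bij_betw_same_card[OF staircases_decompose[OF less.prems 3]] by simp
    also have "\<dots> = (\<Sum>X | X \<subset> I. \<Sum>Y | Y \<subset> J. card (staircases X Y))"
      using finI IH(1) by (subst card_SigmaI) (auto intro!: finite_SigmaI sum.cong card_SigmaI)
    finally have "int (card (staircases I J)) = (\<Sum>X | X \<subset> I. \<Sum>Y | Y \<subset> J. int (card (staircases X Y)))"
      by simp
    also have "\<dots> = (\<Sum>X | X \<subset> I. \<Sum>Y | Y \<subset> J. \<Sum>k\<le>m'. surjections (card X) k * surjections (card Y) k)"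
      by (intro sum.cong refl) (use IH(2) in auto)
    also have "\<dots> = (\<Sum>X | X \<subset> I. \<Sum>k\<le>m'. \<Sum>Y | Y \<subset> J. surjections (card X) k * surjections (card Y) k)"
      by (intro sum.cong refl sum.swap)
    also have "\<dots> = (\<Sum>k\<le>m'. \<Sum>X | X \<subset> I. \<Sum>Y | Y \<subset> J. surjections (card X) k * surjections (card Y) k)"
      by (rule sum.swap)
    also have "\<dots> = (\<Sum>k\<le>m'. (\<Sum>X | X \<subset> I. surjections (card X) k) * (\<Sum>Y | Y \<subset> J. surjections (card Y) k))"
      by (simp only: sum_product)
    also have "\<dots> = (\<Sum>k\<le>m'. surjections m (Suc k) * surjections n (Suc k))"
      using less.prems
      by (simp only: sum_psubsets_card[where g = "\<lambda>x. surjections x _"] sum_binomial_surjections_less m_def n_def)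
    also have "\<dots> = (\<Sum>k\<le>m. surjections m k * surjections n k)"
      unfolding m' sum.atMost_Suc_shift by (simp add: surjections_Suc_0)
    finally show ?thesis by (simp add: m_def n_def)
  qed
  then show ?case using fin by blast
qed

text \<open>
  The sum over \<open>l\<close> replaces \<open>(i + 1)\<^sup>n\<^sup>-\<^sup>l\<close> by \<open>i\<^sup>n\<close>, and the sum over \<open>k\<close> combines the
  numbers \<open>surjections (m - k) i\<close> into \<open>surjections m i + surjections m (i + 1)\<close>. Expanding \<open>i\<^sup>n\<close> in the binomial basis \<open>i choose k\<close> leaves the
  alternating sum evaluated above.
\<close>

lemma sum_poly_Bernoulli:
  "(\<Sum>k=0..m. \<Sum>l=0..n. (-1) ^ (k + l) * int (m choose k) * int (n choose l) * poly_Bernoulli (m - k) (n - l))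
    = (\<Sum>k\<le>m. surjections m k * surjections n k)"
proof -
  have B: "poly_Bernoulli L N = (\<Sum>i\<le>m. (-1) ^ (L - i) * surjections L i * (int i + 1) ^ N)"
    if "L \<le> m" for L N
  proof -
    have "poly_Bernoulli L N = (\<Sum>i\<le>L. (-1) ^ (L - i) * surjections L i * (int i + 1) ^ N)"
      by (simp add: poly_Bernoulli_def surjections_def atLeast0AtMost mult.assoc add.commute)
    also have "\<dots> = (\<Sum>i\<le>m. (-1) ^ (L - i) * surjections L i * (int i + 1) ^ N)"
      by (rule sum.mono_neutral_left) (use that in \<open>auto simp: surjections_eq_0\<close>)
    finally show ?thesis .
  qed
  have inner: "(\<Sum>l\<le>n. (-1) ^ l * int (n choose l) * (int i + 1) ^ (n - l)) = int i ^ n" for i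
    using binomial_ring[of "-1" "int i + 1" n] by (simp add: mult_ac)
  have "(\<Sum>k=0..m. \<Sum>l=0..n. (-1) ^ (k + l) * int (m choose k) * int (n choose l) * poly_Bernoulli (m - k) (n - l))
     = (\<Sum>k\<le>m. \<Sum>l\<le>n. \<Sum>i\<le>m. (-1) ^ k * int (m choose k) * ((-1) ^ (m - k - i) * surjections (m - k) i)
          * ((-1) ^ l * int (n choose l) * (int i + 1) ^ (n - l)))"
    unfolding atLeast0AtMost
    by (intro sum.cong refl) (simp add: B sum_distrib_left power_add mult_ac)
  also have "\<dots> = (\<Sum>k\<le>m. \<Sum>i\<le>m. (-1) ^ k * int (m choose k) * ((-1) ^ (m - k - i) * surjections (m - k) i) * int i ^ n)"
  proof (rule sum.cong[OF refl])
    fix k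
    show "(\<Sum>l\<le>n. \<Sum>i\<le>m. (-1) ^ k * int (m choose k) * ((-1) ^ (m - k - i) * surjections (m - k) i)
          * ((-1) ^ l * int (n choose l) * (int i + 1) ^ (n - l)))
      = (\<Sum>i\<le>m. (-1) ^ k * int (m choose k) * ((-1) ^ (m - k - i) * surjections (m - k) i) * int i ^ n)"
      by (subst sum.swap) (simp only: sum_distrib_left[symmetric] inner)
  qed
  also have "\<dots> = (\<Sum>i\<le>m. \<Sum>k\<le>m. (-1) ^ (m - i) * int i ^ n * (int (m choose (m - k)) * surjections (m - k) i))"
  proof (subst sum.swap, intro sum.cong refl)
    fix i k assume ik: "i \<in> {..m}" "k \<in> {..m}"
    show "(-1) ^ k * int (m choose k) * ((-1) ^ (m - k - i) * surjections (m - k) i) * int i ^ n =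
      (-1) ^ (m - i) * int i ^ n * (int (m choose (m - k)) * surjections (m - k) i)"
    proof (cases "i \<le> m - k")
      case True
      then have "k + (m - k - i) = m - i" using ik by auto
      then have "(-1::int) ^ (m - i) = (-1) ^ k * (-1) ^ (m - k - i)" by (simp flip: power_add)
      moreover have "m choose (m - k) = m choose k" using ik by (simp add: binomial_symmetric[of k m])
      ultimately show ?thesis by simp
    qed (simp add: surjections_eq_0)
  qed
  also have "\<dots> = (\<Sum>i\<le>m. (-1) ^ (m - i) * int i ^ n * (\<Sum>x\<le>m. int (m choose x) * surjections x i))"
    unfolding sum_distrib_left
    by (rule sum.cong[OF refl], rule sum.reindex_bij_witness[of _ "\<lambda>x. m - x" "\<lambda>x. m - x"]) auto
  also have "\<dots> = (\<Sum>i\<le>m. (-1) ^ (m - i) * int i ^ n * (surjections m i + surjections m (Suc i)))"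
    by (simp only: sum_binomial_surjections)
  also have "\<dots> = (\<Sum>i\<le>m. \<Sum>k\<le>m. surjections n k *
        ((-1) ^ (m - i) * int (i choose k) * (surjections m i + surjections m (Suc i))))"
    by (intro sum.cong refl) (simp add: power_eq_sum_surjections[of _ m] sum_distrib_left sum_distrib_right mult_ac)
  also have "\<dots> = (\<Sum>k\<le>m. surjections n k * surjections m k)"
    by (subst sum.swap) (simp add: sum_distrib_left[symmetric] alternating_sum_surjections)
  finally show ?thesis by (simp add: mult.commute)
qed


section \<open>Positive real data\<close>

text \<open>
  Order the rows by size: a larger row gets a smaller \<open>a\<^sub>i\<close>, and \<open>b\<^sub>j\<close> is placed half a step above the
  \<open>a\<^sub>i\<close> of the smallest row containing \<open>j\<close>. The denominators scale everything into the unit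
  interval.
\<close>

lemma staircase_realization:
  fixes \<sigma> :: "('m::finite \<times> 'n::finite) set"
  assumes \<sigma>: "\<sigma> \<in> staircases UNIV UNIV"
  shows "\<exists>a b. (\<forall>i. 0 < a i) \<and> (\<forall>j. b j < (1::real)) \<and>
    (\<forall>i j. if (i, j) \<in> \<sigma> then a i < b j else b j < a i)"
proof -
  define n where "n = real CARD('n)"
  define c where "c i = card (\<sigma> `` {i})" for i
  define \<mu> where "\<mu> j = Min (c ` {i. (i, j) \<in> \<sigma>})" for j
  define a where "a i = (n + 1 - real (c i)) / (n + 1)" for i
  define b where "b j = (n + 3 / 2 - real (\<mu> j)) / (n + 1)" for j
  have n: "n + 1 > 0" by (simp add: n_def add_nonneg_pos)
  have c1: "c i \<ge> 1" for i
  proof -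
    have "\<sigma> `` {i} \<noteq> {}" using \<sigma> by (simp add: staircases_def)
    then show ?thesis by (simp add: c_def Suc_le_eq card_gt_0_iff)
  qed
  have cn: "real (c i) \<le> n" for i by (simp add: c_def n_def card_mono)
  have \<mu>: "\<exists>i. (i, j) \<in> \<sigma> \<and> \<mu> j = c i" for j
  proof -
    have "{i. (i, j) \<in> \<sigma>} \<noteq> {}" using \<sigma> by (auto simp: staircases_def)
    then have "\<mu> j \<in> c ` {i. (i, j) \<in> \<sigma>}" unfolding \<mu>_def by (intro Min_in) auto
    then show ?thesis by auto
  qed
  have "0 < a i" for i using cn[of i] n by (simp add: a_def)
  moreover have "b j < 1" for j
  proof -
    obtain i where "\<mu> j = c i" using \<mu> by blast
    then have "real (\<mu> j) \<ge> 1" using c1[of i] by simp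
    then show ?thesis using n by (simp add: b_def)
  qed
  moreover have "a i < b j" if "(i, j) \<in> \<sigma>" for i j
  proof -
    have "\<mu> j \<le> c i" unfolding \<mu>_def using that by (intro Min_le) auto
    then show ?thesis using n by (simp add: a_def b_def divide_strict_right_mono)
  qed
  moreover have "b j < a i" if ij: "(i, j) \<notin> \<sigma>" for i j
  proof -
    obtain i' where i': "(i', j) \<in> \<sigma>" "\<mu> j = c i'" using \<mu> by blast
    have "\<sigma> `` {i} \<subseteq> \<sigma> `` {i'} \<or> \<sigma> `` {i'} \<subseteq> \<sigma> `` {i}" using \<sigma> by (simp add: staircases_def)
    then have "\<sigma> `` {i} \<subset> \<sigma> `` {i'}" using i' ij by auto
    then have "c i < c i'" unfolding c_def by (intro psubset_card_mono) auto
    then have "real (c i) + 1 \<le> real (\<mu> j)" using i'(2) by simp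
    then show ?thesis using n by (simp add: a_def b_def divide_strict_right_mono)
  qed
  ultimately show ?thesis by (intro exI[of _ a] exI[of _ b]) auto
qed

text \<open>
  The monotonicity of the derivative of the logarithm, the source of concavity and uniqueness.
\<close>

lemma inverse_difference_nonpos:
  fixes x y :: real
  assumes "x * y > 0"
  shows "(x - y) * (1 / x - 1 / y) \<le> 0" and "(x - y) * (1 / x - 1 / y) = 0 \<longleftrightarrow> x = y"
proof -
  have nz: "x \<noteq> 0" "y \<noteq> 0" using assms by auto
  then have "1 / x - 1 / y = - (x - y) / (x * y)" by (simp add: field_simps)
  then have eq: "(x - y) * (1 / x - 1 / y) = - ((x - y)\<^sup>2 / (x * y))"
    by (simp only: power2_eq_square times_divide_eq_right minus_divide_left mult_minus_right)
  show "(x - y) * (1 / x - 1 / y) \<le> 0" unfolding eq using assms by simp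
  show "(x - y) * (1 / x - 1 / y) = 0 \<longleftrightarrow> x = y" unfolding eq using nz by simp
qed

lemma Im_of_real_divide:
  assumes "t > 0"
  shows "Im z \<le> 0 \<Longrightarrow> Im (complex_of_real t / z) \<ge> 0" and "Im z \<ge> 0 \<Longrightarrow> Im (complex_of_real t / z) \<le> 0"
    and "Im z > 0 \<Longrightarrow> Im (complex_of_real t / z) < 0"
proof -
  have eq: "Im (complex_of_real t / z) = - (t * Im z / ((Re z)\<^sup>2 + (Im z)\<^sup>2))"
    by (simp add: Im_divide)
  show "Im (complex_of_real t / z) \<ge> 0" if "Im z \<le> 0"
    unfolding eq using that assms by (simp add: divide_nonpos_nonneg mult_nonneg_nonpos)
  show "Im (complex_of_real t / z) \<le> 0" if "Im z \<ge> 0"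
    unfolding eq using that assms by (simp add: divide_nonneg_nonneg)
  show "Im (complex_of_real t / z) < 0" if "Im z > 0"
  proof -
    have "(Re z)\<^sup>2 + (Im z)\<^sup>2 > 0" using that by (intro add_nonneg_pos) auto
    then show ?thesis unfolding eq using that assms by (simp add: divide_pos_pos)
  qed
qed

lemma ln_on_line_has_derivative:
  assumes "(c :: real) > 0"
  shows "((\<lambda>t. k * ln (c + t * e)) has_real_derivative k * (e / c)) (at 0)"
  using assms by (auto intro!: derivative_eq_intros simp: field_simps)

definition real_data :: "('m::finite \<Rightarrow> 'n::finite \<Rightarrow> real) \<Rightarrow> ('m \<Rightarrow> real) \<Rightarrow> ('n \<Rightarrow> real) \<Rightarrow> ('m, 'n) data" where
  "real_data T a b = (\<chi> i. of_real (a i), \<chi> j. of_real (b j), \<chi> i j. of_real (T i j))"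

definition order_pattern :: "('m \<Rightarrow> real) \<Rightarrow> ('n \<Rightarrow> real) \<Rightarrow> ('m \<times> 'n) set" where
  "order_pattern a b = {(i, j). a i < b j}"

text \<open>
  From here to the end of the section the data \<open>(R, S, T)\<close> are positive reals.
\<close>

context
  fixes R :: "'m::finite \<Rightarrow> real" and S :: "'n::finite \<Rightarrow> real" and T :: "'m \<Rightarrow> 'n \<Rightarrow> real"
  assumes R_pos: "\<And>i. R i > 0" and S_pos: "\<And>j. S j > 0" and T_pos: "\<And>i j. T i j > 0"
begin

definition real_critical :: "('m \<Rightarrow> real) \<Rightarrow> ('n \<Rightarrow> real) \<Rightarrow> bool" where
  "real_critical a b \<longleftrightarrow> (\<forall>i j. b j \<noteq> a i) \<and>
     (\<forall>i. a i * (\<Sum>j\<in>UNIV. T i j / (b j - a i)) = R i) \<and>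
     (\<forall>j. (1 - b j) * (\<Sum>i\<in>UNIV. T i j / (b j - a i)) = S j)"

lemma real_data_in_fibre_iff: "real_data T a b \<in> fibre (real_data T R S) \<longleftrightarrow> real_critical a b"
proof -
  have "complex_of_real (a i) * (\<Sum>j\<in>UNIV. of_real (T i j) / (of_real (b j) - of_real (a i))) = of_real (R i)
      \<longleftrightarrow> a i * (\<Sum>j\<in>UNIV. T i j / (b j - a i)) = R i" for i
    by (subst of_real_eq_iff[where 'a = complex, symmetric]) simp
  moreover have "(1 - complex_of_real (b j)) * (\<Sum>i\<in>UNIV. of_real (T i j) / (of_real (b j) - of_real (a i))) = of_real (S j)
      \<longleftrightarrow> (1 - b j) * (\<Sum>i\<in>UNIV. T i j / (b j - a i)) = S j" for j
    by (subst of_real_eq_iff[where 'a = complex, symmetric]) simp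
  ultimately show ?thesis
    by (simp add: fibre_def admissible_def crit_map_def gap_def real_data_def real_critical_def vec_eq_iff)
qed

text \<open>
  At a point of maximal imaginary part, if that is positive, all terms of the critical equation have
  imaginary parts of the same sign, and the term with the constant point \<open>0\<close> or \<open>1\<close> is not
  real.
\<close>

lemma Im_fibre_nonpos:
  assumes x: "x \<in> fibre (real_data T R S)"
  shows "Im (fst x $ i) \<le> 0" and "Im (fst (snd x) $ j) \<le> 0"
proof -
  obtain a b where x': "x = (a, b, \<chi> i j. of_real (T i j))"
    using fibre_table[OF x] by (cases x) (auto simp: real_data_def)
  have row: "a $ i * (\<Sum>j\<in>UNIV. of_real (T i j) / (b $ j - a $ i)) = of_real (R i)"
    and col: "(1 - b $ j) * (\<Sum>i\<in>UNIV. of_real (T i j) / (b $ j - a $ i)) = of_real (S j)" for i j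
    using x by (auto simp: fibre_def crit_map_def gap_def real_data_def x' vec_eq_iff)
  define M where "M = Max (range (\<lambda>i. Im (a $ i)) \<union> range (\<lambda>j. Im (b $ j)))"
  have M: "Im (a $ i) \<le> M" "Im (b $ j) \<le> M" for i j
    unfolding M_def by (auto intro!: Max_ge)
  have "M \<le> 0"
  proof (rule ccontr)
    assume "\<not> M \<le> 0"
    then have Mpos: "M > 0" by simp
    have "M \<in> range (\<lambda>i. Im (a $ i)) \<union> range (\<lambda>j. Im (b $ j))"
      unfolding M_def by (intro Max_in) auto
    then consider i where "Im (a $ i) = M" | j where "Im (b $ j) = M" by auto
    then show False
    proof cases
      case 1
      then have "a $ i \<noteq> 0" using Mpos by auto
      then have "(\<Sum>j\<in>UNIV. of_real (T i j) / (b $ j - a $ i)) = of_real (R i) / a $ i"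
        using row[of i] by (simp add: eq_divide_eq mult.commute)
      moreover have "Im (\<Sum>j\<in>UNIV. of_real (T i j) / (b $ j - a $ i)) \<ge> 0"
        unfolding Im_sum by (intro sum_nonneg Im_of_real_divide(1) T_pos) (simp add: 1 M)
      moreover have "Im (of_real (R i) / a $ i) < 0"
        by (rule Im_of_real_divide(3)) (use 1 Mpos R_pos in auto)
      ultimately show False by simp
    next
      case 2
      then have "b $ j - 1 \<noteq> 0" using Mpos by auto
      moreover have "(\<Sum>i\<in>UNIV. of_real (T i j) / (b $ j - a $ i)) * (b $ j - 1) = - of_real (S j)"
        using col[of j] by (simp add: algebra_simps)
      ultimately have "(\<Sum>i\<in>UNIV. of_real (T i j) / (b $ j - a $ i)) = - (of_real (S j) / (b $ j - 1))"
        by (metis minus_divide_left nonzero_eq_divide_eq)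
      moreover have "Im (\<Sum>i\<in>UNIV. of_real (T i j) / (b $ j - a $ i)) \<le> 0"
        unfolding Im_sum by (intro sum_nonpos Im_of_real_divide(2) T_pos) (simp add: 2 M)
      moreover have "Im (of_real (S j) / (b $ j - 1)) < 0"
        by (rule Im_of_real_divide(3)) (use 2 Mpos S_pos in auto)
      ultimately show False by simp
    qed
  qed
  then show "Im (fst x $ i) \<le> 0" "Im (fst (snd x) $ j) \<le> 0"
    using M(1)[of i] M(2)[of j] by (simp_all add: x')
qed

text \<open>
  The complex conjugate of a solution is a solution as well, so the bound on imaginary parts
  applies in both directions.
\<close>

lemma fibre_real:
  assumes x: "x \<in> fibre (real_data T R S)"
  shows "x = real_data T (\<lambda>i. Re (fst x $ i)) (\<lambda>j. Re (fst (snd x) $ j))"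
proof -
  obtain a b where x': "x = (a, b, \<chi> i j. of_real (T i j))"
    using fibre_table[OF x] by (cases x) (auto simp: real_data_def)
  have gp: "b $ j \<noteq> a $ i"
    and row: "a $ i * (\<Sum>j\<in>UNIV. of_real (T i j) / (b $ j - a $ i)) = of_real (R i)"
    and col: "(1 - b $ j) * (\<Sum>i\<in>UNIV. of_real (T i j) / (b $ j - a $ i)) = of_real (S j)" for i j
    using x by (auto simp: fibre_def admissible_def crit_map_def gap_def real_data_def x' vec_eq_iff)
  define y :: "('m, 'n) data" where "y = (\<chi> i. cnj (a $ i), \<chi> j. cnj (b $ j), \<chi> i j. of_real (T i j))"
  have "cnj (a $ i) * (\<Sum>j\<in>UNIV. of_real (T i j) / (cnj (b $ j) - cnj (a $ i))) = of_real (R i)" for i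
    using arg_cong[OF row[of i], of cnj] by simp
  moreover have "(1 - cnj (b $ j)) * (\<Sum>i\<in>UNIV. of_real (T i j) / (cnj (b $ j) - cnj (a $ i))) = of_real (S j)" for j
    using arg_cong[OF col[of j], of cnj] by simp
  ultimately have "y \<in> fibre (real_data T R S)"
    using gp by (simp add: y_def fibre_def admissible_def crit_map_def gap_def real_data_def vec_eq_iff)
  from Im_fibre_nonpos[OF this] Im_fibre_nonpos[OF x]
  have "Im (a $ i) = 0" "Im (b $ j) = 0" for i j
    by (auto simp: y_def x' intro!: antisym)
  then show ?thesis by (simp add: real_data_def x' vec_eq_iff complex_eq_iff)
qed

text \<open>
  Signs in the equation of the smallest of all \<open>a\<^sub>i\<close> and \<open>b\<^sub>j\<close> give positivity; those in the equation of
  the largest one give the upper bound.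
\<close>

lemma real_critical_positive:
  assumes "real_critical a b"
  shows "0 < a i" and "b j < 1"
proof -
  have ne: "b j \<noteq> a i" and row: "a i * (\<Sum>j\<in>UNIV. T i j / (b j - a i)) = R i"
    and col: "(1 - b j) * (\<Sum>i\<in>UNIV. T i j / (b j - a i)) = S j" for i j
    using assms by (simp_all add: real_critical_def)
  have row_pos: "0 < a i" if "\<And>j. a i \<le> b j" for i
  proof -
    have "a i < b j" for j using that[of j] ne[of j i] by simp
    then have "0 < (\<Sum>j\<in>UNIV. T i j / (b j - a i))" by (intro sum_pos) (auto simp: T_pos)
    then show ?thesis using row[of i] R_pos[of i] by (metis zero_less_mult_pos2)
  qed
  have row_neg: "a i < 0" if "\<And>j. b j \<le> a i" for i
  proof -
    have "b j < a i" for j using that[of j] ne[of j i] by simp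
    then have "0 < (\<Sum>j\<in>UNIV. T i j / (a i - b j))" by (intro sum_pos) (auto simp: T_pos)
    moreover have "- a i * (\<Sum>j\<in>UNIV. T i j / (a i - b j)) = R i"
    proof -
      have "T i j / (b j - a i) = - (T i j / (a i - b j))" for j
        by (metis minus_diff_eq minus_divide_right)
      then show ?thesis using row[of i] by (simp add: sum_negf)
    qed
    ultimately have "0 < - a i" using R_pos[of i] by (metis zero_less_mult_pos2)
    then show ?thesis by simp
  qed
  have col_pos: "b j < 1" if "\<And>i. a i \<le> b j" for j
  proof -
    have "a i < b j" for i using that[of i] ne[of j i] by simp
    then have "0 < (\<Sum>i\<in>UNIV. T i j / (b j - a i))" by (intro sum_pos) (auto simp: T_pos)
    then have "0 < 1 - b j" using col[of j] S_pos[of j] by (metis zero_less_mult_pos2)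
    then show ?thesis by simp
  qed
  have col_neg: "b j > 1" if "\<And>i. b j \<le> a i" for j
  proof -
    have "b j < a i" for i using that[of i] ne[of j i] by simp
    then have "0 < (\<Sum>i\<in>UNIV. T i j / (a i - b j))" by (intro sum_pos) (auto simp: T_pos)
    moreover have "(b j - 1) * (\<Sum>i\<in>UNIV. T i j / (a i - b j)) = S j"
    proof -
      have "T i j / (b j - a i) = - (T i j / (a i - b j))" for i
        by (metis minus_diff_eq minus_divide_right)
      then show ?thesis using col[of j] by (simp add: sum_negf algebra_simps)
    qed
    ultimately have "0 < b j - 1" using S_pos[of j] by (metis zero_less_mult_pos2)
    then show ?thesis by simp
  qed
  let ?P = "range a \<union> range b"
  have "Min ?P \<in> ?P" by (intro Min_in) auto
  then obtain z where z: "z \<in> ?P" "\<And>y. y \<in> ?P \<Longrightarrow> z \<le> y" using Min_le[of ?P] by auto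
  have "0 < z"
  proof -
    consider i where "z = a i" | j where "z = b j" using z(1) by auto
    then show ?thesis
    proof cases
      case 1 then show ?thesis using row_pos[of i] z(2) by auto
    next
      case 2
      then have "b j \<le> a i" for i using z(2) by auto
      then show ?thesis using col_neg[of j] 2 by auto
    qed
  qed
  then show "0 < a i" using z(2)[of "a i"] by auto
  have "Max ?P \<in> ?P" by (intro Max_in) auto
  then obtain w where w: "w \<in> ?P" "\<And>y. y \<in> ?P \<Longrightarrow> y \<le> w" using Max_ge[of ?P] by auto
  have "w < 1"
  proof -
    consider i where "w = a i" | j where "w = b j" using w(1) by auto
    then show ?thesis
    proof cases
      case 1
      then have "b j \<le> a i" for j using w(2) by auto
      then show ?thesis using row_neg[of i] 1 by auto
    next
      case 2 then show ?thesis using col_pos[of j] w(2) by auto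
    qed
  qed
  then show "b j < 1" using w(2)[of "b j"] by auto
qed

lemma order_pattern_staircase:
  assumes "real_critical a b"
  shows "order_pattern a b \<in> staircases UNIV UNIV"
proof -
  have row: "a i * (\<Sum>j\<in>UNIV. T i j / (b j - a i)) = R i"
    and col: "(1 - b j) * (\<Sum>i\<in>UNIV. T i j / (b j - a i)) = S j" for i j
    using assms by (simp_all add: real_critical_def)
  note pos = real_critical_positive[OF assms]
  have nonpos: "T i j / (b j - a i) \<le> 0" if "b j \<le> a i" for i j
    using that T_pos[of i j] by (simp add: divide_nonneg_nonpos less_imp_le)
  have "\<exists>j. a i < b j" for i
  proof (rule ccontr)
    assume "\<nexists>j. a i < b j"
    then have "(\<Sum>j\<in>UNIV. T i j / (b j - a i)) \<le> 0" by (intro sum_nonpos nonpos) (simp add: not_less)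
    then have "R i \<le> 0" using pos(1)[of i] unfolding row[of i, symmetric] by (simp add: mult_nonneg_nonpos)
    then show False using R_pos[of i] by simp
  qed
  moreover have "\<exists>i. a i < b j" for j
  proof (rule ccontr)
    assume "\<nexists>i. a i < b j"
    then have "(\<Sum>i\<in>UNIV. T i j / (b j - a i)) \<le> 0" by (intro sum_nonpos nonpos) (simp add: not_less)
    then have "S j \<le> 0" using pos(2)[of j] unfolding col[of j, symmetric] by (simp add: mult_nonneg_nonpos)
    then show False using S_pos[of j] by simp
  qed
  moreover have "order_pattern a b `` {i} \<subseteq> order_pattern a b `` {i'} \<or>
      order_pattern a b `` {i'} \<subseteq> order_pattern a b `` {i}" for i i'
    by (cases "a i \<le> a i'") (auto simp: order_pattern_def)
  ultimately show ?thesis by (auto simp: staircases_def order_pattern_def)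
qed

text \<open>
  Each critical point maximizes a strictly concave function on its cell. In coordinates: pairing the difference of the two
  gradients with the difference of the two points gives a sum of nonpositive terms that equals
  zero.
\<close>

lemma real_critical_unique:
  assumes x: "real_critical a b" and y: "real_critical a' b'"
    and eq: "order_pattern a b = order_pattern a' b'"
  shows "a = a'" and "b = b'"
proof -
  define \<phi> where "\<phi> x y = (x - y) * (1 / x - 1 / y)" for x y :: real
  note px = real_critical_positive[OF x] and py = real_critical_positive[OF y]
  have a: "a i * a' i > 0" and b: "(1 - b j) * (1 - b' j) > 0" for i j
    using px py by simp_all
  have d: "(b j - a i) * (b' j - a' i) > 0" for i j
  proof -
    have "b j \<noteq> a i" "b' j \<noteq> a' i" using x y by (simp_all add: real_critical_def)
    moreover have "a i < b j \<longleftrightarrow> a' i < b' j" using eq by (auto simp: order_pattern_def set_eq_iff)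
    ultimately show ?thesis by (auto simp: zero_less_mult_iff)
  qed
  define q where "q i j = T i j * (1 / (b j - a i) - 1 / (b' j - a' i))" for i j
  have q: "q i j = T i j / (b j - a i) - T i j / (b' j - a' i)" for i j
    by (simp add: q_def right_diff_distrib)
  have row: "R i * \<phi> (a i) (a' i) = (\<Sum>j\<in>UNIV. (a i - a' i) * q i j)" for i
  proof -
    have "R i / a i = (\<Sum>j\<in>UNIV. T i j / (b j - a i))" "R i / a' i = (\<Sum>j\<in>UNIV. T i j / (b' j - a' i))"
      using x y px(1)[of i] py(1)[of i] by (auto simp: real_critical_def divide_eq_eq mult.commute)
    then have "R i / a i - R i / a' i = (\<Sum>j\<in>UNIV. q i j)" by (simp add: q sum_subtractf)
    then show ?thesis by (simp add: \<phi>_def sum_distrib_left[symmetric] right_diff_distrib[of "R i"] mult.left_commute)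
  qed
  have col: "S j * \<phi> (1 - b j) (1 - b' j) = (\<Sum>i\<in>UNIV. (b' j - b j) * q i j)" for j
  proof -
    have "S j / (1 - b j) = (\<Sum>i\<in>UNIV. T i j / (b j - a i))" "S j / (1 - b' j) = (\<Sum>i\<in>UNIV. T i j / (b' j - a' i))"
      using x y px(2)[of j] py(2)[of j] by (auto simp: real_critical_def divide_eq_eq mult.commute)
    then have "S j / (1 - b j) - S j / (1 - b' j) = (\<Sum>i\<in>UNIV. q i j)" by (simp add: q sum_subtractf)
    then show ?thesis by (simp add: \<phi>_def sum_distrib_left[symmetric] right_diff_distrib[of "S j"] mult.left_commute)
  qed
  have "(\<Sum>i\<in>UNIV. R i * \<phi> (a i) (a' i)) + (\<Sum>j\<in>UNIV. S j * \<phi> (1 - b j) (1 - b' j))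
      + (\<Sum>i\<in>UNIV. \<Sum>j\<in>UNIV. T i j * \<phi> (b j - a i) (b' j - a' i))
    = (\<Sum>i\<in>UNIV. \<Sum>j\<in>UNIV. (a i - a' i) * q i j + (b' j - b j) * q i j + T i j * \<phi> (b j - a i) (b' j - a' i))"
    unfolding row col sum.distrib by (simp add: sum.swap[of "\<lambda>j i. (b' j - b j) * q i j"])
  also have "\<dots> = 0"
  proof (intro sum.neutral ballI)
    fix i j
    have "T i j * \<phi> (b j - a i) (b' j - a' i) = ((b j - a i) - (b' j - a' i)) * q i j"
      by (simp only: \<phi>_def q_def mult.left_commute)
    then have "(a i - a' i) * q i j + (b' j - b j) * q i j + T i j * \<phi> (b j - a i) (b' j - a' i)
        = ((a i - a' i) + (b' j - b j) + ((b j - a i) - (b' j - a' i))) * q i j"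
      by (simp only: distrib_right)
    then show "(a i - a' i) * q i j + (b' j - b j) * q i j + T i j * \<phi> (b j - a i) (b' j - a' i) = 0"
      by simp
  qed
  finally have sum0: "(\<Sum>i\<in>UNIV. R i * \<phi> (a i) (a' i)) + (\<Sum>j\<in>UNIV. S j * \<phi> (1 - b j) (1 - b' j))
      + (\<Sum>i\<in>UNIV. \<Sum>j\<in>UNIV. T i j * \<phi> (b j - a i) (b' j - a' i)) = 0" .
  have nonpos: "R i * \<phi> (a i) (a' i) \<le> 0" "S j * \<phi> (1 - b j) (1 - b' j) \<le> 0"
    "T i j * \<phi> (b j - a i) (b' j - a' i) \<le> 0" for i j
    using inverse_difference_nonpos(1)[OF a] inverse_difference_nonpos(1)[OF b] inverse_difference_nonpos(1)[OF d]
      R_pos[of i] S_pos[of j] T_pos[of i j]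
    by (simp_all only: \<phi>_def mult_nonneg_nonpos less_imp_le)
  have "(\<Sum>i\<in>UNIV. R i * \<phi> (a i) (a' i)) \<le> 0" "(\<Sum>j\<in>UNIV. S j * \<phi> (1 - b j) (1 - b' j)) \<le> 0"
    "(\<Sum>i\<in>UNIV. \<Sum>j\<in>UNIV. T i j * \<phi> (b j - a i) (b' j - a' i)) \<le> 0"
    by (intro sum_nonpos nonpos)+
  with sum0 have "(\<Sum>i\<in>UNIV. R i * \<phi> (a i) (a' i)) = 0" "(\<Sum>j\<in>UNIV. S j * \<phi> (1 - b j) (1 - b' j)) = 0"
    by linarith+
  then have "R i * \<phi> (a i) (a' i) = 0" "S j * \<phi> (1 - b j) (1 - b' j) = 0" for i j
    using nonpos sum_nonneg_eq_0_iff[of UNIV "\<lambda>i. - (R i * \<phi> (a i) (a' i))"]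
      sum_nonneg_eq_0_iff[of UNIV "\<lambda>j. - (S j * \<phi> (1 - b j) (1 - b' j))"]
    by (simp_all add: sum_negf)
  then have "\<phi> (a i) (a' i) = 0" "\<phi> (1 - b j) (1 - b' j) = 0" for i j
    using R_pos[of i] S_pos[of j] by (metis less_irrefl mult_eq_0_iff)+
  then show "a = a'" "b = b'"
    using inverse_difference_nonpos(2)[OF a] inverse_difference_nonpos(2)[OF b] by (auto simp: \<phi>_def)
qed

text \<open>
  The cell of the staircase is bounded, so the product \<open>F\<close> attains its maximum on the closed
  cell. It vanishes on the boundary, hence the maximum is attained at an interior critical point.
\<close>

lemma real_critical_exists:
  assumes \<sigma>: "\<sigma> \<in> staircases UNIV UNIV"
  shows "\<exists>a b. real_critical a b \<and> order_pattern a b = \<sigma>"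
proof -
  define s :: "'m \<Rightarrow> 'n \<Rightarrow> real" where "s i j = (if (i, j) \<in> \<sigma> then 1 else -1)" for i j
  define A :: "(real^'m) \<times> (real^'n) \<Rightarrow> 'm \<Rightarrow> real" where "A x i = fst x $ i" for x i
  define B :: "(real^'m) \<times> (real^'n) \<Rightarrow> 'n \<Rightarrow> real" where "B x j = 1 - snd x $ j" for x j
  define G :: "(real^'m) \<times> (real^'n) \<Rightarrow> 'm \<Rightarrow> 'n \<Rightarrow> real" where
    "G x i j = s i j * (snd x $ j - fst x $ i)" for x i j
  define Q where "Q = {x. (\<forall>i. 0 \<le> A x i) \<and> (\<forall>j. 0 \<le> B x j) \<and> (\<forall>i j. 0 \<le> G x i j)}"
  \<comment> \<open>\<open>F\<close> is continuous up to the boundary of the cell; its logarithm \<open>\<Lambda>\<close> is used inside.\<close>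
  define F where "F x = (\<Prod>i\<in>UNIV. A x i powr R i) * (\<Prod>j\<in>UNIV. B x j powr S j)
      * (\<Prod>i\<in>UNIV. \<Prod>j\<in>UNIV. G x i j powr T i j)" for x
  define \<Lambda> where "\<Lambda> x = (\<Sum>i\<in>UNIV. R i * ln (A x i)) + (\<Sum>j\<in>UNIV. S j * ln (B x j))
      + (\<Sum>i\<in>UNIV. \<Sum>j\<in>UNIV. T i j * ln (G x i j))" for x
  have cont: "continuous_on X (\<lambda>x. A x i)" "continuous_on X (\<lambda>x. B x j)" "continuous_on X (\<lambda>x. G x i j)" for X i j
    unfolding A_def B_def G_def by (intro continuous_intros)+
  have "compact Q"
  proof -
    have "Q = (\<Inter>i. {x. 0 \<le> A x i}) \<inter> (\<Inter>j. {x. 0 \<le> B x j}) \<inter> (\<Inter>i. \<Inter>j. {x. 0 \<le> G x i j})"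
      by (auto simp: Q_def)
    moreover have "closed {x. 0 \<le> A x i}" "closed {x. 0 \<le> B x j}" "closed {x. 0 \<le> G x i j}" for i j
      by (intro closed_Collect_le continuous_on_const cont)+
    ultimately have "closed Q" by (auto intro!: closed_Int closed_INT)
    moreover have "Q \<subseteq> {v. \<forall>i. norm (v $ i) \<le> 1} \<times> {v. \<forall>i. norm (v $ i) \<le> 1}"
    proof
      fix x assume x: "x \<in> Q"
      have le: "fst x $ i \<le> snd x $ j" if "(i, j) \<in> \<sigma>" for i j
      proof -
        have "0 \<le> G x i j" using x by (simp add: Q_def)
        then show ?thesis using that by (simp add: G_def s_def)
      qed
      have nn: "0 \<le> fst x $ i" "snd x $ j \<le> 1" for i j using x by (auto simp: Q_def A_def B_def)
      have "norm (fst x $ i) \<le> 1" for i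
      proof -
        have "\<sigma> `` {i} \<noteq> {}" using \<sigma> by (simp add: staircases_def)
        then obtain j where "(i, j) \<in> \<sigma>" by auto
        then show ?thesis using le nn(1)[of i] nn(2)[of j] by fastforce
      qed
      moreover have "norm (snd x $ j) \<le> 1" for j
      proof -
        have "j \<in> \<sigma> `` UNIV" using \<sigma> by (simp add: staircases_def)
        then obtain i where "(i, j) \<in> \<sigma>" by auto
        then show ?thesis using le nn(1)[of i] nn(2)[of j] by fastforce
      qed
      ultimately show "x \<in> {v. \<forall>i. norm (v $ i) \<le> 1} \<times> {v. \<forall>i. norm (v $ i) \<le> 1}"
        by (simp add: mem_Times_iff)
    qed
    then have "bounded Q" by (rule bounded_subset[rotated]) (intro bounded_Times bounded_vec_entries)
    ultimately show ?thesis by (simp add: compact_eq_bounded_closed)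
  qed
  moreover have "continuous_on Q F"
    unfolding F_def
    by (intro continuous_on_mult continuous_on_prod continuous_on_powr' cont continuous_on_const)
      (auto simp: Q_def R_pos S_pos T_pos)
  moreover obtain x0 where x0: "\<And>i. 0 < A x0 i" "\<And>j. 0 < B x0 j" "\<And>i j. 0 < G x0 i j"
  proof -
    obtain a b where ab: "\<forall>i. 0 < a i" "\<forall>j. b j < (1::real)"
      "\<forall>i j. if (i, j) \<in> \<sigma> then a i < b j else b j < a i"
      using staircase_realization[OF \<sigma>] by blast
    show thesis
    proof (rule that[of "(\<chi> i. a i, \<chi> j. b j)"])
      show "0 < G (\<chi> i. a i, \<chi> j. b j) i j" for i j
        using ab(3)[rule_format, of i j] by (simp add: G_def s_def split: if_splits)
    qed (use ab in \<open>simp_all add: A_def B_def\<close>)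
  qed
  then have "x0 \<in> Q" by (auto simp: Q_def less_imp_le)
  ultimately obtain z where z: "z \<in> Q" "\<And>x. x \<in> Q \<Longrightarrow> F x \<le> F z"
    using continuous_attains_sup[of Q F] by blast
  have "0 < F x0" unfolding F_def using x0 by (intro mult_pos_pos prod_pos) (auto simp: less_imp_neq[symmetric])
  then have Fz: "0 < F z" using z(2)[OF \<open>x0 \<in> Q\<close>] by simp
  have zA: "0 < A z i" for i
  proof -
    have "F z = 0" if "A z i = 0" using that by (auto simp: F_def)
    then have "A z i \<noteq> 0" using Fz by auto
    then show ?thesis using z(1) by (auto simp: Q_def less_le)
  qed
  have zB: "0 < B z j" for j
  proof -
    have "F z = 0" if "B z j = 0" using that by (auto simp: F_def)
    then have "B z j \<noteq> 0" using Fz by auto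
    then show ?thesis using z(1) by (auto simp: Q_def less_le)
  qed
  have zG: "0 < G z i j" for i j
  proof -
    have "F z = 0" if "G z i j = 0" using that by (auto simp: F_def)
    then have "G z i j \<noteq> 0" using Fz by auto
    then show ?thesis using z(1) by (auto simp: Q_def less_le)
  qed
  have F_exp: "F x = exp (\<Lambda> x)" if "\<And>i. 0 < A x i" "\<And>j. 0 < B x j" "\<And>i j. 0 < G x i j" for x
  proof -
    have "A x i powr R i = exp (R i * ln (A x i))" "B x j powr S j = exp (S j * ln (B x j))"
      "G x i j powr T i j = exp (T i j * ln (G x i j))" for i j
      using that(1)[of i] that(2)[of j] that(3)[of i j] by (simp_all add: powr_def)
    then show ?thesis by (simp add: F_def \<Lambda>_def exp_add exp_sum)
  qed
  have stationary: "(\<Sum>i\<in>UNIV. R i * (v $ i / A z i)) + (\<Sum>j\<in>UNIV. S j * (- w $ j / B z j))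
      + (\<Sum>i\<in>UNIV. \<Sum>j\<in>UNIV. T i j * (s i j * (w $ j - v $ i) / G z i j)) = 0" for v w
  proof -
    define L where "L t = (\<Sum>i\<in>UNIV. R i * ln (A z i + t * v $ i)) + (\<Sum>j\<in>UNIV. S j * ln (B z j + t * (- w $ j)))
      + (\<Sum>i\<in>UNIV. \<Sum>j\<in>UNIV. T i j * ln (G z i j + t * (s i j * (w $ j - v $ i))))" for t
    define y where "y t = z + t *\<^sub>R (v, w)" for t
    have y: "A (y t) i = A z i + t * v $ i" "B (y t) j = B z j + t * (- w $ j)"
      "G (y t) i j = G z i j + t * (s i j * (w $ j - v $ i))" for t i j
      by (simp_all add: y_def A_def B_def G_def algebra_simps)
    have L: "L t = \<Lambda> (y t)" for t unfolding L_def \<Lambda>_def y ..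
    have deriv: "(L has_real_derivative (\<Sum>i\<in>UNIV. R i * (v $ i / A z i)) + (\<Sum>j\<in>UNIV. S j * (- w $ j / B z j))
      + (\<Sum>i\<in>UNIV. \<Sum>j\<in>UNIV. T i j * (s i j * (w $ j - v $ i) / G z i j))) (at 0)"
      unfolding L_def by (intro DERIV_add DERIV_sum ln_on_line_has_derivative zA zB zG)
    have pos: "\<forall>\<^sub>F t in nhds 0. 0 < c + t * e" if "0 < c" for c e :: real
    proof -
      have "((\<lambda>t. c + t * e) \<longlongrightarrow> c + 0 * e) (nhds 0)"
        by (intro tendsto_intros filterlim_ident)
      then show ?thesis by (rule order_tendstoD(1)) (use that in simp)
    qed
    have "\<forall>\<^sub>F t in nhds 0. (\<forall>i. 0 < A (y t) i) \<and> (\<forall>j. 0 < B (y t) j) \<and> (\<forall>i. \<forall>j. 0 < G (y t) i j)"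
      unfolding y by (intro eventually_conj eventually_all_finite pos zA zB zG)
    then obtain d where d: "d > 0" "\<And>t. dist t 0 < d \<Longrightarrow>
        (\<forall>i. 0 < A (y t) i) \<and> (\<forall>j. 0 < B (y t) j) \<and> (\<forall>i. \<forall>j. 0 < G (y t) i j)"
      unfolding eventually_nhds_metric by blast
    have "L t \<le> L 0" if "\<bar>0 - t\<bar> < d" for t
    proof -
      have t: "\<And>i. 0 < A (y t) i" "\<And>j. 0 < B (y t) j" "\<And>i j. 0 < G (y t) i j"
        using d(2)[of t] that by auto
      then have "y t \<in> Q" by (auto simp: Q_def less_imp_le)
      then have "F (y t) \<le> F z" by (rule z(2))
      then have "exp (L t) \<le> exp (\<Lambda> z)" using F_exp[OF t] F_exp[OF zA zB zG] by (simp add: L)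
      moreover have "y 0 = z" by (simp only: y_def scaleR_zero_left add_0_right)
      ultimately show ?thesis by (simp add: L)
    qed
    then show ?thesis using DERIV_local_max[OF deriv d(1)] by blast
  qed
  define a where "a i = fst z $ i" for i
  define b where "b j = snd z $ j" for j
  have s: "s i j \<noteq> 0" for i j by (simp add: s_def)
  have G: "s i j * t / G z i j = t / (b j - a i)" for i j t
    using s[of i j] by (simp add: G_def a_def b_def)
  have ne: "b j \<noteq> a i" for i j using zG[of i j] by (auto simp: G_def a_def b_def)
  have a: "A z i = a i" "a i > 0" for i using zA[of i] by (simp_all add: A_def a_def)
  have b: "B z j = 1 - b j" "1 - b j > 0" for j using zB[of j] by (simp_all add: B_def b_def)
  have "a i * (\<Sum>j\<in>UNIV. T i j / (b j - a i)) = R i" for i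
  proof -
    have "(\<Sum>k\<in>UNIV. \<Sum>j\<in>UNIV. T k j * ((0 - axis i 1 $ k) / (b j - a k)))
        = (\<Sum>k\<in>UNIV. if k = i then - (\<Sum>j\<in>UNIV. T i j / (b j - a i)) else 0)"
      by (intro sum.cong refl) (simp add: axis_def sum_negf)
    moreover have "(\<Sum>k\<in>UNIV. R k * (axis i 1 $ k / a k)) = (\<Sum>k\<in>UNIV. if k = i then R i / a i else 0)"
      by (intro sum.cong refl) (simp add: axis_def)
    ultimately have "R i / a i = (\<Sum>j\<in>UNIV. T i j / (b j - a i))"
      using stationary[of "axis i 1" 0] by (simp add: G a)
    then show ?thesis using a(2)[of i] by (simp add: divide_eq_eq mult.commute)
  qed
  moreover have "(1 - b j) * (\<Sum>i\<in>UNIV. T i j / (b j - a i)) = S j" for j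
  proof -
    have "(\<Sum>k\<in>UNIV. \<Sum>l\<in>UNIV. T k l * ((axis j 1 $ l - 0) / (b l - a k)))
        = (\<Sum>k\<in>UNIV. \<Sum>l\<in>UNIV. if l = j then T k j / (b j - a k) else 0)"
      by (intro sum.cong refl) (simp add: axis_def)
    moreover have "(\<Sum>l\<in>UNIV. S l * (- axis j 1 $ l / (1 - b l))) = (\<Sum>l\<in>UNIV. if l = j then - (S j / (1 - b j)) else 0)"
      by (intro sum.cong refl) (simp add: axis_def)
    ultimately have "S j / (1 - b j) = (\<Sum>i\<in>UNIV. T i j / (b j - a i))"
      using stationary[of 0 "axis j 1"] by (simp add: G b)
    then show ?thesis using b(2)[of j] by (simp add: divide_eq_eq mult.commute)
  qed
  ultimately have "real_critical a b" using ne by (simp add: real_critical_def)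
  moreover have "order_pattern a b = \<sigma>"
  proof -
    have "a i < b j \<longleftrightarrow> (i, j) \<in> \<sigma>" for i j
      using zG[of i j] by (auto simp: G_def s_def a_def b_def split: if_splits)
    then show ?thesis by (auto simp: order_pattern_def)
  qed
  ultimately show ?thesis by blast
qed

lemma card_fibre_real_data:
  "card (fibre (real_data T R S)) = card (staircases (UNIV :: 'm set) (UNIV :: 'n set))"
proof -
  define pat where "pat x = order_pattern (\<lambda>i. Re (fst x $ i)) (\<lambda>j. Re (fst (snd x) $ j))" for x :: "('m, 'n) data"
  have crit: "real_critical (\<lambda>i. Re (fst x $ i)) (\<lambda>j. Re (fst (snd x) $ j))" if "x \<in> fibre (real_data T R S)" for x
  proof -
    have "real_data T (\<lambda>i. Re (fst x $ i)) (\<lambda>j. Re (fst (snd x) $ j)) \<in> fibre (real_data T R S)"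
      by (subst fibre_real[OF that, symmetric]) (rule that)
    then show ?thesis by (simp only: real_data_in_fibre_iff)
  qed
  have "bij_betw pat (fibre (real_data T R S)) (staircases UNIV UNIV)"
    unfolding bij_betw_def
  proof
    show "inj_on pat (fibre (real_data T R S))"
    proof (rule inj_onI)
      fix x y assume x: "x \<in> fibre (real_data T R S)" and y: "y \<in> fibre (real_data T R S)" and "pat x = pat y"
      then have "(\<lambda>i. Re (fst x $ i)) = (\<lambda>i. Re (fst y $ i))" "(\<lambda>j. Re (fst (snd x) $ j)) = (\<lambda>j. Re (fst (snd y) $ j))"
        using real_critical_unique[OF crit[OF x] crit[OF y]] by (simp_all only: pat_def)
      then have "real_data T (\<lambda>i. Re (fst x $ i)) (\<lambda>j. Re (fst (snd x) $ j)) =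
          real_data T (\<lambda>i. Re (fst y $ i)) (\<lambda>j. Re (fst (snd y) $ j))" by (simp only:)
      then show "x = y" by (subst fibre_real[OF x], subst fibre_real[OF y])
    qed
    show "pat ` fibre (real_data T R S) = staircases UNIV UNIV"
    proof
      show "pat ` fibre (real_data T R S) \<subseteq> staircases UNIV UNIV"
        unfolding pat_def using order_pattern_staircase crit by blast
      show "staircases UNIV UNIV \<subseteq> pat ` fibre (real_data T R S)"
      proof
        fix \<sigma> :: "('m \<times> 'n) set" assume "\<sigma> \<in> staircases UNIV UNIV"
        then obtain a b where ab: "real_critical a b" "order_pattern a b = \<sigma>"
          using real_critical_exists by blast
        have "pat (real_data T a b) = \<sigma>" using ab(2) by (simp add: pat_def real_data_def)
        then show "\<sigma> \<in> pat ` fibre (real_data T R S)" using real_data_in_fibre_iff ab(1) by blast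
      qed
    qed
  qed
  then show ?thesis by (rule bij_betw_same_card)
qed

text \<open>
  Only the pair of constant points has negative weight, and that weight balances all the others
  together. A block without this pair has positive weight, and a proper block with it has negative
  weight.
\<close>

lemma resonance_real_data: "resonance (real_data T R S) \<noteq> 0"
proof -
  define w :: "'m option \<Rightarrow> 'n option \<Rightarrow> real" where "w k l = (case k of
      None \<Rightarrow> (case l of None \<Rightarrow> 0 | Some j \<Rightarrow> S j)
    | Some i \<Rightarrow> (case l of None \<Rightarrow> R i | Some j \<Rightarrow> T i j))" for k l
  define N where "N = (\<Sum>k\<in>UNIV. \<Sum>l\<in>UNIV. w k l)"
  have w_pos: "w k l > 0" if "(k, l) \<noteq> (None, None)" for k l
    using that R_pos S_pos T_pos by (auto simp: w_def split: option.split)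
  have w_nonneg: "w k l \<ge> 0" for k l
    using w_pos[of k l] by (cases "(k, l) = (None, None)") (auto simp: w_def)
  have N: "sample_size (real_data T R S) = of_real N"
    by (simp add: N_def sample_size_def real_data_def w_def sum_UNIV_option sum.distrib)
  have weight: "weight (real_data T R S) k l = of_real (w k l - (if k = None \<and> l = None then N else 0))" for k l
    by (cases k; cases l) (simp_all add: weight_def N w_def, simp_all add: real_data_def)
  have "block_weight (real_data T R S) (C, D) \<noteq> 0" if CD: "(C, D) \<in> proper_blocks" for C D
  proof -
    define r where "r = (\<Sum>k\<in>C. \<Sum>l\<in>D. w k l)"
    have "(\<Sum>k\<in>C. \<Sum>l\<in>D. if k = None \<and> l = None then N else 0) = (\<Sum>k\<in>C. if k = None then if None \<in> D then N else 0 else 0)"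
      by (intro sum.cong refl) auto
    then have "(\<Sum>k\<in>C. \<Sum>l\<in>D. w k l - (if k = None \<and> l = None then N else 0))
        = r - (if None \<in> C \<and> None \<in> D then N else 0)"
      by (simp add: r_def sum_subtractf)
    then have eq: "block_weight (real_data T R S) (C, D) = of_real (r - (if None \<in> C \<and> None \<in> D then N else 0))"
      by (simp only: block_weight_def weight fst_conv snd_conv flip: of_real_sum)
    have r: "r = (\<Sum>(k, l)\<in>C \<times> D. w k l)" by (simp add: r_def sum.cartesian_product)
    show ?thesis
    proof (cases "None \<in> C \<and> None \<in> D")
      case True
      obtain k l where kl: "(k, l) \<notin> C \<times> D" using CD by (auto simp: proper_blocks_def)
      have wkl: "0 < w k l" by (rule w_pos) (use kl True in auto)
      have "r < (\<Sum>(k, l)\<in>UNIV. w k l)"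
        unfolding r by (rule sum_strict_mono2[where b = "(k, l)"]) (use kl wkl w_nonneg in auto)
      also have "\<dots> = N" by (simp add: N_def sum.cartesian_product)
      finally show ?thesis using True by (simp add: eq)
    next
      case False
      obtain k l where kl: "k \<in> C" "l \<in> D" using CD by (auto simp: proper_blocks_def)
      have "0 < w k' l'" if "k' \<in> C" "l' \<in> D" for k' l'
        by (rule w_pos) (use that False in auto)
      then have "0 < r" unfolding r_def by (intro sum_pos) (use kl in auto)
      then show ?thesis unfolding eq using False by auto
    qed
  qed
  then show ?thesis unfolding resonance_nonzero_iff by auto
qed

end


section \<open>The ML-degree\<close>

lemma of_coords_real_data:
  "of_coords (\<lambda>k. of_real (t k)) =
    real_data (\<lambda>i j. t (Inr (Inr (i, j)))) (\<lambda>i. t (Inl i)) (\<lambda>j. t (Inr (Inl j)))"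
  by (simp add: of_coords_def real_data_def)

text \<open>
  The exceptional set is the union of the resonance hyperplanes and the discriminant. Positive
  real data are Zariski dense, so one of them lies outside it, and there the fibre can be counted.
\<close>

lemma fibre_generic_card:
  "\<exists>h. polynomial_on_data h \<and> (\<exists>u :: ('m::finite, 'n::finite) data. h u \<noteq> 0) \<and>
    (\<forall>u. h u \<noteq> 0 \<longrightarrow> resonance u \<noteq> 0 \<and> finite (fibre u) \<and>
       card (fibre u) = card (staircases (UNIV :: 'm set) (UNIV :: 'n set)))"
proof -
  obtain q where q: "polynomial_on_data q" "\<exists>u :: ('m, 'n) data. q u \<noteq> 0"
    "\<And>u. q u \<noteq> 0 \<Longrightarrow> \<forall>x\<in>fibre u. crit_jacobian x \<noteq> 0"
    using discriminant_exists by blast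
  define h where "h u = resonance u * q u" for u :: "('m, 'n) data"
  have h: "polynomial_on_data h"
    unfolding h_def by (intro polynomial_on_data.mult polynomial_resonance q(1))
  have good: "resonance u \<noteq> 0 \<and> (\<forall>x\<in>fibre u. crit_jacobian x \<noteq> 0)" if "h u \<noteq> 0" for u
    using that q(3)[of u] by (auto simp: h_def)
  have "resonance (real_data (\<lambda>(_ :: 'm) (_ :: 'n). 1) (\<lambda>_. 1) (\<lambda>_. 1)) \<noteq> 0"
    by (rule resonance_real_data) auto
  then obtain u0 :: "('m, 'n) data" where "h u0 \<noteq> 0"
    using polynomials_common_nonzero[OF polynomial_resonance q(1)] q(2) unfolding h_def by (metis mult_eq_0_iff)
  then obtain t where t: "\<And>k. t k > 0" "h (of_coords (\<lambda>k. of_real (t k))) \<noteq> 0"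
    using polynomial_nonzero_pos_real[OF h] by blast
  define u1 where "u1 = of_coords (\<lambda>k. complex_of_real (t k))"
  have "card (fibre u1) = card (staircases (UNIV :: 'm set) (UNIV :: 'n set))"
    unfolding u1_def of_coords_real_data by (rule card_fibre_real_data) (simp_all add: t(1))
  then have "card (fibre u) = card (staircases (UNIV :: 'm set) (UNIV :: 'n set))" if "h u \<noteq> 0" for u
    using card_fibre_generically_constant[OF h good that, of u1] t(2) by (simp add: u1_def)
  moreover have "finite (fibre u)" if "h u \<noteq> 0" for u
    by (rule finite_fibre) (use good[OF that] in auto)
  ultimately show ?thesis using h \<open>h u0 \<noteq> 0\<close> good by blast
qed

lemma has_mldegree_staircases:
  "has_mldegree TYPE('m::finite) TYPE('n::finite) (card (staircases (UNIV :: 'm set) (UNIV :: 'n set)))"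
proof -
  obtain h :: "('m, 'n) data \<Rightarrow> complex" where h: "polynomial_on_data h" "\<exists>u. h u \<noteq> 0"
    "\<And>u. h u \<noteq> 0 \<Longrightarrow> resonance u \<noteq> 0 \<and> finite (fibre u) \<and>
       card (fibre u) = card (staircases (UNIV :: 'm set) (UNIV :: 'n set))"
    using fibre_generic_card by blast
  have "algebraic_subset {u. h u = 0}"
    unfolding algebraic_subset_def by (rule exI[of _ "{h}"]) (simp add: h(1))
  moreover have "{u. h u = 0} \<noteq> UNIV" using h(2) by blast
  moreover have "finite (score_solutions R S T) \<and>
      card (score_solutions R S T) = card (staircases (UNIV :: 'm set) (UNIV :: 'n set))"
    if "(R, S, T) \<notin> {u. h u = 0}" for R :: "complex^'m" and S :: "complex^'n" and T :: "complex^'n^'m"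
  proof -
    have good: "resonance (R, S, T) \<noteq> 0" "finite (fibre (R, S, T))"
      "card (fibre (R, S, T)) = card (staircases (UNIV :: 'm set) (UNIV :: 'n set))"
      using h(3) that by auto
    obtain f where "bij_betw f (score_solutions R S T) (fibre (R, S, T))"
      using score_solutions_bij_fibre[of R S T] nonresonant_nonzero[OF good(1)] by auto
    then show ?thesis using good bij_betw_finite bij_betw_same_card by metis
  qed
  ultimately show ?thesis unfolding has_mldegree_def by blast
qed

lemma algebraic_subset_proper:
  assumes "algebraic_subset A" "A \<noteq> UNIV"
  shows "\<exists>f. polynomial_on_data f \<and> (\<exists>u. f u \<noteq> 0) \<and> (\<forall>u\<in>A. f u = 0)"
proof -
  obtain F where F: "\<And>f. f \<in> F \<Longrightarrow> polynomial_on_data f" "A = {x. \<forall>f\<in>F. f x = 0}"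
    using assms(1) unfolding algebraic_subset_def by blast
  then obtain u f where "f \<in> F" "f u \<noteq> 0" using assms(2) by blast
  then show ?thesis using F by blast
qed

text \<open>
  Two proper algebraic subsets do not cover the data space.
\<close>

lemma has_mldegree_unique:
  fixes M :: "'m::finite itself" and N :: "'n::finite itself"
  assumes "has_mldegree M N d" and "has_mldegree M N e"
  shows "d = e"
proof -
  obtain A :: "('m, 'n) data set" where A: "algebraic_subset A" "A \<noteq> UNIV"
    "\<And>R S T. (R, S, T) \<notin> A \<Longrightarrow> card (score_solutions R S T) = d"
    using assms(1) unfolding has_mldegree_def by blast
  obtain B :: "('m, 'n) data set" where B: "algebraic_subset B" "B \<noteq> UNIV"
    "\<And>R S T. (R, S, T) \<notin> B \<Longrightarrow> card (score_solutions R S T) = e"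
    using assms(2) unfolding has_mldegree_def by blast
  obtain f u where f: "polynomial_on_data f" "f u \<noteq> 0" "\<forall>x\<in>A. f x = 0"
    using algebraic_subset_proper[OF A(1,2)] by blast
  obtain g v where g: "polynomial_on_data g" "g v \<noteq> 0" "\<forall>x\<in>B. g x = 0"
    using algebraic_subset_proper[OF B(1,2)] by blast
  obtain w where w: "f w \<noteq> 0" "g w \<noteq> 0"
    using polynomials_common_nonzero[OF f(1) g(1) f(2) g(2)] by blast
  obtain R S T where "w = (R, S, T)" by (cases w)
  moreover have "w \<notin> A" "w \<notin> B" using w f(3) g(3) by auto
  ultimately show ?thesis using A(3)[of R S T] B(3)[of R S T] by simp
qed

theorem theorem3p2:
  shows "has_mldegree TYPE('m::finite) TYPE('n::finite) (mldegree TYPE('m) TYPE('n)) \<and>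
    int (mldegree TYPE('m) TYPE('n)) =
      (\<Sum>k=0..CARD('m). \<Sum>l=0..CARD('n). (-1) ^ (k + l) * int (CARD('m) choose k) *
         int (CARD('n) choose l) * poly_Bernoulli (CARD('m) - k) (CARD('n) - l))"
proof -
  let ?d = "card (staircases (UNIV :: 'm set) (UNIV :: 'n set))"
  note has = has_mldegree_staircases[where 'm = 'm and 'n = 'n]
  have eq: "mldegree TYPE('m) TYPE('n) = ?d"
    unfolding mldegree_def by (rule the_equality) (use has has_mldegree_unique in blast)+
  have "int ?d = (\<Sum>k=0..CARD('m). \<Sum>l=0..CARD('n). (-1) ^ (k + l) * int (CARD('m) choose k) *
         int (CARD('n) choose l) * poly_Bernoulli (CARD('m) - k) (CARD('n) - l))"
    unfolding sum_poly_Bernoulli using card_staircases[of "UNIV :: 'm set" "UNIV :: 'n set"] by simp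
  then show ?thesis using has unfolding eq by blast
qed

end
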